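(* Let $a$ be a symbol, $c$ a constant, and $w$ a fixed word with $|w|=c$. Then the parameterized problem $\mathsf{SimplePath}(a^k w? a^* )$ — given an edge-labeled directed graph $G$, nodes $s,t$, and $k\in\mathbb N$, is there a simple path from $s$ to $t$ whose label is in $L(a^k w? a^* )=\{a^{k}a^{m}\mid m\ge0\}\cup\{a^k w a^m\mid m\ge 0\}$? — is in FPT with parameter $k$.
   Context: A simple path has no repeated nodes; its label is the word of its edge labels. FPT: decidable in time $f(k)\cdot(|G|+k)^{O(1)}$ for a computable $f$. *)

theory Defs
  imports Main
begin

datatype instr =
    Const nat nat
  | Add nat nat nat
  | Sub nat nat nat
  | Load nat nat
  | Store nat nat
  | Jz nat nat
  | Halt

type_synonym config = "nat \<times> (nat \<Rightarrow> nat)"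

definition halted :: "instr list \<Rightarrow> config \<Rightarrow> bool" where
  "halted P c \<longleftrightarrow> fst c \<ge> length P \<or> P ! fst c = Halt"

fun exec :: "instr \<Rightarrow> config \<Rightarrow> config" where
  "exec (Const r x) (pc, m) = (Suc pc, m(r := x))"
| "exec (Add r i j) (pc, m) = (Suc pc, m(r := m i + m j))"
| "exec (Sub r i j) (pc, m) = (Suc pc, m(r := m i - m j))"
| "exec (Load r i) (pc, m) = (Suc pc, m(r := m (m i)))"
| "exec (Store i j) (pc, m) = (Suc pc, m(m i := m j))"
| "exec (Jz i l) (pc, m) = (if m i = 0 then (l, m) else (Suc pc, m))"
| "exec Halt (pc, m) = (pc, m)"

definition step :: "instr list \<Rightarrow> config \<Rightarrow> config" where
  "step P c = (if halted P c then c else exec (P ! fst c) c)"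

definition run :: "instr list \<Rightarrow> nat \<Rightarrow> config \<Rightarrow> config" where
  "run P t c = (step P ^^ t) c"

definition init :: "nat list \<Rightarrow> config" where
  "init xs = (0, (\<lambda>i. if i = 0 then length xs
                      else if i \<le> length xs then xs ! (i - 1) else 0))"

definition halts_with :: "instr list \<Rightarrow> nat list \<Rightarrow> nat \<Rightarrow> nat \<Rightarrow> bool" where
  "halts_with P xs t y \<longleftrightarrow> halted P (run P t (init xs)) \<and> snd (run P t (init xs)) 0 = y"

definition computable :: "(nat \<Rightarrow> nat) \<Rightarrow> bool" where
  "computable f \<longleftrightarrow> (\<exists>P. \<forall>n. \<exists>t. halts_with P [n] t (f n))"

text \<open>A graph instance: nodes are 0..<n, edges is a list of labelled edges (u, label, v),
  symbols are natural numbers.\<close>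
type_synonym edge = "nat \<times> nat \<times> nat"

definition wf_graph :: "nat \<Rightarrow> edge list \<Rightarrow> bool" where
  "wf_graph n es \<longleftrightarrow> (\<forall>(u, l, v) \<in> set es. u < n \<and> v < n)"

definition is_simple_path ::
  "edge list \<Rightarrow> nat \<Rightarrow> nat \<Rightarrow> nat list \<Rightarrow> nat list \<Rightarrow> bool" where
  "is_simple_path es s t vs ls \<longleftrightarrow>
     vs \<noteq> [] \<and> hd vs = s \<and> last vs = t \<and> distinct vs \<and>
     length vs = Suc (length ls) \<and>
     (\<forall>i < length ls. (vs ! i, ls ! i, vs ! Suc i) \<in> set es)"

definition SimplePath :: "nat list set \<Rightarrow> edge list \<Rightarrow> nat \<Rightarrow> nat \<Rightarrow> bool" where
  "SimplePath L es s t \<longleftrightarrow> (\<exists>vs ls. is_simple_path es s t vs ls \<and> ls \<in> L)"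

definition lang_akwa :: "nat \<Rightarrow> nat list \<Rightarrow> nat \<Rightarrow> nat list set" where
  "lang_akwa a w k =
     {replicate k a @ replicate m a | m. True} \<union> {replicate k a @ w @ replicate m a | m. True}"

definition encode :: "nat \<Rightarrow> edge list \<Rightarrow> nat \<Rightarrow> nat \<Rightarrow> nat \<Rightarrow> nat list" where
  "encode n es s t k = [n, s, t, k, length es] @ concat (map (\<lambda>(u, l, v). [u, l, v]) es)"

definition graph_size :: "nat \<Rightarrow> edge list \<Rightarrow> nat" where
  "graph_size n es = n + length es"

definition FPT :: "(nat \<Rightarrow> edge list \<Rightarrow> nat \<Rightarrow> nat \<Rightarrow> nat \<Rightarrow> bool) \<Rightarrow> bool" where
  "FPT Q \<longleftrightarrow> (\<exists>P f c. computable f \<and>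
     (\<forall>n es s t k. wf_graph n es \<and> s < n \<and> t < n \<longrightarrow>
        (\<exists>T \<le> f k * (graph_size n es + k + 2) ^ c.
            halts_with P (encode n es s t k) T (if Q n es s t k then 1 else 0))))"

end

(* Guess the w-part node by node; the difficulty is an a-labelled k-path A from s that avoids an
   a-labelled path of unbounded length. Let B consist of the w-part and the last k nodes of a solution.
   Some modulus m = O((2k+|w|)^2 log n) is injective on A and B, since otherwise the product of the
   differences would be a multiple of 1,...,m and hence at least 2^(m-1). Trying all m and all colour
   sequences of length k costs (k log n)^(O(k)), which is FPT. For the right guess, a layered search that
   visits colour i in round i finds a k-path A' with the same end as A which is disjoint from B, and any
   such A' will do: if A' meets the remaining part of the solution in z, then following A' up to z and the
   solution from z on gives a path in a^k a^*, and this is shorter than the solution if w is empty. So the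
   shortest a^k a^* path is found, and if there is none, then A' extends to a solution. *)
theory Submission
  imports Defs
begin

subsection \<open>A structured language with counting loops\<close>

text \<open>Keeping \<open>B\<close> small is what makes the guess affordable: the middle of a
  solution has unbounded length and cannot be coloured apart from \<open>A\<close>. The last
  \<open>k\<close> nodes belong to \<open>B\<close> so that a crossing \<open>z\<close> outside
  \<open>B\<close> is followed by at least \<open>k\<close> edges labelled \<open>a\<close>; the
  shortcut through \<open>z\<close> then keeps a label \<open>a^k'\<close> with
  \<open>k' >= k\<close>, however short its first part is. Wrong guesses cost only time, since every
  continuation is tested against the nodes of the path actually found. The modulus depends on log n,
  and the factor (log n)^(O(k)) is harmless because x^q <= q^q * 2^x turns it into a function of
  \<open>k\<close> times a linear function of \<open>n\<close>. The claim concerns step counts of a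
  concrete machine that can add, subtract and jump on zero, but neither multiply nor divide. The
  algorithm is therefore written in a loop language in which all programs terminate and is
  translated by a verified compiler. Its running time is polynomial in the largest loop limit, about
  \<open>M ^ (k + 1)\<close> for the base \<open>M\<close> of the guesses.\<close>

datatype loc = Var nat | Arr nat nat

type_synonym store = "loc \<Rightarrow> nat"

datatype aexp = N nat | X nat | Get nat aexp | Plus aexp aexp | Minus aexp aexp

datatype cmd =
    Skip
  | Asg nat aexp
  | Put nat aexp aexp
  | Seq cmd cmd (infixr ";;" 60)
  | Cond aexp cmd cmd
  | For nat nat cmd

primrec val :: "aexp \<Rightarrow> store \<Rightarrow> nat" where
  "val (N c) \<sigma> = c"
| "val (X x) \<sigma> = \<sigma> (Var x)"
| "val (Get j e) \<sigma> = \<sigma> (Arr j (val e \<sigma>))"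
| "val (Plus e f) \<sigma> = val e \<sigma> + val f \<sigma>"
| "val (Minus e f) \<sigma> = val e \<sigma> - val f \<sigma>"

text \<open>The number of passes is fixed on entry, so every program terminates and its semantics is
  a plain function without fuel.\<close>

primrec loop :: "nat \<Rightarrow> (store \<Rightarrow> store) \<Rightarrow> nat \<Rightarrow> store \<Rightarrow> store" where
  "loop x f 0 \<sigma> = \<sigma>(Var x := 0)"
| "loop x f (Suc i) \<sigma> = (f (loop x f i \<sigma>))(Var x := Suc i)"

primrec sem :: "cmd \<Rightarrow> store \<Rightarrow> store" where
  "sem Skip \<sigma> = \<sigma>"
| "sem (Asg x e) \<sigma> = \<sigma>(Var x := val e \<sigma>)"
| "sem (Put j e f) \<sigma> = \<sigma>(Arr j (val e \<sigma>) := val f \<sigma>)"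
| "sem (c ;; d) \<sigma> = sem d (sem c \<sigma>)"
| "sem (Cond e c d) \<sigma> = (if val e \<sigma> \<noteq> 0 then sem c \<sigma> else sem d \<sigma>)"
| "sem (For x y c) \<sigma> = loop x (sem c) (\<sigma> (Var y)) \<sigma>"

primrec writes :: "cmd \<Rightarrow> loc set" where
  "writes Skip = {}"
| "writes (Asg x e) = {Var x}"
| "writes (Put j e f) = range (Arr j)"
| "writes (c ;; d) = writes c \<union> writes d"
| "writes (Cond e c d) = writes c \<union> writes d"
| "writes (For x y c) = insert (Var x) (writes c)"

lemma loop_frame:
  assumes "\<And>\<sigma>. f \<sigma> l = \<sigma> l" and "l \<noteq> Var x"
  shows "loop x f i \<sigma> l = \<sigma> l"
  using assms by (induction i) auto

lemma sem_frame: "l \<notin> writes c \<Longrightarrow> sem c \<sigma> l = \<sigma> l"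
  by (induction c arbitrary: \<sigma>) (auto intro: loop_frame)

lemma loop_var [simp]: "loop x f i \<sigma> (Var x) = i"
  by (induction i) auto

lemma loop_invariant:
  assumes "I 0 (\<sigma>(Var x := 0))"
    and "\<And>i s. i < b \<Longrightarrow> I i s \<Longrightarrow> s (Var x) = i \<Longrightarrow> I (Suc i) ((f s)(Var x := Suc i))"
  shows "I b (loop x f b \<sigma>)"
proof -
  have "i \<le> b \<Longrightarrow> I i (loop x f i \<sigma>)" for i
    by (induction i) (use assms in auto)
  then show ?thesis by simp
qed

subsection \<open>Compilation to the random access machine\<close>

text \<open>Variables sit at the bottom of the memory, followed by 16 temporaries for evaluating expressions.
  Up to eight arrays of unbounded length are interleaved above them, so that distinct cells never
  collide and no array sizes have to be known.\<close>

definition address :: "nat \<Rightarrow> loc \<Rightarrow> nat" where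
  "address nv l = (case l of Var x \<Rightarrow> x | Arr j i \<Rightarrow> nv + 16 + 8 * i + j)"

definition valid :: "nat \<Rightarrow> loc \<Rightarrow> bool" where
  "valid nv l = (case l of Var x \<Rightarrow> x < nv | Arr j i \<Rightarrow> j < 8)"

definition represents :: "nat \<Rightarrow> store \<Rightarrow> (nat \<Rightarrow> nat) \<Rightarrow> bool" where
  "represents nv \<sigma> m \<longleftrightarrow> (\<forall>l. valid nv l \<longrightarrow> m (address nv l) = \<sigma> l)"

lemma address_simps [simp]:
  "address nv (Var x) = x" "address nv (Arr j i) = nv + 16 + 8 * i + j"
  "valid nv (Var x) \<longleftrightarrow> x < nv" "valid nv (Arr j i) \<longleftrightarrow> j < 8"
  by (auto simp: address_def valid_def)

lemma address_inj: "valid nv l \<Longrightarrow> valid nv l' \<Longrightarrow> address nv l = address nv l' \<Longrightarrow> l = l'"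
proof (cases l; cases l')
  fix j i j' i'
  assume *: "valid nv l" "valid nv l'" "address nv l = address nv l'" "l = Arr j i" "l' = Arr j' i'"
  then have "8 * i + j = 8 * i' + j'" "j < 8" "j' < 8" by auto
  then have "(8 * i + j) div 8 = (8 * i' + j') div 8" "j < 8" "j' < 8" by simp_all
  with \<open>8 * i + j = 8 * i' + j'\<close> have "i = i'" by simp
  with \<open>8 * i + j = 8 * i' + j'\<close> have "j = j'" by simp
  with * \<open>i = i'\<close> show ?thesis by simp
qed auto

lemma address_not_temp: "valid nv l \<Longrightarrow> address nv l < nv \<or> nv + 16 \<le> address nv l"
  by (cases l) auto

lemma represents_update:
  assumes "represents nv \<sigma> m" "valid nv l"
  shows "represents nv (\<sigma>(l := v)) (m(address nv l := v))"
  using assms address_inj unfolding represents_def by auto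

lemma represents_cong:
  assumes "represents nv \<sigma> m" and "\<And>p. p < nv \<or> nv + 16 \<le> p \<Longrightarrow> m' p = m p"
  shows "represents nv \<sigma> m'"
  using assms address_not_temp unfolding represents_def by fastforce

text \<open>Three doublings scale the index by the interleaving factor 8; the cell
  \<open>Suc t\<close> serves as scratch space.\<close>

definition index_code :: "nat \<Rightarrow> nat \<Rightarrow> nat \<Rightarrow> instr list" where
  "index_code nv t j =
     [Add t t t, Add t t t, Add t t t, Const (Suc t) (nv + 16 + j), Add t t (Suc t)]"

primrec compile_exp :: "nat \<Rightarrow> nat \<Rightarrow> aexp \<Rightarrow> instr list" where
  "compile_exp nv d (N c) = [Const (nv + d) c]"
| "compile_exp nv d (X x) = [Const (nv + d) 0, Add (nv + d) x (nv + d)]"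
| "compile_exp nv d (Get j e) = compile_exp nv d e @ index_code nv (nv + d) j @ [Load (nv + d) (nv + d)]"
| "compile_exp nv d (Plus e f) = compile_exp nv d e @ compile_exp nv (Suc d) f @ [Add (nv + d) (nv + d) (Suc (nv + d))]"
| "compile_exp nv d (Minus e f) = compile_exp nv d e @ compile_exp nv (Suc d) f @ [Sub (nv + d) (nv + d) (Suc (nv + d))]"

text \<open>Depth \<open>d\<close> stands for the temporary \<open>nv + d\<close>, of which there
  are 16; array access needs the next one as scratch space, hence \<open>d < 15\<close>
  there.\<close>

primrec wfE :: "nat \<Rightarrow> nat \<Rightarrow> aexp \<Rightarrow> bool" where
  "wfE nv d (N c) \<longleftrightarrow> d < 16"
| "wfE nv d (X x) \<longleftrightarrow> d < 16 \<and> x < nv"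
| "wfE nv d (Get j e) \<longleftrightarrow> d < 15 \<and> j < 8 \<and> wfE nv d e"
| "wfE nv d (Plus e f) \<longleftrightarrow> wfE nv d e \<and> wfE nv (Suc d) f"
| "wfE nv d (Minus e f) \<longleftrightarrow> wfE nv d e \<and> wfE nv (Suc d) f"

text \<open>Jump targets are absolute, so the address of the block is a parameter. An unconditional
  jump is a jump on zero right after clearing \<open>nv\<close>, and a loop ends once the truncated
  difference of limit and counter is zero.\<close>

primrec compile :: "nat \<Rightarrow> nat \<Rightarrow> cmd \<Rightarrow> instr list" where
  "compile nv pc Skip = []"
| "compile nv pc (Asg x e) = compile_exp nv 0 e @ [Const (Suc nv) 0, Add x nv (Suc nv)]"
| "compile nv pc (Put j e f) =
     compile_exp nv 0 e @ index_code nv nv j @ compile_exp nv 1 f @ [Store nv (Suc nv)]"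
| "compile nv pc (c ;; d) = (let C = compile nv pc c in C @ compile nv (pc + length C) d)"
| "compile nv pc (Cond e c d) =
     (let T = compile_exp nv 0 e;
          C = compile nv (pc + length T + 1) c;
          D = compile nv (pc + length T + length C + 3) d
      in T @ [Jz nv (pc + length T + length C + 3)] @ C @
         [Const nv 0, Jz nv (pc + length T + length C + 3 + length D)] @ D)"
| "compile nv pc (For x y c) =
     (let C = compile nv (pc + 3) c
      in [Const x 0, Sub nv y x, Jz nv (pc + 7 + length C)] @ C @
         [Const nv 1, Add x x nv, Const nv 0, Jz nv (pc + 1)])"

text \<open>Compiled loops reread \<open>y\<close> at every test and increment \<open>x\<close>;
  this agrees with \<open>loop\<close> because the body writes neither.\<close>

primrec wfC :: "nat \<Rightarrow> cmd \<Rightarrow> bool" where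
  "wfC nv Skip \<longleftrightarrow> True"
| "wfC nv (Asg x e) \<longleftrightarrow> x < nv \<and> wfE nv 0 e"
| "wfC nv (Put j e f) \<longleftrightarrow> j < 8 \<and> wfE nv 0 e \<and> wfE nv 1 f"
| "wfC nv (c ;; d) \<longleftrightarrow> wfC nv c \<and> wfC nv d"
| "wfC nv (Cond e c d) \<longleftrightarrow> wfE nv 0 e \<and> wfC nv c \<and> wfC nv d"
| "wfC nv (For x y c) \<longleftrightarrow> x < nv \<and> y < nv \<and> x \<noteq> y \<and> Var x \<notin> writes c \<and> Var y \<notin> writes c \<and> wfC nv c"

text \<open>\<^term>\<open>bounded_loops B c \<sigma>\<close> bounds every loop limit that is met when \<^term>\<open>c\<close> runs from
  \<^term>\<open>\<sigma>\<close>. Loop limits are mostly read-only, so this is a syntactic matter, and it is all that the time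
  bound depends on.\<close>

primrec bounded_loops :: "nat \<Rightarrow> cmd \<Rightarrow> store \<Rightarrow> bool" where
  "bounded_loops B Skip \<sigma> \<longleftrightarrow> True"
| "bounded_loops B (Asg x e) \<sigma> \<longleftrightarrow> True"
| "bounded_loops B (Put j e f) \<sigma> \<longleftrightarrow> True"
| "bounded_loops B (c ;; d) \<sigma> \<longleftrightarrow> bounded_loops B c \<sigma> \<and> bounded_loops B d (sem c \<sigma>)"
| "bounded_loops B (Cond e c d) \<sigma> \<longleftrightarrow> bounded_loops B c \<sigma> \<and> bounded_loops B d \<sigma>"
| "bounded_loops B (For x y c) \<sigma> \<longleftrightarrow>
     \<sigma> (Var y) \<le> B \<and> (\<forall>i < \<sigma> (Var y). bounded_loops B c (loop x (sem c) i \<sigma>))"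

primrec limits :: "cmd \<Rightarrow> loc set" where
  "limits Skip = {}"
| "limits (Asg x e) = {}"
| "limits (Put j e f) = {}"
| "limits (c ;; d) = limits c \<union> limits d"
| "limits (Cond e c d) = limits c \<union> limits d"
| "limits (For x y c) = insert (Var y) (limits c)"

lemma bounded_loopsI:
  assumes "limits c \<inter> writes c = {}" and "\<And>l. l \<in> limits c \<Longrightarrow> \<sigma> l \<le> B"
  shows "bounded_loops B c \<sigma>"
  using assms
proof (induction c arbitrary: \<sigma>)
  case (Seq c d)
  have "sem c \<sigma> l \<le> B" if "l \<in> limits d" for l
  proof -
    have "l \<notin> writes c" using Seq.prems(1) that by auto
    then have "sem c \<sigma> l = \<sigma> l" by (rule sem_frame)
    then show ?thesis using Seq.prems(2) that by simp
  qed
  moreover have "bounded_loops B c \<sigma>"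
    by (rule Seq.IH(1)) (use Seq.prems in auto)
  moreover have "limits d \<inter> writes d = {}" using Seq.prems(1) by auto
  ultimately show ?case using Seq.IH(2) by simp
next
  case (Cond e c d)
  then have "limits c \<inter> writes c = {}" "limits d \<inter> writes d = {}" by auto
  with Cond show ?case by simp
next
  case (For x y c)
  have "bounded_loops B c (loop x (sem c) i \<sigma>)" for i
  proof (rule For.IH)
    fix l assume l: "l \<in> limits c"
    then have "l \<notin> writes c" "l \<noteq> Var x" using For.prems(1) by auto
    then have "loop x (sem c) i \<sigma> l = \<sigma> l" by (intro loop_frame sem_frame)
    then show "loop x (sem c) i \<sigma> l \<le> B" using For.prems(2) l by simp
  qed (use For.prems in auto)
  then show ?case using For.prems(2) by simp
qed auto

text \<open>Both branches of a conditional are charged. A loop pays 6 steps around its body in each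
  pass (test 2, increment and jump back 4), and 3 more for entry and the final test.\<close>

primrec time_bound :: "nat \<Rightarrow> nat \<Rightarrow> cmd \<Rightarrow> nat" where
  "time_bound nv B Skip = 0"
| "time_bound nv B (Asg x e) = length (compile_exp nv 0 e) + 2"
| "time_bound nv B (Put j e f) = length (compile_exp nv 0 e) + length (compile_exp nv 1 f) + 6"
| "time_bound nv B (c ;; d) = time_bound nv B c + time_bound nv B d"
| "time_bound nv B (Cond e c d) =
     length (compile_exp nv 0 e) + 3 + time_bound nv B c + time_bound nv B d"
| "time_bound nv B (For x y c) = 3 + B * (time_bound nv B c + 6)"

lemma le_power_const: "(c::nat) \<le> (B + 2) ^ c"
proof -
  have "c \<le> 2 ^ c" using less_exp[of c] by (rule less_imp_le)
  also have "\<dots> \<le> (B + 2) ^ c" by (rule power_mono) auto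
  finally show ?thesis .
qed

lemma add_le_power:
  assumes "a \<le> (B + 2) ^ d" "b \<le> (B + 2) ^ e"
  shows "a + b \<le> ((B::nat) + 2) ^ (d + e + 1)"
proof -
  have "a + b \<le> (B + 2) ^ d + (B + 2) ^ e" using assms by simp
  also have "\<dots> \<le> (B + 2) ^ (d + e) + (B + 2) ^ (d + e)"
    by (intro add_mono power_increasing) auto
  also have "\<dots> = 2 * (B + 2) ^ (d + e)" by simp
  also have "\<dots> \<le> (B + 2) * (B + 2) ^ (d + e)" by (intro mult_le_mono1) simp
  finally show ?thesis by simp
qed

text \<open>The degree depends on the program and not on \<open>B\<close>. The base
  \<open>B + 2\<close> is at least 2, so that constants and sums can be absorbed into the
  exponent.\<close>

lemma time_bound_polynomial: "\<exists>d. \<forall>B. time_bound nv B c \<le> (B + 2) ^ d"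
proof (induction c)
  case (Seq c d)
  then obtain p q where "time_bound nv B c \<le> (B + 2) ^ p" "time_bound nv B d \<le> (B + 2) ^ q" for B
    by blast
  then have "time_bound nv B (c ;; d) \<le> (B + 2) ^ (p + q + 1)" for B
    unfolding time_bound.simps by (rule add_le_power)
  then show ?case by blast
next
  case (Cond e c d)
  then obtain p q where "time_bound nv B c \<le> (B + 2) ^ p" "time_bound nv B d \<le> (B + 2) ^ q" for B
    by blast
  then have "time_bound nv B (Cond e c d) \<le> (B + 2) ^ (length (compile_exp nv 0 e) + 3 + p + 1 + q + 1)" for B
    unfolding time_bound.simps by (intro add_le_power le_power_const)
  then show ?case by blast
next
  case (For x y c)
  then obtain p where p: "time_bound nv B c \<le> (B + 2) ^ p" for B by blast
  have "time_bound nv B (For x y c) \<le> (B + 2) ^ (3 + (1 + (p + 6 + 1)) + 1)" for B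
  proof -
    have "time_bound nv B c + 6 \<le> (B + 2) ^ (p + 6 + 1)" using add_le_power p le_power_const by blast
    then have "B * (time_bound nv B c + 6) \<le> (B + 2) ^ (1 + (p + 6 + 1))"
      unfolding power_add[of _ 1] by (intro mult_le_mono) auto
    then show ?thesis
      unfolding time_bound.simps by (intro add_le_power le_power_const)
  qed
  then show ?case by blast
next
  case (Asg x e)
  show ?case unfolding time_bound.simps using le_power_const by blast
next
  case (Put j e f)
  show ?case unfolding time_bound.simps using le_power_const by blast
qed auto

section \<open>Execution of code blocks inside a machine program\<close>

definition effect :: "instr \<Rightarrow> (nat \<Rightarrow> nat) \<Rightarrow> nat \<Rightarrow> nat" where
  "effect i m = snd (exec i (0, m))"

definition straight :: "instr \<Rightarrow> bool" where
  "straight i \<longleftrightarrow> i \<noteq> Halt \<and> (\<forall>r p. i \<noteq> Jz r p)"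

lemma effect_simps [simp]:
  "effect (Const r x) m = m(r := x)"
  "effect (Add r i j) m = m(r := m i + m j)"
  "effect (Sub r i j) m = m(r := m i - m j)"
  "effect (Load r i) m = m(r := m (m i))"
  "effect (Store i j) m = m(m i := m j)"
  by (auto simp: effect_def)

lemma straight_simps [simp]:
  "straight (Const r x)" "straight (Add r i j)" "straight (Sub r i j)"
  "straight (Load r i)" "straight (Store i j)"
  by (auto simp: straight_def)

definition code_at :: "instr list \<Rightarrow> nat \<Rightarrow> instr list \<Rightarrow> bool" where
  "code_at P pc is \<longleftrightarrow> (\<exists>pre post. P = pre @ is @ post \<and> length pre = pc)"

lemma code_at_append: "code_at P pc (xs @ ys) \<longleftrightarrow> code_at P pc xs \<and> code_at P (pc + length xs) ys"
proof
  assume "code_at P pc (xs @ ys)"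
  then obtain pre post where "P = pre @ (xs @ ys) @ post" "length pre = pc"
    unfolding code_at_def by blast
  then have "P = pre @ xs @ (ys @ post)" "P = (pre @ xs) @ ys @ post" "length (pre @ xs) = pc + length xs"
    by auto
  then show "code_at P pc xs \<and> code_at P (pc + length xs) ys"
    using \<open>length pre = pc\<close> unfolding code_at_def by blast
next
  assume "code_at P pc xs \<and> code_at P (pc + length xs) ys"
  then obtain pre post pre' post' where
    *: "P = pre @ xs @ post" "length pre = pc" "P = pre' @ ys @ post'" "length pre' = pc + length xs"
    unfolding code_at_def by blast
  then have "pre' = pre @ xs" by (metis append.assoc append_eq_append_conv length_append)
  with * show "code_at P pc (xs @ ys)" unfolding code_at_def by auto
qed

lemma code_at_Cons: "code_at P pc (i # is) \<longleftrightarrow> code_at P pc [i] \<and> code_at P (Suc pc) is"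
  using code_at_append[of P pc "[i]" "is"] by simp

lemma code_at_shift: "code_at P pc is \<Longrightarrow> pc = pc' \<Longrightarrow> code_at P pc' is"
  by simp

lemma code_at_singleton: "code_at P pc [i] \<Longrightarrow> pc < length P \<and> P ! pc = i"
  unfolding code_at_def by (auto simp: nth_append)

lemma code_at_whole: "code_at P 0 P"
  unfolding code_at_def by simp

definition reach :: "instr list \<Rightarrow> nat \<Rightarrow> config \<Rightarrow> config \<Rightarrow> bool" where
  "reach P T c c' \<longleftrightarrow> (\<exists>t \<le> T. run P t c = c')"

lemma reach_refl: "reach P T c c"
  unfolding reach_def run_def by (intro exI[of _ 0]) auto

lemma reach_trans: "reach P T c c' \<Longrightarrow> reach P U c' c'' \<Longrightarrow> reach P (T + U) c c''"
proof -
  assume "reach P T c c'" "reach P U c' c''"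
  then obtain t u where "t \<le> T" "run P t c = c'" "u \<le> U" "run P u c' = c''"
    unfolding reach_def by blast
  then have "run P (u + t) c = c''" "u + t \<le> T + U" unfolding run_def by (auto simp: funpow_add)
  then show ?thesis unfolding reach_def by blast
qed

lemma reach_mono: "reach P T c c' \<Longrightarrow> T \<le> U \<Longrightarrow> reach P U c c'"
  unfolding reach_def using le_trans by blast

lemma reach_straight:
  assumes "code_at P pc is" "\<forall>i \<in> set is. straight i"
  shows "reach P (length is) (pc, m) (pc + length is, fold effect is m)"
  using assms
proof (induction "is" arbitrary: pc m)
  case Nil
  then show ?case by (simp add: reach_refl)
next
  case (Cons i "is")
  then have "pc < length P" "P ! pc = i" "straight i" "code_at P (Suc pc) is"
    using code_at_Cons[of P pc i "is"] code_at_singleton[of P pc i] by simp_all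
  moreover have "exec i (pc, m) = (Suc pc, effect i m)"
    using \<open>straight i\<close> by (cases i) (auto simp: straight_def)
  ultimately have "run P 1 (pc, m) = (Suc pc, effect i m)"
    unfolding run_def by (auto simp: step_def halted_def straight_def)
  then have "reach P 1 (pc, m) (Suc pc, effect i m)" unfolding reach_def by blast
  from reach_trans[OF this Cons.IH[OF \<open>code_at P (Suc pc) is\<close>]] Cons.prems
  show ?case by simp
qed

lemma reach_Jz:
  assumes "code_at P pc [Jz r p]"
  shows "reach P 1 (pc, m) (if m r = 0 then p else Suc pc, m)"
proof -
  have "pc < length P" "P ! pc = Jz r p" using assms code_at_singleton by auto
  then have "run P 1 (pc, m) = (if m r = 0 then p else Suc pc, m)"
    unfolding run_def by (auto simp: step_def halted_def)
  then show ?thesis unfolding reach_def by blast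
qed

section \<open>Correctness of the compiler\<close>

lemma straight_index_code: "i \<in> set (index_code nv t j) \<Longrightarrow> straight i"
  by (auto simp: index_code_def)

lemma straight_compE: "i \<in> set (compile_exp nv d e) \<Longrightarrow> straight i"
  by (induction e arbitrary: d) (auto dest: straight_index_code)

lemma fold_index_code:
  "fold effect (index_code nv t j) m =
     m(t := nv + 16 + 8 * m t + j, Suc t := nv + 16 + j)"
  by (auto simp: index_code_def fun_eq_iff)

lemma wfE_depth: "wfE nv d e \<Longrightarrow> d < 16"
  by (induction e) auto

text \<open>Since nothing below \<open>nv + d\<close> changes, the value of a left operand survives
  the evaluation of the right one at depth \<open>Suc d\<close>.\<close>

lemma compile_exp_correct:
  assumes "wfE nv d e" "represents nv \<sigma> m"
  shows "fold effect (compile_exp nv d e) m (nv + d) = val e \<sigma>"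
    and "p < nv + d \<or> nv + 16 \<le> p \<Longrightarrow> fold effect (compile_exp nv d e) m p = m p"
  using assms
proof (induction e arbitrary: d m p)
  case (N c)
  { case 1 then show ?case by simp next case 2 then show ?case by auto }
next
  case (X x)
  { case 1 then show ?case unfolding represents_def by (auto dest: spec[of _ "Var x"])
  next case 2 then show ?case by auto }
next
  case (Get j e)
  { case 1
    let ?m = "fold effect (compile_exp nv d e) m"
    have "?m (nv + d) = val e \<sigma>" using Get.IH(1) 1 by simp
    moreover have "?m (nv + 16 + 8 * val e \<sigma> + j) = \<sigma> (Arr j (val e \<sigma>))"
      using 1 Get.IH(2)[of "nv + 16 + 8 * val e \<sigma> + j" d m]
      unfolding represents_def by (auto dest: spec[of _ "Arr j (val e \<sigma>)"])
    ultimately show ?case using 1 by (auto simp: fold_index_code)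
  next
    case 2
    then show ?case using Get.IH(2)[of p d m] by (auto simp: fold_index_code)
  }
next
  case (Plus e f)
  have IH: "represents nv \<sigma> (fold effect (compile_exp nv d e) m)"
    if "wfE nv d e" "represents nv \<sigma> m" for m d
    by (rule represents_cong[OF that(2)]) (use Plus.IH(2) that in auto)
  { case 1
    then have r: "represents nv \<sigma> (fold effect (compile_exp nv d e) m)" using IH by simp
    with 1 show ?case
      using Plus.IH(1)[of d m] Plus.IH(3)[OF _ r, of "Suc d"] Plus.IH(4)[OF _ _ r, of "nv + d" "Suc d"]
      by simp
  next
    case 2
    then have r: "represents nv \<sigma> (fold effect (compile_exp nv d e) m)" using IH by simp
    have "d < 16" using 2 wfE_depth by auto
    with 2 show ?case using Plus.IH(2)[of p d m] Plus.IH(4)[OF _ _ r, of p "Suc d"] by auto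
  }
next
  case (Minus e f)
  have IH: "represents nv \<sigma> (fold effect (compile_exp nv d e) m)"
    if "wfE nv d e" "represents nv \<sigma> m" for m d
    by (rule represents_cong[OF that(2)]) (use Minus.IH(2) that in auto)
  { case 1
    then have r: "represents nv \<sigma> (fold effect (compile_exp nv d e) m)" using IH by simp
    with 1 show ?case
      using Minus.IH(1)[of d m] Minus.IH(3)[OF _ r, of "Suc d"] Minus.IH(4)[OF _ _ r, of "nv + d" "Suc d"]
      by simp
  next
    case 2
    then have r: "represents nv \<sigma> (fold effect (compile_exp nv d e) m)" using IH by simp
    have "d < 16" using 2 wfE_depth by auto
    with 2 show ?case using Minus.IH(2)[of p d m] Minus.IH(4)[OF _ _ r, of p "Suc d"] by auto
  }
qed

lemma compile_exp_reach:
  assumes "code_at P pc (compile_exp nv d e)" "wfE nv d e" "represents nv \<sigma> m"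
  obtains m' where "reach P (length (compile_exp nv d e)) (pc, m) (pc + length (compile_exp nv d e), m')"
    "m' (nv + d) = val e \<sigma>" "\<And>p. p < nv + d \<or> nv + 16 \<le> p \<Longrightarrow> m' p = m p"
    "represents nv \<sigma> m'"
proof
  show "reach P (length (compile_exp nv d e)) (pc, m)
      (pc + length (compile_exp nv d e), fold effect (compile_exp nv d e) m)"
    using assms(1) straight_compE by (intro reach_straight) auto
  show "fold effect (compile_exp nv d e) m (nv + d) = val e \<sigma>"
    using assms(2,3) by (rule compile_exp_correct)
  show *: "fold effect (compile_exp nv d e) m p = m p" if "p < nv + d \<or> nv + 16 \<le> p" for p
    using assms(2,3) that by (rule compile_exp_correct)
  show "represents nv \<sigma> (fold effect (compile_exp nv d e) m)"
    using assms(3) by (rule represents_cong) (use * in auto)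
qed

lemma reach_straightI:
  assumes "code_at P pc is" "\<forall>i \<in> set is. straight i" "fold effect is m = m'" "length is \<le> T"
    "pc' = pc + length is"
  shows "reach P T (pc, m) (pc', m')"
  unfolding assms(3)[symmetric] assms(5)
  by (rule reach_mono[OF reach_straight[OF assms(1,2)] assms(4)])

theorem compile_correct:
  assumes "code_at P pc (compile nv pc c)" "wfC nv c" "bounded_loops B c \<sigma>" "represents nv \<sigma> m"
  shows "\<exists>m'. reach P (time_bound nv B c) (pc, m) (pc + length (compile nv pc c), m') \<and>
              represents nv (sem c \<sigma>) m'"
  using assms
proof (induction c arbitrary: pc \<sigma> m)
  case Skip
  then show ?case using reach_refl[of P 0] by force
next
  case (Asg x e)
  let ?T = "compile_exp nv 0 e"
  have C: "code_at P pc ?T" "code_at P (pc + length ?T) [Const (Suc nv) 0, Add x nv (Suc nv)]"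
    using Asg.prems(1) by (auto simp: code_at_append)
  have x: "x < nv" "wfE nv 0 e" using Asg.prems by auto
  obtain m1 where m1: "reach P (length ?T) (pc, m) (pc + length ?T, m1)" "m1 nv = val e \<sigma>"
    "represents nv \<sigma> m1" using compile_exp_reach[OF C(1) x(2) Asg.prems(4)] by auto
  let ?m2 = "m1(Suc nv := 0, x := m1 nv)"
  have "reach P 2 (pc + length ?T, m1) (pc + length ?T + 2, ?m2)"
    by (rule reach_straightI[OF C(2)]) auto
  from reach_trans[OF m1(1) this]
  have "reach P (time_bound nv B (Asg x e)) (pc, m) (pc + length (compile nv pc (Asg x e)), ?m2)"
    by (simp add: add.assoc)
  moreover have "represents nv (sem (Asg x e) \<sigma>) ?m2"
  proof -
    have "represents nv \<sigma> (m1(Suc nv := 0))" using m1(3) by (rule represents_cong) auto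
    from represents_update[OF this, of "Var x" "val e \<sigma>"] show ?thesis using m1(2) x by simp
  qed
  ultimately show ?case by blast
next
  case (Put j e f)
  let ?T = "compile_exp nv 0 e" and ?I = "index_code nv nv j" and ?U = "compile_exp nv 1 f"
  have len: "length ?I = 5" by (simp add: index_code_def)
  have C: "code_at P pc ?T" "code_at P (pc + length ?T) ?I" "code_at P (pc + length ?T + 5) ?U"
    "code_at P (pc + length ?T + 5 + length ?U) [Store nv (Suc nv)]"
    using Put.prems(1) by (auto simp: code_at_append len add.assoc)
  have w: "j < 8" "wfE nv 0 e" "wfE nv 1 f" using Put.prems by auto
  obtain m1 where m1: "reach P (length ?T) (pc, m) (pc + length ?T, m1)" "m1 nv = val e \<sigma>"
    "represents nv \<sigma> m1" using compile_exp_reach[OF C(1) w(2) Put.prems(4)] by auto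
  let ?m2 = "m1(nv := nv + 16 + 8 * m1 nv + j, Suc nv := nv + 16 + j)"
  have r2: "reach P 5 (pc + length ?T, m1) (pc + length ?T + 5, ?m2)"
    by (rule reach_straightI[OF C(2) _ fold_index_code])
      (auto simp: len dest: straight_index_code)
  have "represents nv \<sigma> ?m2" using m1(3) by (rule represents_cong) auto
  then obtain m3 where m3: "reach P (length ?U) (pc + length ?T + 5, ?m2) (pc + length ?T + 5 + length ?U, m3)"
    "m3 (Suc nv) = val f \<sigma>" "m3 nv = ?m2 nv" "represents nv \<sigma> m3"
    using compile_exp_reach[OF C(3) w(3)] by force
  have m3': "m3 nv = address nv (Arr j (val e \<sigma>))" using m3(3) m1(2) by simp
  let ?m4 = "m3(m3 nv := m3 (Suc nv))"
  have "reach P 1 (pc + length ?T + 5 + length ?U, m3) (pc + length ?T + 5 + length ?U + 1, ?m4)"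
    by (rule reach_straightI[OF C(4)]) auto
  from reach_trans[OF reach_trans[OF reach_trans[OF m1(1) r2] m3(1)] this]
  have "reach P (time_bound nv B (Put j e f)) (pc, m) (pc + length (compile nv pc (Put j e f)), ?m4)"
    by (simp add: add_ac len)
  moreover have "represents nv (sem (Put j e f) \<sigma>) ?m4"
    using represents_update[OF m3(4), of "Arr j (val e \<sigma>)"] w(1) m3(2) m3' by simp
  ultimately show ?case by blast
next
  case (Seq c d)
  let ?C = "compile nv pc c"
  have C: "code_at P pc ?C" "code_at P (pc + length ?C) (compile nv (pc + length ?C) d)"
    using Seq.prems(1) by (auto simp: code_at_append Let_def)
  obtain m1 where m1: "reach P (time_bound nv B c) (pc, m) (pc + length ?C, m1)"
    "represents nv (sem c \<sigma>) m1" using Seq.IH(1)[OF C(1)] Seq.prems by auto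
  obtain m2 where m2: "reach P (time_bound nv B d) (pc + length ?C, m1)
      (pc + length ?C + length (compile nv (pc + length ?C) d), m2)"
    "represents nv (sem d (sem c \<sigma>)) m2" using Seq.IH(2)[OF C(2)] Seq.prems m1 by auto
  show ?case using reach_trans[OF m1(1) m2(1)] m2(2) by (auto simp: Let_def add.assoc)
next
  case (Cond e c d)
  let ?T = "compile_exp nv 0 e"
  let ?C = "compile nv (pc + length ?T + 1) c"
  let ?p = "pc + length ?T + length ?C + 3"
  let ?D = "compile nv ?p d"
  have code: "compile nv pc (Cond e c d) =
     ?T @ [Jz nv ?p] @ ?C @ [Const nv 0] @ [Jz nv (?p + length ?D)] @ ?D"
    by (simp add: Let_def)
  have C: "code_at P pc ?T" "code_at P (pc + length ?T) [Jz nv ?p]"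
    "code_at P (pc + length ?T + 1) ?C" "code_at P (pc + length ?T + 1 + length ?C) [Const nv 0]"
    "code_at P (pc + length ?T + 1 + length ?C + 1) [Jz nv (?p + length ?D)]" "code_at P ?p ?D"
    using Cond.prems(1) unfolding code code_at_append
    by (auto elim: code_at_shift)
  have w: "wfE nv 0 e" using Cond.prems by simp
  obtain m1 where m1: "reach P (length ?T) (pc, m) (pc + length ?T, m1)" "m1 nv = val e \<sigma>"
    "represents nv \<sigma> m1" using compile_exp_reach[OF C(1) w Cond.prems(4)] by auto
  have len: "pc + length (compile nv pc (Cond e c d)) = ?p + length ?D" unfolding code by simp
  show ?case
  proof (cases "val e \<sigma> = 0")
    case False
    have j: "reach P 1 (pc + length ?T, m1) (pc + length ?T + 1, m1)"
      using reach_Jz[OF C(2), of m1] m1(2) False by simp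
    obtain m2 where m2: "reach P (time_bound nv B c) (pc + length ?T + 1, m1)
        (pc + length ?T + 1 + length ?C, m2)" "represents nv (sem c \<sigma>) m2"
      using Cond.IH(1)[OF C(3) _ _ m1(3)] Cond.prems by auto
    let ?m3 = "m2(nv := 0)"
    have k: "reach P 1 (pc + length ?T + 1 + length ?C, m2) (pc + length ?T + 1 + length ?C + 1, ?m3)"
      by (rule reach_straightI[OF C(4)]) auto
    have l: "reach P 1 (pc + length ?T + 1 + length ?C + 1, ?m3) (?p + length ?D, ?m3)"
      using reach_Jz[OF C(5), of ?m3] by simp
    have "represents nv (sem c \<sigma>) ?m3" using m2(2) by (rule represents_cong) auto
    moreover have "reach P (time_bound nv B (Cond e c d)) (pc, m) (?p + length ?D, ?m3)"
      by (rule reach_mono[OF reach_trans[OF reach_trans[OF reach_trans[OF reach_trans[OF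
              m1(1) j] m2(1)] k] l]]) simp
    moreover have "sem (Cond e c d) \<sigma> = sem c \<sigma>" using False by simp
    ultimately show ?thesis unfolding len by metis
  next
    case True
    have j: "reach P 1 (pc + length ?T, m1) (?p, m1)"
      using reach_Jz[OF C(2), of m1] m1(2) True by simp
    obtain m2 where m2: "reach P (time_bound nv B d) (?p, m1) (?p + length ?D, m2)"
      "represents nv (sem d \<sigma>) m2"
      using Cond.IH(2)[OF C(6) _ _ m1(3)] Cond.prems by auto
    have "reach P (time_bound nv B (Cond e c d)) (pc, m) (?p + length ?D, m2)"
      by (rule reach_mono[OF reach_trans[OF reach_trans[OF m1(1) j] m2(1)]]) simp
    moreover have "sem (Cond e c d) \<sigma> = sem d \<sigma>" using True by simp
    ultimately show ?thesis unfolding len using m2(2) by metis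
  qed
next
  case (For x y c)
  let ?C = "compile nv (pc + 3) c"
  let ?t = "time_bound nv B c" and ?b = "\<sigma> (Var y)"
  let ?g = "\<lambda>i. loop x (sem c) i \<sigma>"
  have code: "compile nv pc (For x y c) =
     [Const x 0] @ [Sub nv y x] @ [Jz nv (pc + 7 + length ?C)] @ ?C @
         [Const nv 1, Add x x nv, Const nv 0] @ [Jz nv (pc + 1)]"
    by (simp add: Let_def)
  have C: "code_at P pc [Const x 0]" "code_at P (pc + 1) [Sub nv y x]"
    "code_at P (pc + 2) [Jz nv (pc + 7 + length ?C)]" "code_at P (pc + 3) ?C"
    "code_at P (pc + 3 + length ?C) [Const nv 1, Add x x nv, Const nv 0]"
    "code_at P (pc + 3 + length ?C + 3) [Jz nv (pc + 1)]"
    using For.prems(1) unfolding code code_at_append by (auto elim: code_at_shift)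
  have w: "x < nv" "y < nv" "x \<noteq> y" "Var x \<notin> writes c" "Var y \<notin> writes c" "wfC nv c"
    using For.prems by auto
  have y: "?g i (Var y) = ?b" for i using w by (intro loop_frame sem_frame) auto
  have B: "?b \<le> B" "\<And>i. i < ?b \<Longrightarrow> bounded_loops B c (?g i)" using For.prems by auto
  have head: "reach P 1 (pc + 1, m') (pc + 2, m'(nv := ?b - i))"
    if "represents nv (?g i) m'" for i m'
  proof -
    have "m' x = i" "m' y = ?b"
      using that w y[of i] unfolding represents_def
      by (auto dest: spec[of _ "Var x"] spec[of _ "Var y"])
    then show ?thesis by (intro reach_straightI[OF C(2)]) auto
  qed
  \<comment> \<open>The invariant is placed at the loop test, the target of the jump back: one step
    for clearing the counter, then \<open>?t + 6\<close> per completed pass.\<close>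
  have "i \<le> ?b \<Longrightarrow> \<exists>m'. reach P (1 + i * (?t + 6)) (pc, m) (pc + 1, m') \<and> represents nv (?g i) m'" for i
  proof (induction i)
    case 0
    have "reach P 1 (pc, m) (pc + 1, m(x := 0))"
      by (rule reach_straightI[OF C(1)]) auto
    moreover have "represents nv (?g 0) (m(x := 0))"
      using represents_update[OF For.prems(4), of "Var x" 0] w by simp
    ultimately have "reach P (1 + 0 * (?t + 6)) (pc, m) (pc + 1, m(x := 0)) \<and> represents nv (?g 0) (m(x := 0))"
      by (simp only: mult_0 add_0_right)
    then show ?case by blast
  next
    case (Suc i)
    then obtain m1 where m1: "reach P (1 + i * (?t + 6)) (pc, m) (pc + 1, m1)"
      "represents nv (?g i) m1" by auto
    let ?m2 = "m1(nv := ?b - i)"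
    have r2: "represents nv (?g i) ?m2" using m1(2) by (rule represents_cong) auto
    have j: "reach P 1 (pc + 2, ?m2) (pc + 3, ?m2)"
      using reach_Jz[OF C(3), of ?m2] Suc.prems by (simp add: eval_nat_numeral)
    obtain m3 where m3: "reach P ?t (pc + 3, ?m2) (pc + 3 + length ?C, m3)"
      "represents nv (sem c (?g i)) m3"
      using For.IH[OF C(4) w(6) B(2) r2] Suc.prems Suc_le_eq by blast
    have "sem c (?g i) (Var x) = i" using sem_frame[OF w(4)] by simp
    then have m3x: "m3 x = i" using m3(2) w(1) unfolding represents_def
      by (auto dest: spec[of _ "Var x"])
    let ?m4 = "m3(x := Suc i, nv := 0)"
    have k: "reach P 3 (pc + 3 + length ?C, m3) (pc + 3 + length ?C + 3, ?m4)"
      by (rule reach_straightI[OF C(5)]) (use m3x w in \<open>auto simp: fun_eq_iff\<close>)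
    have l: "reach P 1 (pc + 3 + length ?C + 3, ?m4) (pc + 1, ?m4)"
      using reach_Jz[OF C(6), of ?m4] by simp
    have "represents nv (?g (Suc i)) (m3(x := Suc i))"
      using represents_update[OF m3(2), of "Var x"] w(1) by simp
    then have "represents nv (?g (Suc i)) ?m4" by (rule represents_cong) auto
    moreover have "reach P (1 + Suc i * (?t + 6)) (pc, m) (pc + 1, ?m4)"
      by (rule reach_mono[OF reach_trans[OF reach_trans[OF reach_trans[OF reach_trans[OF reach_trans[OF
                m1(1) head[OF m1(2)]] j] m3(1)] k] l]]) simp
    ultimately show ?case by blast
  qed
  then obtain m1 where m1: "reach P (1 + ?b * (?t + 6)) (pc, m) (pc + 1, m1)"
    "represents nv (?g ?b) m1" by blast
  let ?m2 = "m1(nv := 0)"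
  have h: "reach P 1 (pc + 1, m1) (pc + 2, ?m2)" using head[OF m1(2)] by simp
  have j: "reach P 1 (pc + 2, ?m2) (pc + 7 + length ?C, ?m2)"
    using reach_Jz[OF C(3), of ?m2] by simp
  have "represents nv (sem (For x y c) \<sigma>) ?m2"
    unfolding sem.simps using m1(2) by (rule represents_cong) auto
  moreover have "reach P (time_bound nv B (For x y c)) (pc, m) (pc + length (compile nv pc (For x y c)), ?m2)"
  proof -
    have "?b * (?t + 6) \<le> B * (?t + 6)" using B(1) by (rule mult_le_mono1)
    then have "reach P (time_bound nv B (For x y c)) (pc, m) (pc + 7 + length ?C, ?m2)"
      by (intro reach_mono[OF reach_trans[OF reach_trans[OF m1(1) h] j]]) simp
    moreover have "pc + length (compile nv pc (For x y c)) = pc + 7 + length ?C"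
      unfolding code by simp
    ultimately show ?thesis by metis
  qed
  ultimately show ?case by blast
qed

subsection \<open>A small modulus that separates a small set\<close>

text \<open>The entries of Leibniz's harmonic triangle satisfy
  \<open>1/((n+1) C(n,k+1)) = 1/(n C(n-1,k)) - 1/((n+1) C(n,k))\<close>, so a common multiple of
  \<open>1, \<dots>, n+1\<close> clears all denominators up to row \<open>n\<close>.\<close>

lemma leibniz_triangle_dvd:
  fixes D :: nat
  assumes "\<And>i. 1 \<le> i \<Longrightarrow> i \<le> Suc n \<Longrightarrow> i dvd D" "k \<le> n"
  shows "Suc n * (n choose k) dvd D"
  using assms
proof (induction k arbitrary: n)
  case 0
  then show ?case by simp
next
  case (Suc k)
  obtain n' where n: "n = Suc n'" using Suc.prems(2) by (cases n) auto
  define p q r where "p = n * (n' choose k)" and "q = Suc n * (n choose k)"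
    and "r = Suc n * (n choose Suc k)"
  have "p dvd D" using Suc.IH[of n'] Suc.prems unfolding p_def n by force
  moreover have "q dvd D" using Suc.IH[of n] Suc.prems unfolding q_def by force
  ultimately obtain x y where xy: "D = p * x" "D = q * y" unfolding dvd_def by blast
  have "p = (n - k) * (n choose k)"
    using binomial_absorb_comp[of n k] unfolding p_def n by simp
  then have q: "q = p + Suc k * (n choose k)"
    using Suc.prems(2) unfolding q_def by (simp flip: add_mult_distrib)
  have "Suc k * r = Suc n * p"
  proof -
    have "Suc k * (n choose Suc k) = n * (n' choose k)"
      using binomial_absorption[of k n] unfolding n by (simp only: diff_Suc_1)
    then show ?thesis unfolding p_def r_def by (metis mult.left_commute)
  qed
  then have "Suc k * (p * q) = Suc k * (r * (Suc k * (n choose k)))"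
    unfolding q_def by (metis (no_types, lifting) mult.assoc mult.commute)
  \<comment> \<open>This is \<open>1/r = 1/p - 1/q\<close> cleared of denominators, as
    \<open>q - p = Suc k * (n choose k)\<close>. Hence \<open>D / r\<close> is the difference of the
    integers \<open>x = D / p\<close> and \<open>y = D / q\<close>.\<close>
  then have key: "p * q = r * (Suc k * (n choose k))" by (simp only: mult_cancel1) simp
  have pos: "p > 0" "q > 0" using Suc.prems(2) unfolding p_def q_def n by auto
  have "int r * (int x - int y) * (int p * int q) = int r * (int q * int D - int p * int D)"
    unfolding xy(1) by (subst (2) xy(1)[symmetric], subst xy(2)) (simp add: algebra_simps)
  also have "\<dots> = int (r * (Suc k * (n choose k))) * int D"
    unfolding q by (simp add: algebra_simps)
  also have "\<dots> = int D * (int p * int q)" unfolding key[symmetric] by simp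
  finally have "int r * (int x - int y) = int D" using pos by simp
  then have "int r dvd int D" by (metis dvd_triv_left)
  then show ?case unfolding r_def by (simp only: int_dvd_int_iff)
qed

text \<open>Row \<open>n\<close> of the triangle gives \<open>n + 1\<close> divisors of
  \<open>D\<close> with sum \<open>(n + 1) * 2 ^ n\<close>; their mean \<open>2 ^ n\<close> is
  therefore at most \<open>D\<close>.\<close>

lemma power2_le_common_multiple:
  fixes D :: nat
  assumes "\<And>i. 1 \<le> i \<Longrightarrow> i \<le> Suc n \<Longrightarrow> i dvd D" "D > 0"
  shows "2 ^ n \<le> D"
proof -
  have "Suc n * 2 ^ n = (\<Sum>k\<le>n. Suc n * (n choose k))"
    by (simp only: choose_row_sum sum_distrib_left[symmetric])
  also have "\<dots> \<le> (\<Sum>k\<le>n. D)"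
    using leibniz_triangle_dvd[OF assms(1)] assms(2) by (intro sum_mono dvd_imp_le) auto
  also have "\<dots> = Suc n * D" by simp
  finally show ?thesis by (simp only: Suc_mult_le_cancel1)
qed

lemma separating_modulus:
  assumes "finite S" "S \<subseteq> {..<n}" "card S \<le> q" "n \<le> 2 ^ L"
  obtains m where "1 \<le> m" "m \<le> 2 + L * q ^ 2" "inj_on (\<lambda>x. x mod m) S"
proof -
  let ?P = "{(x, y) \<in> S \<times> S. x < y}"
  define D where "D = (\<Prod>(x, y)\<in>?P. y - x)"
  have fin: "finite ?P" using assms(1) by (auto intro: finite_subset[of _ "S \<times> S"])
  have "card ?P \<le> card (S \<times> S)" using assms(1) by (intro card_mono) auto
  also have "\<dots> \<le> q ^ 2" using assms(3) by (simp add: card_cartesian_product power2_eq_square mult_le_mono)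
  finally have card: "card ?P \<le> q ^ 2" .
  have "D \<le> (\<Prod>(x, y)\<in>?P. 2 ^ L)" unfolding D_def
    by (intro prod_mono) (use assms(2,4) in \<open>force\<close>)
  also have "\<dots> = 2 ^ (L * card ?P)" by (simp add: case_prod_unfold power_mult)
  also have "\<dots> \<le> 2 ^ (L * q ^ 2)" using card by (intro power_increasing) auto
  also have "\<dots> < 2 ^ (1 + L * q ^ 2)" by simp
  finally have "\<not> 2 ^ (1 + L * q ^ 2) \<le> D" by simp
  moreover have "D > 0" unfolding D_def using fin by (intro prod_pos) auto
  \<comment> \<open>With exponent \<open>1 + L * q ^ 2\<close> the common-multiple bound speaks of
    the divisors up to \<open>2 + L * q ^ 2\<close>; as \<open>D\<close> is below that power of 2,
    one of them fails to divide it.\<close>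
  ultimately obtain m where m: "1 \<le> m" "m \<le> 2 + L * q ^ 2" "\<not> m dvd D"
    using power2_le_common_multiple[of "1 + L * q ^ 2" D] by auto
  have no: "x mod m \<noteq> y mod m" if "x \<in> S" "y \<in> S" "x < y" for x y
  proof
    assume "x mod m = y mod m"
    then have "m dvd y - x" using that mod_eq_dvd_iff_nat[of x y m] by simp
    moreover have "y - x dvd D" unfolding D_def
      using fin that by (intro dvd_prod_eqI[of _ "(x, y)"]) auto
    ultimately show False using m(3) dvd_trans by blast
  qed
  have "inj_on (\<lambda>x. x mod m) S"
    by (rule inj_onI) (metis no linorder_less_linear)
  with m that show ?thesis by blast
qed

text \<open>Lets a single counter below \<open>M ^ (k + 1)\<close> run through all combinations of a
  modulus (digit 0) and \<open>k\<close> colours.\<close>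

lemma digits_exist:
  assumes "\<And>i. i \<le> k \<Longrightarrow> d i < (M::nat)"
  shows "\<exists>z < M ^ Suc k. \<forall>i \<le> k. (z div M ^ i) mod M = d i"
  using assms
proof (induction k arbitrary: d)
  case 0
  then show ?case by (intro exI[of _ "d 0"]) auto
next
  case (Suc k)
  obtain z where z: "z < M ^ Suc k" "\<forall>i \<le> k. (z div M ^ i) mod M = d (Suc i)"
    using Suc.IH[of "\<lambda>i. d (Suc i)"] Suc.prems by auto
  have d0: "d 0 < M" using Suc.prems by simp
  let ?z = "d 0 + M * z"
  have "?z < M * Suc z" using d0 by simp
  also have "\<dots> \<le> M * M ^ Suc k" using z(1) by (intro mult_le_mono2) simp
  finally have "?z < M ^ Suc (Suc k)" by simp
  moreover have "(?z div M ^ i) mod M = d i" if "i \<le> Suc k" for i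
  proof (cases i)
    case 0
    then show ?thesis using d0 by simp
  next
    case (Suc j)
    have "?z div M = z" using d0 by simp
    then have "?z div M ^ i = z div M ^ j" unfolding Suc power_Suc by (simp only: div_mult2_eq)
    then show ?thesis using z(2) that Suc by simp
  qed
  ultimately show ?case by blast
qed

subsection \<open>Layered search and marked paths\<close>

fun walk :: "edge list \<Rightarrow> nat \<Rightarrow> nat list \<Rightarrow> nat list \<Rightarrow> bool" where
  "walk es u [] [] \<longleftrightarrow> True"
| "walk es u (l # ls) (v # vs) \<longleftrightarrow> (u, l, v) \<in> set es \<and> walk es v ls vs"
| "walk es u _ _ \<longleftrightarrow> False"

lemma walk_length: "walk es u ls vs \<Longrightarrow> length vs = length ls"
  by (induction es u ls vs rule: walk.induct) auto

lemma walk_append: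
  "length vs = length ls \<Longrightarrow>
   walk es u (ls @ ls') (vs @ vs') \<longleftrightarrow> walk es u ls vs \<and> walk es (last (u # vs)) ls' vs'"
  by (induction es u ls vs rule: walk.induct) auto

lemma walk_nodes: "wf_graph n es \<Longrightarrow> walk es u ls vs \<Longrightarrow> v \<in> set vs \<Longrightarrow> v < n"
  by (induction es u ls vs rule: walk.induct) (auto simp: wf_graph_def)

lemma walk_iff_nth:
  "walk es u ls vs \<longleftrightarrow> length vs = length ls \<and>
     (\<forall>i < length ls. ((u # vs) ! i, ls ! i, (u # vs) ! Suc i) \<in> set es)"
  by (induction es u ls vs rule: walk.induct) (auto simp: All_less_Suc2)

lemma is_simple_path_iff_walk:
  "is_simple_path es s t vs ls \<longleftrightarrow>
     (\<exists>vs'. vs = s # vs' \<and> walk es s ls vs' \<and> distinct (s # vs') \<and> last (s # vs') = t)"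
  unfolding is_simple_path_def walk_iff_nth by (cases vs) auto

section \<open>Simple walks and continuations that avoid a set of nodes\<close>

definition simple_walk :: "edge list \<Rightarrow> nat \<Rightarrow> nat \<Rightarrow> nat list \<Rightarrow> bool" where
  "simple_walk es s t ls \<longleftrightarrow> (\<exists>vs. walk es s ls vs \<and> distinct (s # vs) \<and> last (s # vs) = t)"

lemma SimplePath_akwa_iff:
  "SimplePath (lang_akwa a w k) es s t \<longleftrightarrow>
     (\<exists>m. simple_walk es s t (replicate k a @ replicate m a) \<or>
          simple_walk es s t (replicate k a @ w @ replicate m a))"
  unfolding SimplePath_def lang_akwa_def is_simple_path_iff_walk simple_walk_def by blast

text \<open>Only the heads of edges are tested, because the search starts at a node that itself lies
  in \<open>S\<close>.\<close>

definition avoiding :: "edge list \<Rightarrow> nat \<Rightarrow> nat set \<Rightarrow> (nat \<times> nat) set" where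
  "avoiding es a S = {(u, v). (u, a, v) \<in> set es \<and> v \<notin> S}"

text \<open>For the part in \<open>a^*\<close> plain reachability suffices, since cutting cycles out
  of a walk keeps its label in \<open>a^*\<close>; only the nodes read along \<open>w\<close>, whose
  number is fixed, have to be remembered in \<open>S\<close>.\<close>

fun tail :: "edge list \<Rightarrow> nat \<Rightarrow> nat \<Rightarrow> nat set \<Rightarrow> nat list \<Rightarrow> nat \<Rightarrow> bool" where
  "tail es a t S [] u \<longleftrightarrow> (u, t) \<in> (avoiding es a S)\<^sup>*"
| "tail es a t S (l # w) u \<longleftrightarrow>
     (\<exists>v. (u, l, v) \<in> set es \<and> v \<notin> S \<and> tail es a t (insert v S) w v)"

lemma avoiding_rtrancl_walk:
  assumes "(u, t) \<in> (avoiding es a S)\<^sup>*"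
  shows "\<exists>m vs. walk es u (replicate m a) vs \<and> distinct (u # vs) \<and> set vs \<inter> S = {} \<and>
           last (u # vs) = t"
  using assms
proof (induction rule: converse_rtrancl_induct)
  case base
  show ?case by (intro exI[of _ 0] exI[of _ "[]"]) auto
next
  case (step u v)
  then obtain m vs where vs: "walk es v (replicate m a) vs" "distinct (v # vs)" "set vs \<inter> S = {}"
    "last (v # vs) = t" by blast
  have uv: "(u, a, v) \<in> set es" "v \<notin> S" using step.hyps(1) by (auto simp: avoiding_def)
  show ?case
  proof (cases "u \<in> set (v # vs)")
    case False
    then show ?thesis using uv vs
      by (intro exI[of _ "Suc m"] exI[of _ "v # vs"]) auto
  next
    case True
    \<comment> \<open>The path from \<open>v\<close> returns to \<open>u\<close>, so it is entered
      only at that occurrence and everything before is dropped.\<close>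
    from split_list[OF this] obtain xs ys where xy: "v # vs = xs @ u # ys" by blast
    show ?thesis
    proof (cases xs)
      case Nil
      then show ?thesis using xy vs by (intro exI[of _ m] exI[of _ vs]) auto
    next
      case (Cons x xs')
      then have v: "vs = (xs' @ [u]) @ ys" using xy by simp
      have len: "m = length (xs' @ [u]) + length ys" using walk_length[OF vs(1)] v by simp
      have "walk es u (replicate (length ys) a) ys"
        using vs(1) walk_append[of "xs' @ [u]" "replicate (length (xs' @ [u])) a" es v
            "replicate (length ys) a" ys]
        unfolding len replicate_add v by simp
      then show ?thesis using vs v by (intro exI[of _ "length ys"] exI[of _ ys]) auto
    qed
  qed
qed

lemma walk_avoiding_rtrancl:
  "walk es u (replicate m a) vs \<Longrightarrow> set vs \<inter> S = {} \<Longrightarrow> (u, last (u # vs)) \<in> (avoiding es a S)\<^sup>*"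
proof (induction vs arbitrary: u m)
  case (Cons v vs)
  obtain m' where m: "m = Suc m'" using Cons.prems(1) by (cases m) auto
  with Cons have "(v, last (v # vs)) \<in> (avoiding es a S)\<^sup>*" "(u, v) \<in> avoiding es a S"
    by (auto simp: avoiding_def)
  then show ?case by (auto intro: converse_rtrancl_into_rtrancl)
qed auto

text \<open>Distinctness does not mention \<open>u\<close>: wherever this is applied,
  \<open>u\<close> belongs to \<open>S\<close>, so that avoiding \<open>S\<close> already keeps the
  walk from returning to it.\<close>

lemma tail_iff_walk:
  "tail es a t S w u \<longleftrightarrow>
     (\<exists>m vs. walk es u (w @ replicate m a) vs \<and> distinct vs \<and> set vs \<inter> S = {} \<and> last (u # vs) = t)"
proof (induction w arbitrary: S u)
  case Nil
  show ?case (is "?L \<longleftrightarrow> ?R")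
  proof
    assume ?L
    then have "(u, t) \<in> (avoiding es a S)\<^sup>*" by simp
    from avoiding_rtrancl_walk[OF this] obtain m vs
      where "walk es u (replicate m a) vs" "distinct (u # vs)" "set vs \<inter> S = {}" "last (u # vs) = t"
      by blast
    then show ?R by (intro exI[of _ m] exI[of _ vs]) simp
  next
    assume ?R
    then obtain m vs where "walk es u (replicate m a) vs" "set vs \<inter> S = {}" "last (u # vs) = t"
      by auto
    then show ?L using walk_avoiding_rtrancl[of es u m a vs S] by simp
  qed
next
  case (Cons l w)
  show ?case (is "?L \<longleftrightarrow> ?R")
  proof
    assume ?L
    then obtain v m vs where "(u, l, v) \<in> set es" "v \<notin> S" "walk es v (w @ replicate m a) vs"
      "distinct vs" "set vs \<inter> insert v S = {}" "last (v # vs) = t"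
      using Cons.IH by auto
    then show ?R by (intro exI[of _ m] exI[of _ "v # vs"]) auto
  next
    assume ?R
    then obtain m vs where vs: "walk es u (l # w @ replicate m a) vs" "distinct vs"
      "set vs \<inter> S = {}" "last (u # vs) = t" by auto
    then obtain v vs' where "vs = v # vs'" by (cases vs) auto
    with vs show ?L using Cons.IH by fastforce
  qed
qed

text \<open>The outcome of the layered search: \<^term>\<open>lay v = Suc i\<close> when \<^term>\<open>v\<close> was first reached in
  round \<^term>\<open>i\<close>, and \<^term>\<open>lay v = 0\<close> when it was not reached; a node is entered in round
  \<^term>\<open>i\<close> only if its colour is the \<^term>\<open>i\<close>-th digit.\<close>

definition layered ::
  "edge list \<Rightarrow> nat \<Rightarrow> nat \<Rightarrow> nat \<Rightarrow> nat \<Rightarrow> (nat \<Rightarrow> nat) \<Rightarrow> (nat \<Rightarrow> nat) \<Rightarrow> (nat \<Rightarrow> nat) \<Rightarrow> (nat \<Rightarrow> nat) \<Rightarrow> bool"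
  where
  "layered es n a s k col dig lay par \<longleftrightarrow>
     lay s = 1 \<and>
     (\<forall>v < n. lay v \<noteq> 0 \<longrightarrow> lay v = 1 \<and> v = s \<or>
        (\<exists>i < k. lay v = Suc (Suc i) \<and> par v < n \<and> lay (par v) = Suc i \<and>
           (par v, a, v) \<in> set es \<and> col v = dig (Suc i))) \<and>
     (\<forall>u v i. (u, a, v) \<in> set es \<longrightarrow> i < k \<longrightarrow> lay u = Suc i \<longrightarrow> col v = dig (Suc i) \<longrightarrow> lay v \<noteq> 0)"

text \<open>The node set of the path that the search has recorded for \<open>x\<close>, for a node
  \<open>x\<close> at layer \<open>Suc i\<close>.\<close>

definition ancestors :: "(nat \<Rightarrow> nat) \<Rightarrow> nat \<Rightarrow> nat \<Rightarrow> nat set" where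
  "ancestors par i x = (\<lambda>j. (par ^^ j) x) ` {..i}"

lemma ancestors_Suc: "ancestors par (Suc i) x = insert x (ancestors par i (par x))"
  unfolding ancestors_def atMost_Suc_eq_insert_0 image_insert image_image
  by (simp add: funpow_swap1)

text \<open>Parents of a node on the chain stay on the chain, so cutting the recorded path off at
  \<open>y\<close> introduces no new node.\<close>

lemma ancestors_subset:
  assumes "y \<in> ancestors par k x" 
  obtains j where "j \<le> k" "y = (par ^^ j) x" "ancestors par (k - j) y \<subseteq> ancestors par k x"
proof -
  obtain j where j: "j \<le> k" "y = (par ^^ j) x" using assms unfolding ancestors_def by auto
  have "(par ^^ i) y \<in> ancestors par k x" if "i \<le> k - j" for i
    unfolding ancestors_def j(2) using that j(1) by (intro image_eqI[of _ _ "i + j"]) (auto simp: funpow_add)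
  then have "ancestors par (k - j) y \<subseteq> ancestors par k x" unfolding ancestors_def[of _ "k - j"] by auto
  with j that show ?thesis by blast
qed

lemma layered_cases:
  assumes "layered es n a s k col dig lay par" "x < n" "lay x = Suc i"
  obtains "i = 0" "x = s"
  | i' where "i = Suc i'" "i' < k" "par x < n" "lay (par x) = i" "(par x, a, x) \<in> set es"
      "col x = dig i"
proof -
  have "lay x = 1 \<and> x = s \<or> (\<exists>i < k. lay x = Suc (Suc i) \<and> par x < n \<and> lay (par x) = Suc i \<and>
           (par x, a, x) \<in> set es \<and> col x = dig (Suc i))"
  proof -
    have "lay x \<noteq> 0" using assms(3) by simp
    then show ?thesis using assms(1,2) unfolding layered_def by blast
  qed
  then show ?thesis
  proof
    assume "lay x = 1 \<and> x = s"
    then show ?thesis using assms(3) that(1) by simp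
  next
    assume "\<exists>i < k. lay x = Suc (Suc i) \<and> par x < n \<and> lay (par x) = Suc i \<and>
           (par x, a, x) \<in> set es \<and> col x = dig (Suc i)"
    then show ?thesis using assms(3) that(2) by auto
  qed
qed

text \<open>Layers drop by one from child to parent, which makes the recorded path simple. The
  colour clause is what later separates this path from nodes of other colours.\<close>

lemma layered_walk:
  assumes "layered es n a s k col dig lay par" "x < n" "lay x = Suc i"
  shows "\<exists>vs. walk es s (replicate i a) vs \<and> last (s # vs) = x \<and> distinct (s # vs) \<and>
      set (s # vs) = ancestors par i x \<and>
      (\<forall>v \<in> set (s # vs). v < n \<and> lay v \<le> Suc i \<and> (v = s \<or> (\<exists>j. 1 \<le> j \<and> j \<le> i \<and> col v = dig j)))"
  using assms(2,3)
proof (induction i arbitrary: x)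
  case 0
  from assms(1) this have "x = s" by (rule layered_cases) auto
  then show ?case using 0 by (intro exI[of _ "[]"]) (auto simp: ancestors_def)
next
  case (Suc i)
  from assms(1) Suc.prems
  have p: "par x < n \<and> lay (par x) = Suc i \<and> (par x, a, x) \<in> set es \<and> col x = dig (Suc i)"
    by (rule layered_cases) auto
  then have p: "par x < n" "lay (par x) = Suc i" "(par x, a, x) \<in> set es" "col x = dig (Suc i)"
    by auto
  from Suc.IH[OF p(1,2)] obtain vs where vs: "walk es s (replicate i a) vs" "last (s # vs) = par x"
    "distinct (s # vs)" "set (s # vs) = ancestors par i (par x)"
    "\<And>v. v \<in> set (s # vs) \<Longrightarrow>
       v < n \<and> lay v \<le> Suc i \<and> (v = s \<or> (\<exists>j. 1 \<le> j \<and> j \<le> i \<and> col v = dig j))" by blast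
  have "x \<notin> set (s # vs)" using vs(5)[of x] Suc.prems(2) by auto
  moreover have "walk es s (replicate (Suc i) a) (vs @ [x])"
  proof -
    have "replicate (Suc i) a = replicate i a @ [a]" by (simp add: replicate_append_same)
    then show ?thesis using vs(1,2) p(3) walk_length[OF vs(1)]
      by (simp add: walk_append del: replicate_Suc)
  qed
  moreover have "set (s # vs @ [x]) = ancestors par (Suc i) x"
    unfolding ancestors_Suc vs(4)[symmetric] by auto
  moreover have "\<forall>v \<in> set (s # vs @ [x]). v < n \<and> lay v \<le> Suc (Suc i) \<and>
      (v = s \<or> (\<exists>j. 1 \<le> j \<and> j \<le> Suc i \<and> col v = dig j))"
  proof
    fix v assume "v \<in> set (s # vs @ [x])"
    then consider "v \<in> set (s # vs)" | "v = x" by auto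
    then show "v < n \<and> lay v \<le> Suc (Suc i) \<and> (v = s \<or> (\<exists>j. 1 \<le> j \<and> j \<le> Suc i \<and> col v = dig j))"
    proof cases
      case 1
      then show ?thesis using vs(5)[of v] le_Suc_eq by auto
    next
      case 2
      then show ?thesis using Suc.prems p(4) by auto
    qed
  qed
  ultimately show ?case using vs(3) by (intro exI[of _ "vs @ [x]"]) auto
qed

text \<open>Valid for any colouring and any digits, so a wrong guess can never produce a wrong
  positive answer.\<close>

lemma layered_tail_sound:
  assumes "layered es n a s k col dig lay par" "x < n" "lay x = Suc k"
    and "tail es a t (ancestors par k x) w x"
  shows "\<exists>m. simple_walk es s t (replicate k a @ w @ replicate m a)"
proof -
  obtain vs where vs: "walk es s (replicate k a) vs" "last (s # vs) = x"
    "distinct (s # vs)" "set (s # vs) = ancestors par k x"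
    using layered_walk[OF assms(1-3)] by blast
  obtain m us where us: "walk es x (w @ replicate m a) us" "distinct us"
    "set us \<inter> set (s # vs) = {}" "last (x # us) = t"
    using assms(4) unfolding tail_iff_walk vs(4) by blast
  have "walk es s (replicate k a @ w @ replicate m a) (vs @ us)"
    using vs(1,2) us(1) walk_length[OF vs(1)] by (simp add: walk_append)
  moreover have "last (s # vs @ us) = t" using us(4) vs(2) by (cases us) auto
  ultimately show ?thesis using vs(3) us(2,3) unfolding simple_walk_def
    by (intro exI[of _ m] exI[of _ "vs @ us"]) auto
qed

text \<open>By injectivity the colour of \<open>us ! i\<close> is asked for in the round of that
  node and in no other, so it is entered neither too early nor too late. Its recorded parent may
  still be a node off the given path.\<close>

lemma layered_follows_path:
  assumes "layered es n a s k col dig lay par" "walk es s (replicate k a) us" "distinct (s # us)"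
    and "set us \<subseteq> {..<n}" "s < n" "inj_on col (set us)" "\<And>i. i < k \<Longrightarrow> dig (Suc i) = col (us ! i)"
    and "i \<le> k"
  shows "lay ((s # us) ! i) = Suc i"
  using assms(8)
proof (induction i)
  case 0
  then show ?case using assms(1) by (simp add: layered_def)
next
  case (Suc i)
  have len: "length us = k" using walk_length[OF assms(2)] by simp
  let ?u = "(s # us) ! i" and ?v = "us ! i"
  have mem: "?v \<in> set us" using len Suc.prems by simp
  have e: "(?u, a, ?v) \<in> set es" using assms(2) Suc.prems unfolding walk_iff_nth
    by (auto dest: spec[of _ i])
  have "lay ?v \<noteq> 0"
    using assms(1) e Suc assms(7)[of i] unfolding layered_def
    by (metis Suc_leD Suc_le_lessD)
  moreover have "?v \<noteq> s" "?v < n" using assms(3,4) mem by auto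
  ultimately obtain j where j: "j < k" "lay ?v = Suc (Suc j)" "col ?v = dig (Suc j)"
    using assms(1) unfolding layered_def by meson
  then have "col ?v = col (us ! j)" using assms(7) by simp
  then have "?v = us ! j" using assms(6) mem j(1) len by (auto dest: inj_onD)
  then have "i = j" using assms(3) len j(1) Suc.prems by (simp add: nth_eq_iff_index_eq)
  then show ?case using j(2) by simp
qed

text \<open>If the marked path meets the rest of the given path in \<^term>\<open>z\<close>, then cutting out the part
  between the two occurrences of \<^term>\<open>z\<close> leaves a path labelled by \<^term>\<open>a\<close> alone that still
  contains the last \<^term>\<open>k\<close> nodes, as the colouring keeps these off the marked path.\<close>

lemma layered_tail_complete:
  assumes lay: "layered es n a s k col dig lay par"
    and us: "walk es s (replicate k a) us" and vs: "walk es (last (s # us)) (w @ replicate m a) vs"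
    and dist: "distinct (s # us @ vs)" and last: "last (s # us @ vs) = t"
    and n: "set (us @ vs) \<subseteq> {..<n}" "s < n"
    and inj: "inj_on col (set us \<union> set (take (length w) vs) \<union> set (drop (length vs - k) vs))"
    and dig: "\<And>i. i < k \<Longrightarrow> dig (Suc i) = col (us ! i)"
  obtains x where "x < n" "lay x = Suc k" "tail es a t (ancestors par k x) w x"
  | k' where "k \<le> k'" "k' < k + m" "simple_walk es s t (replicate k' a)"
proof -
  define x where "x = last (s # us)"
  have len: "length us = k" using walk_length[OF us] by simp
  have x: "x = (s # us) ! k" unfolding x_def using len by (cases us) (auto simp: last_conv_nth)
  have "x \<in> set (s # us)" unfolding x_def by (rule last_in_set) simp
  then have xn: "x < n" using n by auto
  have layx: "lay x = Suc k"
    unfolding x by (rule layered_follows_path[OF lay us]) (use dist n inj dig in \<open>auto intro: inj_on_subset\<close>)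
  have lvs: "length vs = length w + m" using walk_length[OF vs] by simp
  let ?A = "ancestors par k x"
  show ?thesis
  proof (cases "set vs \<inter> ?A = {}")
    case True
    have "last (x # vs) = t" using last unfolding x_def by (cases vs) auto
    then have "tail es a t ?A w x"
      unfolding tail_iff_walk using vs dist True by (intro exI[of _ m] exI[of _ vs]) (auto simp: x_def)
    then show ?thesis using xn layx that(1) by blast
  next
    case False
    then have "\<exists>z \<in> set vs. z \<in> ?A" by blast
    \<comment> \<open>Taking the last crossing makes everything after \<open>z\<close> disjoint from
      the marked path.\<close>
    then obtain vs1 z vs2 where z: "vs = vs1 @ z # vs2" "z \<in> ?A" "\<forall>y \<in> set vs2. y \<notin> ?A"
      by (rule split_list_last_propE)
    obtain ps where ps: "set (s # ps) = ?A"
      "\<And>v. v \<in> ?A \<Longrightarrow> v < n \<and> lay v \<le> Suc k \<and> (v = s \<or> (\<exists>j. 1 \<le> j \<and> j \<le> k \<and> col v = dig j))"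
      using layered_walk[OF lay xn layx] by metis
    have "z \<noteq> s" using dist z(1) by auto
    then obtain j where j: "1 \<le> j" "j \<le> k" "col z = dig j" using ps(2)[OF z(2)] by auto
    then have cz: "col z = col (us ! (j - 1))" "us ! (j - 1) \<in> set us" using dig[of "j - 1"] len by auto
    have "z \<notin> set us" using dist z(1) by auto
    \<comment> \<open>\<open>z\<close> shares its colour with a node of \<open>us\<close> without
      being one, so injectivity bars it from the nodes of \<open>w\<close> and from the last
      \<open>k\<close> nodes.\<close>
    then have zB: "z \<notin> set (take (length w) vs)" "z \<notin> set (drop (length vs - k) vs)"
      using inj cz by (metis (no_types, lifting) UnI1 UnI2 inj_onD)+
    have l1: "length w \<le> length vs1"
    proof (rule ccontr)
      assume "\<not> length w \<le> length vs1"
      then have "z \<in> set (take (length w) vs)" unfolding z(1) by (simp add: take_Cons')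
      with zB show False by simp
    qed
    have l2: "k \<le> length vs2"
    proof (rule ccontr)
      assume "\<not> k \<le> length vs2"
      then have "length vs - k \<le> length vs1" unfolding z(1) by simp
      then have "z \<in> set (drop (length vs - k) vs)" unfolding z(1) by simp
      with zB show False by simp
    qed
    have l3: "length vs2 < m" using lvs l1 unfolding z(1) by simp
    define r where "r = length vs1 - length w"
    have m: "m = r + (1 + length vs2)" using lvs l1 unfolding z(1) r_def by simp
    have "walk es (last (last (s # us) # vs1)) (a # replicate (length vs2) a) (z # vs2)"
      using vs walk_append[of vs1 "w @ replicate r a" es "last (s # us)" "a # replicate (length vs2) a" "z # vs2"]
        l1 unfolding z(1) m replicate_add r_def by simp
    then have wz: "walk es z (replicate (length vs2) a) vs2" by simp
    obtain j' where j': "j' \<le> k" "z = (par ^^ j') x" "ancestors par (k - j') z \<subseteq> ?A"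
      by (rule ancestors_subset[OF z(2)])
    define i where "i = k - j'"
    have "lay ((par ^^ j) x) = Suc (k - j) \<and> (par ^^ j) x < n" if "j \<le> k" for j
      using that
    proof (induction j)
      case 0 then show ?case using layx xn by simp
    next
      case (Suc j)
      then have *: "lay ((par ^^ j) x) = Suc (Suc (k - Suc j))" "(par ^^ j) x < n" by auto
      from lay *(2,1) show ?case by (rule layered_cases) auto
    qed
    from this[OF j'(1)] have i: "lay z = Suc i" "i \<le> k" using j'(2) unfolding i_def by auto
    have "z < n" using ps(2)[OF z(2)] by simp
    from layered_walk[OF lay this i(1)] obtain qs where qs: "walk es s (replicate i a) qs"
      "last (s # qs) = z" "distinct (s # qs)" "set (s # qs) = ancestors par i z" by blast
    have "ancestors par i z \<subseteq> ?A" using j'(3) unfolding i_def .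
    then have "set (s # qs) \<inter> set vs2 = {}" using qs(4) z(3) by blast
    moreover have "walk es s (replicate (i + length vs2) a) (qs @ vs2)"
      using qs(1,2) wz walk_length[OF qs(1)] by (simp add: walk_append replicate_add)
    moreover have "last (s # qs @ vs2) = t" using last qs(2) unfolding z(1) by (cases vs2) auto
    ultimately have "simple_walk es s t (replicate (i + length vs2) a)"
      unfolding simple_walk_def using qs(3) dist unfolding z(1) by (intro exI[of _ "qs @ vs2"]) auto
    \<comment> \<open>The bounds \<open>i \<le> k\<close> and \<open>length vs2 < m\<close> make the
      shortcut shorter than \<open>k + m\<close>, while \<open>k \<le> length vs2\<close> keeps its
      label in \<open>a^k a^*\<close>.\<close>
    then show ?thesis using that(2)[of "i + length vs2"] l2 l3 i(2) by simp
  qed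
qed

section \<open>Guesses of a modulus and a colour sequence\<close>

definition digit :: "nat \<Rightarrow> nat \<Rightarrow> nat \<Rightarrow> nat" where
  "digit M z i = (z div M ^ i) mod M"

text \<open>The empty continuation is always tested too: if some path in \<open>a^k a^*\<close>
  exists, a good guess is only known for a shortest one of these, and a solution through
  \<open>w\<close> need not be found.\<close>

definition solves :: "edge list \<Rightarrow> nat \<Rightarrow> nat \<Rightarrow> nat list \<Rightarrow> nat \<Rightarrow> nat \<Rightarrow> nat \<Rightarrow> (nat \<Rightarrow> nat) \<Rightarrow> (nat \<Rightarrow> nat) \<Rightarrow> bool" where
  "solves es n a w s t k lay par \<longleftrightarrow>
     (\<exists>x < n. lay x = Suc k \<and>
        (tail es a t (ancestors par k x) [] x \<or> tail es a t (ancestors par k x) w x))"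

lemma solves_sound:
  assumes "layered es n a s k col dig lay par" "solves es n a w s t k lay par"
  shows "SimplePath (lang_akwa a w k) es s t"
  using assms layered_tail_sound[OF assms(1)] unfolding solves_def SimplePath_akwa_iff
  by (metis append_Nil)

text \<open>Which parents the search records depends on the order of the edges. Quantifying over all
  possible outcomes keeps the combinatorics independent of the program.\<close>

definition separating :: "edge list \<Rightarrow> nat \<Rightarrow> nat \<Rightarrow> nat list \<Rightarrow> nat \<Rightarrow> nat \<Rightarrow> nat \<Rightarrow> (nat \<Rightarrow> nat) \<Rightarrow> bool" where
  "separating es n a w s t k dig \<longleftrightarrow> dig 0 > 0 \<and>
     (\<forall>col lay par. (\<forall>v < n. col v = v mod dig 0) \<longrightarrow> layered es n a s k col dig lay par \<longrightarrow>
        solves es n a w s t k lay par)"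

text \<open>At most \<open>k + c + k\<close> nodes need distinct residues, and \<open>M\<close>
  exceeds by one the bound on the modulus, which is itself a digit. Since \<open>c\<close> merely
  bounds the length of \<open>w\<close>, the same \<open>M\<close> serves for the empty
  word.\<close>

lemma separating_exists_for_path:
  assumes wf: "wf_graph n es" and "s < n" "n \<le> 2 ^ L" "length w \<le> c"
    and M: "M = 3 + L * (2 * k + c) ^ 2"
    and path: "simple_walk es s t (replicate k a @ w @ replicate m a)"
  obtains z where "z < M ^ Suc k" "digit M z 0 > 0"
    "\<And>col lay par. (\<And>v. v < n \<Longrightarrow> col v = v mod digit M z 0) \<Longrightarrow>
       layered es n a s k col (digit M z) lay par \<Longrightarrow>
       (\<exists>x < n. lay x = Suc k \<and> tail es a t (ancestors par k x) w x) \<or>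
       (\<exists>k'. k \<le> k' \<and> k' < k + m \<and> simple_walk es s t (replicate k' a))"
proof -
  obtain vs where vs: "walk es s (replicate k a @ w @ replicate m a) vs" "distinct (s # vs)"
    "last (s # vs) = t" using path unfolding simple_walk_def by blast
  define us ws where "us = take k vs" and "ws = drop k vs"
  have lv: "length vs = k + length w + m" using walk_length[OF vs(1)] by simp
  have v: "vs = us @ ws" "length us = k" unfolding us_def ws_def using lv by auto
  have walks: "walk es s (replicate k a) us" "walk es (last (s # us)) (w @ replicate m a) ws"
    using vs(1) v walk_append[of us "replicate k a" es s] by auto
  have nodes: "set (us @ ws) \<subseteq> {..<n}" using walk_nodes[OF wf vs(1)] v(1) by auto
  let ?B = "set us \<union> set (take (length w) ws) \<union> set (drop (length ws - k) ws)"
  have "?B \<subseteq> {..<n}" using nodes by (auto dest: in_set_takeD in_set_dropD)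
  moreover have "card ?B \<le> 2 * k + c"
  proof -
    have "card ?B \<le> card (set us) + card (set (take (length w) ws)) + card (set (drop (length ws - k) ws))"
      by (meson add_mono card_Un_le le_refl le_trans)
    also have "\<dots> \<le> length us + length (take (length w) ws) + length (drop (length ws - k) ws)"
      by (intro add_mono card_length)
    also have "\<dots> \<le> 2 * k + c" using v(2) assms(4) by simp
    finally show ?thesis .
  qed
  ultimately obtain q where q: "1 \<le> q" "q \<le> 2 + L * (2 * k + c) ^ 2" "inj_on (\<lambda>x. x mod q) ?B"
    using separating_modulus[of ?B n "2 * k + c" L] assms(3) by blast
  \<comment> \<open>Digit \<open>i > 0\<close> is the colour of the \<open>i\<close>-th node after
    \<open>s\<close>, which \<open>us\<close> lists at position \<open>i - 1\<close>.\<close>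
  define d where "d i = (if i = 0 then q else us ! (i - 1) mod q)" for i
  have "d i < M" if "i \<le> k" for i
    using q(1,2) unfolding d_def M by (auto intro: less_le_trans[OF mod_less_divisor])
  then obtain z where z: "z < M ^ Suc k" "\<And>i. i \<le> k \<Longrightarrow> digit M z i = d i"
    using digits_exist[of k d M] unfolding digit_def by blast
  have z0: "digit M z 0 = q" using z(2)[of 0] by (simp add: d_def)
  show ?thesis
  proof (rule that[OF z(1)])
    show "digit M z 0 > 0" using z0 q(1) by simp
    fix col lay par
    assume col: "\<And>v. v < n \<Longrightarrow> col v = v mod digit M z 0"
      and lay: "layered es n a s k col (digit M z) lay par"
    have "col v = v mod q" if "v \<in> ?B" for v
      using that \<open>?B \<subseteq> {..<n}\<close> col z0 by (metis lessThan_iff subsetD)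
    then have "inj_on col ?B \<longleftrightarrow> inj_on (\<lambda>x. x mod q) ?B" by (rule inj_on_cong)
    with q(3) have inj: "inj_on col ?B" by blast
    have dig: "digit M z (Suc i) = col (us ! i)" if "i < k" for i
    proof -
      have "us ! i \<in> set us" using that v(2) by simp
      then have "us ! i < n" using nodes by auto
      then show ?thesis using z(2)[of "Suc i"] z0 col that by (simp add: d_def)
    qed
    have "distinct (s # us @ ws)" "last (s # us @ ws) = t" using vs(2,3) v(1) by auto
    from layered_tail_complete[OF lay walks this nodes \<open>s < n\<close> inj dig]
    show "(\<exists>x < n. lay x = Suc k \<and> tail es a t (ancestors par k x) w x) \<or>
       (\<exists>k'. k \<le> k' \<and> k' < k + m \<and> simple_walk es s t (replicate k' a))" by metis
  qed
qed

theorem separating_exists: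
  assumes wf: "wf_graph n es" and n: "s < n" "n \<le> 2 ^ L"
    and M: "M = 3 + L * (2 * k + length w) ^ 2"
    and path: "SimplePath (lang_akwa a w k) es s t"
  shows "\<exists>z < M ^ Suc k. separating es n a w s t k (digit M z)"
proof (cases "\<exists>k' \<ge> k. simple_walk es s t (replicate k' a)")
  case True
  define l where "l = (LEAST k'. k \<le> k' \<and> simple_walk es s t (replicate k' a))"
  have l: "k \<le> l" "simple_walk es s t (replicate l a)"
    using LeastI_ex[of "\<lambda>k'. k \<le> k' \<and> simple_walk es s t (replicate k' a)"] True unfolding l_def by auto
  have least: "\<not> simple_walk es s t (replicate k' a)" if "k \<le> k'" "k' < l" for k'
    using not_less_Least[of k' "\<lambda>k'. k \<le> k' \<and> simple_walk es s t (replicate k' a)"] that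
    unfolding l_def by auto
  \<comment> \<open>Here the word is taken to be empty, so that the second outcome would be a
    shorter path of the same kind, against the choice of \<open>l\<close>.\<close>
  have "simple_walk es s t (replicate k a @ [] @ replicate (l - k) a)"
    using l by (simp flip: replicate_add)
  from separating_exists_for_path[OF wf n _ M this] obtain z where z: "z < M ^ Suc k" "digit M z 0 > 0"
    "\<And>col lay par. (\<And>v. v < n \<Longrightarrow> col v = v mod digit M z 0) \<Longrightarrow>
       layered es n a s k col (digit M z) lay par \<Longrightarrow>
       (\<exists>x < n. lay x = Suc k \<and> tail es a t (ancestors par k x) [] x) \<or>
       (\<exists>k'. k \<le> k' \<and> k' < k + (l - k) \<and> simple_walk es s t (replicate k' a))"
    by (metis le0 list.size(3))
  have "separating es n a w s t k (digit M z)"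
    unfolding separating_def solves_def
  proof (intro conjI allI impI z(2))
    fix col lay par
    assume "\<forall>v<n. col v = v mod digit M z 0" "layered es n a s k col (digit M z) lay par"
    then show "\<exists>x<n. lay x = Suc k \<and>
        (tail es a t (ancestors par k x) [] x \<or> tail es a t (ancestors par k x) w x)"
      using z(3)[of col lay par] least l(1) by auto
  qed
  with z(1) show ?thesis by blast
next
  case False
  then obtain m where "simple_walk es s t (replicate k a @ w @ replicate m a)"
    using path unfolding SimplePath_akwa_iff by (metis le_add1 replicate_add)
  from separating_exists_for_path[OF wf n _ M this] obtain z where z: "z < M ^ Suc k" "digit M z 0 > 0"
    "\<And>col lay par. (\<And>v. v < n \<Longrightarrow> col v = v mod digit M z 0) \<Longrightarrow>
       layered es n a s k col (digit M z) lay par \<Longrightarrow>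
       (\<exists>x < n. lay x = Suc k \<and> tail es a t (ancestors par k x) w x) \<or>
       (\<exists>k'. k \<le> k' \<and> k' < k + m \<and> simple_walk es s t (replicate k' a))"
    by (metis order_refl)
  have "separating es n a w s t k (digit M z)"
    unfolding separating_def solves_def
  proof (intro conjI allI impI z(2))
    fix col lay par
    assume "\<forall>v<n. col v = v mod digit M z 0" "layered es n a s k col (digit M z) lay par"
    then show "\<exists>x<n. lay x = Suc k \<and>
        (tail es a t (ancestors par k x) [] x \<or> tail es a t (ancestors par k x) w x)"
      using z(3)[of col lay par] False by auto
  qed
  with z(1) show ?thesis by blast
qed

subsection \<open>The program\<close>

text \<open>Variables: 0 is the result, 1 to 5 are \<open>n\<close>, \<open>s\<close>, \<open>t\<close>, \<open>k\<close> and the number of edges, 6 is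
  \<open>k + 1\<close>, 7 and 8 are the base \<open>M\<close> and \<open>M ^ (k + 1)\<close>, 9 is the number whose base \<open>M\<close> digits encode the
  modulus and the colour sequence, 16 is the end node of the current \<open>k\<close>-path, and from 24 on every letter
  of \<open>w\<close> has a loop counter and a node. Arrays: 0 is the input word (edge \<open>j\<close> starts at index
  \<open>6 + 3 * j\<close>), 1 the digits, 2 the layers, 3 the parents, 4 the marks, 5 the reached nodes, 6 the
  colours. The value of a condition is a sum of terms that all vanish exactly when the else branch is to
  be taken.\<close>

lemma For_rule:
  assumes "\<sigma> (Var y) = b" and "I 0 (\<sigma>(Var x := 0))"
    and "\<And>i s. i < b \<Longrightarrow> I i s \<Longrightarrow> s (Var x) = i \<Longrightarrow>
           (\<And>l. l \<notin> writes (For x y c) \<Longrightarrow> s l = \<sigma> l) \<Longrightarrow> I (Suc i) ((sem c s)(Var x := Suc i))"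
  shows "I b (sem (For x y c) \<sigma>)"
proof -
  let ?J = "\<lambda>i s. I i s \<and> (\<forall>l. l \<notin> writes (For x y c) \<longrightarrow> s l = \<sigma> l)"
  have "?J b (loop x (sem c) b \<sigma>)"
  proof (rule loop_invariant)
    fix i s assume "i < b" "?J i s" "s (Var x) = i"
    moreover have "sem c s l = s l" if "l \<notin> writes (For x y c)" for l
      using that by (intro sem_frame) auto
    ultimately show "?J (Suc i) ((sem c s)(Var x := Suc i))" using assms(3) by auto
  next
    show "?J 0 (\<sigma>(Var x := 0))" by (intro conjI assms(2)) simp
  qed
  then show ?thesis using assms(1) by simp
qed

lemma Arr_in_range [simp]: "Arr j i \<in> range (Arr j') \<longleftrightarrow> j = j'" "Var x \<notin> range (Arr j)"
  by auto

definition neq :: "aexp \<Rightarrow> aexp \<Rightarrow> aexp" where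
  "neq e f = Plus (Minus e f) (Minus f e)"

lemma val_neq [simp]: "val (neq e f) \<sigma> = 0 \<longleftrightarrow> val e \<sigma> = val f \<sigma>"
  by (auto simp: neq_def)

definition fld :: "nat \<Rightarrow> nat \<Rightarrow> aexp" where
  "fld c j = Get 0 (Plus (N (6 + c)) (Plus (X j) (Plus (X j) (X j))))"

lemma val_fld [simp]: "val (fld c j) \<sigma> = \<sigma> (Arr 0 (6 + c + 3 * \<sigma> (Var j)))"
  by (simp add: fld_def add_ac)

lemma wfE_fld [simp]: "wfE nv d (fld c j) \<longleftrightarrow> d < 13 \<and> j < nv"
  by (auto simp: fld_def)

definition inst :: "nat \<Rightarrow> edge list \<Rightarrow> nat \<Rightarrow> nat \<Rightarrow> nat \<Rightarrow> store \<Rightarrow> bool" where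
  "inst n es s t k \<sigma> \<longleftrightarrow> \<sigma> (Var 1) = n \<and> \<sigma> (Var 2) = s \<and> \<sigma> (Var 3) = t \<and> \<sigma> (Var 4) = k \<and>
     \<sigma> (Var 5) = length es \<and>
     (\<forall>j < length es. es ! j = (\<sigma> (Arr 0 (6 + 3 * j)), \<sigma> (Arr 0 (7 + 3 * j)), \<sigma> (Arr 0 (8 + 3 * j))))"

definition inst_locs :: "loc set" where
  "inst_locs = Var ` {1, 2, 3, 4, 5} \<union> range (Arr 0)"

lemma inst_cong:
  assumes "inst n es s t k \<sigma>" "\<And>l. l \<in> inst_locs \<Longrightarrow> \<sigma>' l = \<sigma> l"
  shows "inst n es s t k \<sigma>'"
  using assms unfolding inst_def inst_locs_def by auto

lemma inst_edge:
  assumes "inst n es s t k \<sigma>" "j < length es"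
  shows "es ! j = (\<sigma> (Arr 0 (6 + 3 * j)), \<sigma> (Arr 0 (7 + 3 * j)), \<sigma> (Arr 0 (8 + 3 * j)))"
  using assms unfolding inst_def by blast

lemma inst_node:
  assumes "inst n es s t k \<sigma>" "wf_graph n es" "j < length es"
  shows "\<sigma> (Arr 0 (6 + 3 * j)) < n" "\<sigma> (Arr 0 (8 + 3 * j)) < n"
    "(\<sigma> (Arr 0 (6 + 3 * j)), \<sigma> (Arr 0 (7 + 3 * j)), \<sigma> (Arr 0 (8 + 3 * j))) \<in> set es"
proof -
  show *: "(\<sigma> (Arr 0 (6 + 3 * j)), \<sigma> (Arr 0 (7 + 3 * j)), \<sigma> (Arr 0 (8 + 3 * j))) \<in> set es"
    using inst_edge[OF assms(1,3)] nth_mem[OF assms(3)] by metis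
  then show "\<sigma> (Arr 0 (6 + 3 * j)) < n" "\<sigma> (Arr 0 (8 + 3 * j)) < n"
    using assms(2) unfolding wf_graph_def by auto
qed

section \<open>Reachability along \<open>a\<close>-edges past the marked nodes\<close>

definition clear :: "nat \<Rightarrow> cmd" where
  "clear j = For 15 1 (Put j (X 15) (N 0))"

lemma clear_correct:
  assumes "\<sigma> (Var 1) = n" "v < n"
  shows "sem (clear j) \<sigma> (Arr j v) = 0"
proof -
  have "\<forall>v < n. sem (clear j) \<sigma> (Arr j v) = 0" unfolding clear_def
    by (rule For_rule[where I = "\<lambda>i s. \<forall>v < i. s (Arr j v) = 0"]) (use assms in \<open>auto simp: less_Suc_eq\<close>)
  then show ?thesis using assms(2) by blast
qed

lemma writes_clear [simp]: "writes (clear j) = insert (Var 15) (range (Arr j))"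
  by (auto simp: clear_def)

abbreviation reach_step :: "nat \<Rightarrow> cmd" where
  "reach_step a \<equiv>
     Cond (Plus (neq (fld 1 13) (N a)) (Plus (Minus (N 1) (Get 5 (fld 0 13))) (Get 4 (fld 2 13))))
       Skip
       (Put 5 (fld 2 13) (N 1))"

text \<open>\<open>length es\<close> rounds are enough, since a reachable node has a walk with at
  most as many steps as the relation has pairs. The result is only ever raised to 1, so that answers
  accumulate over all calls.\<close>

definition reach_prog :: "nat \<Rightarrow> nat \<Rightarrow> cmd" where
  "reach_prog a x =
     clear 5 ;;
     Put 5 (X x) (N 1) ;;
     For 10 5 (For 13 5 (reach_step a)) ;;
     Cond (Get 5 (X 3)) (Asg 0 (N 1)) Skip"

definition marked :: "nat \<Rightarrow> store \<Rightarrow> nat set" where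
  "marked n \<sigma> = {v. v < n \<and> \<sigma> (Arr 4 v) \<noteq> 0}"

lemma writes_reach_prog: "writes (reach_prog a x) = {Var 0, Var 10, Var 13, Var 15} \<union> range (Arr 5)"
  by (auto simp: reach_prog_def)

text \<open>Updates happen in place, so one round may follow several edges in a row. The reached set
  is therefore bounded only from both sides: inside \<open>A\<^sup>*\<close>, and at least one step
  further than before.\<close>

lemma reach_round:
  assumes inst: "inst n es s t k \<sigma>" and wf: "wf_graph n es"
    and A: "A = avoiding es a (marked n \<sigma>)"
    and sound: "\<And>v. v < n \<Longrightarrow> \<sigma> (Arr 5 v) \<noteq> 0 \<Longrightarrow> (u, v) \<in> A\<^sup>*"
  defines "\<sigma>' \<equiv> sem (For 13 5 (reach_step a)) \<sigma>"
  shows "\<And>v. v < n \<Longrightarrow> \<sigma>' (Arr 5 v) \<noteq> 0 \<Longrightarrow> (u, v) \<in> A\<^sup>*"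
    and "\<And>v. \<sigma> (Arr 5 v) \<noteq> 0 \<Longrightarrow> \<sigma>' (Arr 5 v) \<noteq> 0"
    and "\<And>v v'. \<sigma> (Arr 5 v) \<noteq> 0 \<Longrightarrow> (v, v') \<in> A \<Longrightarrow> \<sigma>' (Arr 5 v') \<noteq> 0"
proof -
  let ?I = "\<lambda>j \<tau>. (\<forall>v < n. \<tau> (Arr 5 v) \<noteq> 0 \<longrightarrow> (u, v) \<in> A\<^sup>*) \<and>
     (\<forall>v. \<sigma> (Arr 5 v) \<noteq> 0 \<longrightarrow> \<tau> (Arr 5 v) \<noteq> 0) \<and>
     (\<forall>j' < j. \<forall>v v'. es ! j' = (v, a, v') \<longrightarrow> v' \<notin> marked n \<sigma> \<longrightarrow> \<sigma> (Arr 5 v) \<noteq> 0 \<longrightarrow>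
        \<tau> (Arr 5 v') \<noteq> 0)"
  have I: "?I (length es) \<sigma>'"
    unfolding \<sigma>'_def
  proof (rule For_rule[where I = ?I])
    show "\<sigma> (Var 5) = length es" using inst by (simp add: inst_def)
    show "?I 0 (\<sigma>(Var 13 := 0))" using sound by auto
    fix j \<tau>
    assume j: "j < length es" and I: "?I j \<tau>" and jv: "\<tau> (Var 13) = j"
      and fr: "\<And>l. l \<notin> writes (For 13 5 (reach_step a)) \<Longrightarrow> \<tau> l = \<sigma> l"
    have arr: "\<tau> (Arr 0 i) = \<sigma> (Arr 0 i)" "\<tau> (Arr 4 i) = \<sigma> (Arr 4 i)" for i
      using fr by auto
    obtain v l v' where e: "es ! j = (v, l, v')" by (metis prod_cases3)
    then have f: "\<sigma> (Arr 0 (6 + 3 * j)) = v" "\<sigma> (Arr 0 (7 + 3 * j)) = l" "\<sigma> (Arr 0 (8 + 3 * j)) = v'"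
      using inst_edge[OF inst j] by auto
    note n = inst_node[OF inst wf j, unfolded f]
    have v'm: "v' \<in> marked n \<sigma> \<longleftrightarrow> \<sigma> (Arr 4 v') \<noteq> 0" using n by (simp add: marked_def)
    let ?c = "l = a \<and> \<tau> (Arr 5 v) \<noteq> 0 \<and> v' \<notin> marked n \<sigma>"
    have step: "sem (reach_step a) \<tau> = (if ?c then \<tau>(Arr 5 v' := 1) else \<tau>)"
      using f by (auto simp: jv arr v'm)
    have "(u, v') \<in> A\<^sup>*" if ?c
    proof -
      have "(v, v') \<in> A" using that n(3) unfolding A avoiding_def by auto
      moreover have "(u, v) \<in> A\<^sup>*" using I that n(1) by auto
      ultimately show ?thesis by (rule rtrancl_into_rtrancl[rotated])
    qed
    then show "?I (Suc j) ((sem (reach_step a) \<tau>)(Var 13 := Suc j))"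
      unfolding step using I e by (auto simp: less_Suc_eq)
  qed
  show "\<sigma>' (Arr 5 v) \<noteq> 0 \<Longrightarrow> (u, v) \<in> A\<^sup>*" if "v < n" for v using I that by blast
  show "\<sigma>' (Arr 5 v) \<noteq> 0" if "\<sigma> (Arr 5 v) \<noteq> 0" for v using I that by blast
  show "\<sigma>' (Arr 5 v') \<noteq> 0" if a: "\<sigma> (Arr 5 v) \<noteq> 0" "(v, v') \<in> A" for v v'
  proof -
    obtain j where "j < length es" "es ! j = (v, a, v')" "v' \<notin> marked n \<sigma>"
      using a(2) unfolding A avoiding_def by (auto simp: in_set_conv_nth)
    then show ?thesis using I a(1) by blast
  qed
qed

lemma card_avoiding: "finite (avoiding es a S)" "card (avoiding es a S) \<le> length es"
proof -
  have sub: "avoiding es a S \<subseteq> (\<lambda>(u, l, v). (u, v)) ` set es" by (force simp: avoiding_def)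
  then show "finite (avoiding es a S)" by (rule finite_subset) simp
  have "card (avoiding es a S) \<le> card ((\<lambda>(u, l, v). (u, v)) ` set es)"
    using sub by (intro card_mono) auto
  also have "\<dots> \<le> card (set es)" by (rule card_image_le) simp
  also have "\<dots> \<le> length es" by (rule card_length)
  finally show "card (avoiding es a S) \<le> length es" .
qed

lemma reach_prog_correct:
  assumes inst: "inst n es s t k \<sigma>" and wf: "wf_graph n es" and t: "t < n"
    and x: "x \<notin> {10, 13, 15}" "\<sigma> (Var x) = u" "u < n"
  shows "sem (reach_prog a x) \<sigma> (Var 0) =
     (if (u, t) \<in> (avoiding es a (marked n \<sigma>))\<^sup>* then 1 else \<sigma> (Var 0))"
proof -
  define A where "A = avoiding es a (marked n \<sigma>)"
  let ?body = "For 13 5 (reach_step a)"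
  define \<tau> where "\<tau> = sem (clear 5 ;; Put 5 (X x) (N 1)) \<sigma>"
  have fr: "\<tau> l = \<sigma> l" if "l \<notin> insert (Var 15) (range (Arr 5))" for l
    unfolding \<tau>_def by (rule sem_frame) (use that in auto)
  have \<tau>5: "\<tau> (Arr 5 v) \<noteq> 0 \<longleftrightarrow> v = u" if "v < n" for v
  proof -
    have "sem (clear 5) \<sigma> (Arr 5 v) = 0" using that inst by (intro clear_correct) (auto simp: inst_def)
    moreover have "sem (clear 5) \<sigma> (Var x) = u" using x by (subst sem_frame) auto
    ultimately show ?thesis by (simp add: \<tau>_def)
  qed
  have m: "marked n \<tau> = marked n \<sigma>" unfolding marked_def using fr by auto
  have i\<tau>: "inst n es s t k \<tau>" by (rule inst_cong[OF inst fr]) (auto simp: inst_locs_def)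
  let ?I = "\<lambda>i \<rho>. (\<forall>v < n. \<rho> (Arr 5 v) \<noteq> 0 \<longrightarrow> (u, v) \<in> A\<^sup>*) \<and>
     (\<forall>j \<le> i. \<forall>v. (u, v) \<in> A ^^ j \<longrightarrow> \<rho> (Arr 5 v) \<noteq> 0)"
  let ?\<tau>' = "sem (For 10 5 ?body) \<tau>"
  have I: "?I (length es) ?\<tau>'"
  proof (rule For_rule[where I = ?I])
    show "\<tau> (Var 5) = length es" using i\<tau> by (simp add: inst_def)
    show "?I 0 (\<tau>(Var 10 := 0))" using \<tau>5 x by auto
    fix i \<rho> assume I: "?I i \<rho>" and fr': "\<And>l. l \<notin> writes (For 10 5 ?body) \<Longrightarrow> \<rho> l = \<tau> l"
    have i\<rho>: "inst n es s t k \<rho>" by (rule inst_cong[OF i\<tau> fr']) (auto simp: inst_locs_def)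
    have "marked n \<rho> = marked n \<tau>" unfolding marked_def using fr' by auto
    then have A': "A = avoiding es a (marked n \<rho>)" unfolding A_def m by simp
    note R = reach_round[OF i\<rho> wf A', of u]
    show "?I (Suc i) ((sem ?body \<rho>)(Var 10 := Suc i))"
    proof (intro conjI allI impI)
      fix v assume "v < n" "((sem ?body \<rho>)(Var 10 := Suc i)) (Arr 5 v) \<noteq> 0"
      then show "(u, v) \<in> A\<^sup>*" using R(1) I by (simp del: sem.simps)
    next
      fix j v assume j: "j \<le> Suc i" and v: "(u, v) \<in> A ^^ j"
      have "sem ?body \<rho> (Arr 5 v) \<noteq> 0"
      proof (cases "j = Suc i")
        case False
        then have "j \<le> i" using j by simp
        then show ?thesis using R(2) I v by blast
      next
        case True
        then obtain v' where "(u, v') \<in> A ^^ i" "(v', v) \<in> A" using v by auto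
        then show ?thesis using R(3) I by blast
      qed
      then show "((sem ?body \<rho>)(Var 10 := Suc i)) (Arr 5 v) \<noteq> 0" by (simp del: sem.simps)
    qed
  qed
  have "?\<tau>' (Arr 5 t) \<noteq> 0 \<longleftrightarrow> (u, t) \<in> A\<^sup>*"
  proof
    assume "?\<tau>' (Arr 5 t) \<noteq> 0"
    then show "(u, t) \<in> A\<^sup>*" using I t by blast
  next
    assume "(u, t) \<in> A\<^sup>*"
    then obtain j where "j \<le> card A" "(u, t) \<in> A ^^ j"
      using rtrancl_finite_eq_relpow[of A] card_avoiding(1) unfolding A_def by auto
    then show "?\<tau>' (Arr 5 t) \<noteq> 0"
      using I card_avoiding(2) le_trans unfolding A_def by blast
  qed
  moreover have "?\<tau>' (Var 3) = t" "?\<tau>' (Var 0) = \<sigma> (Var 0)"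
    using sem_frame[of "Var 3" "For 10 5 ?body" \<tau>] sem_frame[of "Var 0" "For 10 5 ?body" \<tau>] fr[of "Var 3"] fr[of "Var 0"] inst
    by (auto simp: inst_def simp del: sem.simps)
  moreover have "sem (reach_prog a x) \<sigma> = sem (Cond (Get 5 (X 3)) (Asg 0 (N 1)) Skip) ?\<tau>'"
    unfolding reach_prog_def \<tau>_def by simp
  ultimately show ?thesis unfolding A_def by (simp del: sem.simps(6))
qed

text \<open>Backtracking with one nested loop over the edges per letter, which stays polynomial
  because \<open>w\<close> is fixed. Each depth \<open>d\<close> owns two registers, and its mark is
  removed on the way back.\<close>

primrec tail_prog :: "nat \<Rightarrow> nat list \<Rightarrow> nat \<Rightarrow> nat \<Rightarrow> cmd" where
  "tail_prog a [] d x = reach_prog a x"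
| "tail_prog a (l # w) d x =
     For (24 + 2 * d) 5
       (Cond (Plus (neq (fld 0 (24 + 2 * d)) (X x))
               (Plus (neq (fld 1 (24 + 2 * d)) (N l)) (Get 4 (fld 2 (24 + 2 * d)))))
          Skip
          (Asg (25 + 2 * d) (fld 2 (24 + 2 * d)) ;;
           Put 4 (X (25 + 2 * d)) (N 1) ;;
           tail_prog a w (Suc d) (25 + 2 * d) ;;
           Put 4 (X (25 + 2 * d)) (N 0)))"

lemma writes_tail_prog:
  "writes (tail_prog a w d x) \<subseteq>
     {Var 0, Var 10, Var 13, Var 15} \<union> Var ` {24 + 2 * d..} \<union> range (Arr 4) \<union> range (Arr 5)"
proof (induction w arbitrary: d x)
  case (Cons l w)
  have "Var ` {24 + 2 * Suc d..} \<subseteq> Var ` {24 + 2 * d..}" by auto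
  with Cons[of "Suc d" "25 + 2 * d"] show ?case by auto
qed (auto simp: writes_reach_prog)

lemma tail_prog_correct:
  assumes "inst n es s t k \<sigma>" "wf_graph n es" "t < n"
    and "x = 16 \<or> 24 \<le> x \<and> x < 24 + 2 * d" "\<sigma> (Var x) = u" "u < n"
  shows "sem (tail_prog a w d x) \<sigma> (Var 0) = (if tail es a t (marked n \<sigma>) w u then 1 else \<sigma> (Var 0)) \<and>
     (\<forall>v. sem (tail_prog a w d x) \<sigma> (Arr 4 v) = \<sigma> (Arr 4 v))"
  using assms
proof (induction w arbitrary: d x \<sigma> u)
  case Nil
  have "x \<notin> {10, 13, 15}" using Nil.prems(4) by auto
  then show ?case
    using reach_prog_correct[OF Nil.prems(1-3) _ Nil.prems(5,6)]
      sem_frame[of "Arr 4 _" "reach_prog a x" \<sigma>] by (auto simp: writes_reach_prog)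
next
  case (Cons l w)
  let ?j = "24 + 2 * d" and ?y = "25 + 2 * d"
  let ?cond = "Plus (neq (fld 0 ?j) (X x)) (Plus (neq (fld 1 ?j) (N l)) (Get 4 (fld 2 ?j)))"
  let ?then = "Asg ?y (fld 2 ?j) ;; Put 4 (X ?y) (N 1) ;; tail_prog a w (Suc d) ?y ;; Put 4 (X ?y) (N 0)"
  let ?body = "Cond ?cond Skip ?then"
  let ?S = "marked n \<sigma>"
  let ?good = "\<lambda>j. \<exists>v. es ! j = (u, l, v) \<and> v \<notin> ?S \<and> tail es a t (insert v ?S) w v"
  let ?I = "\<lambda>j \<tau>. \<tau> (Var 0) = (if \<exists>j' < j. ?good j' then 1 else \<sigma> (Var 0)) \<and>
     (\<forall>v. \<tau> (Arr 4 v) = \<sigma> (Arr 4 v))"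
  have W: "writes (For ?j 5 ?body) \<subseteq>
     {Var 0, Var 10, Var 13, Var 15} \<union> Var ` {24 + 2 * d..} \<union> range (Arr 4) \<union> range (Arr 5)"
    using writes_tail_prog[of a "l # w" d x] by simp
  have "?I (length es) (sem (For ?j 5 ?body) \<sigma>)"
  proof (rule For_rule[where I = ?I])
    show "\<sigma> (Var 5) = length es" using Cons.prems(1) by (simp add: inst_def)
    show "?I 0 (\<sigma>(Var ?j := 0))" by simp
    fix j \<tau>
    assume j: "j < length es" and I: "?I j \<tau>" and jv: "\<tau> (Var ?j) = j"
      and fr: "\<And>l. l \<notin> writes (For ?j 5 ?body) \<Longrightarrow> \<tau> l = \<sigma> l"
    have i\<tau>: "inst n es s t k \<tau>"
      by (rule inst_cong[OF Cons.prems(1) fr]) (use W in \<open>auto simp: inst_locs_def\<close>)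
    have "Var x \<notin> writes (For ?j 5 ?body)" using W Cons.prems(4) by auto
    then have x: "\<tau> (Var x) = u" using fr Cons.prems(5) by auto
    obtain u' l' v where e: "es ! j = (u', l', v)" by (metis prod_cases3)
    then have f: "\<tau> (Arr 0 (6 + 3 * j)) = u'" "\<tau> (Arr 0 (7 + 3 * j)) = l'" "\<tau> (Arr 0 (8 + 3 * j)) = v"
      using inst_edge[OF i\<tau> j] by auto
    note nn = inst_node[OF i\<tau> Cons.prems(2) j, unfolded f]
    have vS: "v \<in> ?S \<longleftrightarrow> \<tau> (Arr 4 v) \<noteq> 0" using nn I by (simp add: marked_def)
    let ?c = "u' = u \<and> l' = l \<and> v \<notin> ?S"
    have cond: "val ?cond \<tau> = 0 \<longleftrightarrow> ?c" using f by (auto simp: jv x vS)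
    show "?I (Suc j) ((sem ?body \<tau>)(Var ?j := Suc j))"
    proof (cases ?c)
      case False
      then have "\<not> ?good j" using e by auto
      moreover have "sem ?body \<tau> = \<tau>" using cond False by simp
      ultimately show ?thesis using I by (auto simp: less_Suc_eq)
    next
      case True
      define \<rho> where "\<rho> = \<tau>(Var ?y := v, Arr 4 v := 1)"
      have "sem (Asg ?y (fld 2 ?j) ;; Put 4 (X ?y) (N 1)) \<tau> = \<rho>"
        using f by (auto simp: \<rho>_def jv)
      then have body: "sem ?body \<tau> = sem (Put 4 (X ?y) (N 0)) (sem (tail_prog a w (Suc d) ?y) \<rho>)"
        using cond True by simp
      have i\<rho>: "inst n es s t k \<rho>" by (rule inst_cong[OF i\<tau>]) (auto simp: \<rho>_def inst_locs_def)
      have m: "marked n \<rho> = insert v ?S" using I nn(2) by (auto simp: \<rho>_def marked_def)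
      have "sem (tail_prog a w (Suc d) ?y) \<rho> (Var 0) =
          (if tail es a t (insert v ?S) w v then 1 else \<rho> (Var 0)) \<and>
          (\<forall>v. sem (tail_prog a w (Suc d) ?y) \<rho> (Arr 4 v) = \<rho> (Arr 4 v))"
        unfolding m[symmetric] by (rule Cons.IH[OF i\<rho> Cons.prems(2,3)]) (use nn in \<open>auto simp: \<rho>_def\<close>)
      moreover have "sem (tail_prog a w (Suc d) ?y) \<rho> (Var ?y) = v"
      proof -
        have "Var ?y \<notin> writes (tail_prog a w (Suc d) ?y)" using writes_tail_prog[of a w "Suc d" ?y] by auto
        then show ?thesis by (subst sem_frame) (auto simp: \<rho>_def)
      qed
      moreover have "?good j \<longleftrightarrow> tail es a t (insert v ?S) w v" using e True by auto
      \<comment> \<open>The node was unmarked before, so overwriting its mark with 0 restores the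
        marks exactly.\<close>
      moreover have "\<tau> (Arr 4 v) = 0" using True vS by simp
      ultimately show ?thesis unfolding body using I
        by (auto simp: \<rho>_def less_Suc_eq)
    qed
  qed
  moreover have "(\<exists>j < length es. ?good j) \<longleftrightarrow> tail es a t ?S (l # w) u"
    by (auto simp: in_set_conv_nth)
  ultimately show ?case by (simp del: sem.simps)
qed

section \<open>Decoding a guess and colouring the nodes\<close>

abbreviation divmod_step :: cmd where
  "divmod_step \<equiv>
     Cond (Minus (Plus (X 11) (N 1)) (X 7))
       (Asg 11 (Minus (X 11) (X 7)) ;; Asg 12 (Plus (X 12) (N 1)))
       Skip"

definition decode :: cmd where
  "decode =
     Asg 11 (X 9) ;;
     For 10 6
       (Asg 12 (N 0) ;;
        For 13 8 divmod_step ;;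
        Put 1 (X 10) (X 11) ;;
        Asg 11 (X 12))"

text \<open>Division by repeated subtraction. The limit \<open>b\<close> exceeds the dividend, so
  \<open>b\<close> passes complete the quotient; surplus passes leave quotient and remainder
  alone.\<close>

lemma divmod_loop:
  assumes "\<sigma> (Var 7) = M" "\<sigma> (Var 8) = b" "\<sigma> (Var 11) = q" "\<sigma> (Var 12) = 0" "M > 0" "q < b"
  defines "\<sigma>' \<equiv> sem (For 13 8 divmod_step) \<sigma>"
  shows "\<sigma>' (Var 11) = q mod M" "\<sigma>' (Var 12) = q div M"
proof -
  let ?I = "\<lambda>j s. s (Var 11) + s (Var 12) * M = q \<and> (s (Var 11) < M \<or> s (Var 12) = j)"
  have I: "?I b \<sigma>'" unfolding \<sigma>'_def
  proof (rule For_rule[where I = ?I])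
    fix j s
    assume I: "?I j s" and fr: "\<And>l. l \<notin> writes (For 13 8 divmod_step) \<Longrightarrow> s l = \<sigma> l"
    have "s (Var 7) = M" using fr[of "Var 7"] assms(1) by simp
    then show "?I (Suc j) ((sem divmod_step s)(Var 13 := Suc j))"
      using I by (auto simp: algebra_simps)
  qed (use assms in auto)
  have "\<sigma>' (Var 11) < M"
  proof (rule ccontr)
    assume "\<not> \<sigma>' (Var 11) < M"
    then have "\<sigma>' (Var 12) = b" using I by blast
    then have "b * M \<le> q" using I by auto
    moreover have "b \<le> b * M" using \<open>M > 0\<close> by simp
    ultimately show False using \<open>q < b\<close> by simp
  qed
  with I \<open>M > 0\<close> show "\<sigma>' (Var 11) = q mod M" "\<sigma>' (Var 12) = q div M" by auto
qed

lemma decode_correct: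
  assumes "\<sigma> (Var 6) = k1" "\<sigma> (Var 7) = M" "\<sigma> (Var 8) = b" "\<sigma> (Var 9) = z" "M > 0" "z < b" "i < k1"
  shows "sem decode \<sigma> (Arr 1 i) = digit M z i"
proof -
  let ?\<tau> = "\<sigma>(Var 11 := z)"
  let ?div = "For 13 8 divmod_step"
  let ?body = "Asg 12 (N 0) ;; ?div ;; Put 1 (X 10) (X 11) ;; Asg 11 (X 12)"
  let ?I = "\<lambda>i s. s (Var 11) = z div M ^ i \<and> (\<forall>i' < i. s (Arr 1 i') = digit M z i')"
  have "?I k1 (sem (For 10 6 ?body) ?\<tau>)"
  proof (rule For_rule[where I = ?I])
    fix i s
    assume I: "?I i s" and iv: "s (Var 10) = i"
      and fr: "\<And>l. l \<notin> writes (For 10 6 ?body) \<Longrightarrow> s l = ?\<tau> l"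
    let ?s = "s(Var 12 := 0)"
    have 7: "?s (Var 7) = M" "?s (Var 8) = b" "?s (Var 12) = 0" using fr assms by auto
    have 11: "?s (Var 11) = z div M ^ i" using I by simp
    have "z div M ^ i < b" using \<open>z < b\<close> by (rule le_less_trans[OF div_le_dividend])
    note d = divmod_loop[of ?s M b "z div M ^ i", OF 7(1,2) 11 7(3) \<open>M > 0\<close> this]
    have fr': "sem ?div ?s l = ?s l" if "l \<notin> {Var 11, Var 12, Var 13}" for l
      by (rule sem_frame) (use that in auto)
    have "sem ?body s = (sem ?div ?s)(Arr 1 i := z div M ^ i mod M, Var 11 := z div M ^ i div M)"
      using d fr'[of "Var 10"] iv by (simp del: sem.simps(6))
    moreover have "z div M ^ i div M = z div M ^ Suc i"
      by (simp only: power_Suc2 div_mult2_eq)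
    ultimately show "?I (Suc i) ((sem ?body s)(Var 10 := Suc i))"
      using I fr' by (auto simp: less_Suc_eq digit_def simp del: sem.simps)
  qed (use assms in auto)
  then show ?thesis using assms(4,7) by (simp add: decode_def del: sem.simps(6))
qed

text \<open>A counter that wraps around at the modulus yields the residues without any
  division.\<close>

definition colour :: cmd where
  "colour =
     Asg 14 (N 0) ;;
     For 15 1
       (Put 6 (X 15) (X 14) ;;
        Asg 14 (Plus (X 14) (N 1)) ;;
        Cond (neq (X 14) (Get 1 (N 0))) Skip (Asg 14 (N 0)))"

lemma colour_correct:
  assumes "\<sigma> (Var 1) = n" "\<sigma> (Arr 1 0) = m" "m > 0" "v < n"
  shows "sem colour \<sigma> (Arr 6 v) = v mod m"
proof -
  let ?body = "Put 6 (X 15) (X 14) ;; Asg 14 (Plus (X 14) (N 1)) ;;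
        Cond (neq (X 14) (Get 1 (N 0))) Skip (Asg 14 (N 0))"
  let ?\<tau> = "\<sigma>(Var 14 := 0)"
  let ?I = "\<lambda>i s. s (Var 14) = i mod m \<and> (\<forall>v < i. s (Arr 6 v) = v mod m)"
  have "?I n (sem (For 15 1 ?body) ?\<tau>)"
  proof (rule For_rule[where I = ?I])
    fix i s
    assume I: "?I i s" and iv: "s (Var 15) = i"
      and fr: "\<And>l. l \<notin> writes (For 15 1 ?body) \<Longrightarrow> s l = ?\<tau> l"
    have "s (Arr 1 0) = m" using fr[of "Arr 1 0"] assms(2) by simp
    then show "?I (Suc i) ((sem ?body s)(Var 15 := Suc i))"
      using I iv by (auto simp: less_Suc_eq mod_Suc)
  qed (use assms in auto)
  then show ?thesis using assms(4) by (simp add: colour_def)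
qed

section \<open>Computing the layers\<close>

abbreviation layer_step :: "nat \<Rightarrow> cmd" where
  "layer_step a \<equiv>
     Cond (Plus (neq (fld 1 13) (N a))
            (Plus (neq (Get 2 (fld 0 13)) (Plus (X 10) (N 1)))
              (Plus (Get 2 (fld 2 13)) (neq (Get 6 (fld 2 13)) (Get 1 (Plus (X 10) (N 1)))))))
       Skip
       (Put 2 (fld 2 13) (Plus (X 10) (N 2)) ;; Put 3 (fld 2 13) (fld 0 13))"

definition layer :: "nat \<Rightarrow> cmd" where
  "layer a =
     clear 2 ;;
     Put 2 (X 2) (N 1) ;;
     For 10 4 (For 13 5 (layer_step a))"

text \<open>Although edges are processed in place, rounds do not mix: a node entered now gets layer
  \<open>i + 2\<close>, whereas a predecessor must have layer \<open>i + 1\<close>.\<close>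

lemma layer_round:
  assumes inst: "inst n es s t k \<sigma>" and wf: "wf_graph n es" and i: "\<sigma> (Var 10) = i"
    and col: "col = (\<lambda>v. \<sigma> (Arr 6 v))" and dig: "dig = (\<lambda>i. \<sigma> (Arr 1 i))"
    and old: "layered es n a s i col dig (\<lambda>v. \<sigma> (Arr 2 v)) (\<lambda>v. \<sigma> (Arr 3 v))"
  defines "\<sigma>' \<equiv> sem (For 13 5 (layer_step a)) \<sigma>"
  shows "layered es n a s (Suc i) col dig (\<lambda>v. \<sigma>' (Arr 2 v)) (\<lambda>v. \<sigma>' (Arr 3 v))"
proof -
  let ?body = "layer_step a"
  let ?I = "\<lambda>j \<tau>. (\<forall>v. \<sigma> (Arr 2 v) \<noteq> 0 \<longrightarrow> \<tau> (Arr 2 v) = \<sigma> (Arr 2 v)) \<and>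
     (\<forall>v. \<sigma> (Arr 2 v) = 0 \<longrightarrow> \<tau> (Arr 2 v) \<noteq> 0 \<longrightarrow> \<tau> (Arr 2 v) = Suc (Suc i)) \<and>
     (\<forall>v < n. \<tau> (Arr 2 v) \<noteq> 0 \<longrightarrow> \<tau> (Arr 2 v) = 1 \<and> v = s \<or>
        (\<exists>i' < Suc i. \<tau> (Arr 2 v) = Suc (Suc i') \<and> \<tau> (Arr 3 v) < n \<and> \<tau> (Arr 2 (\<tau> (Arr 3 v))) = Suc i' \<and>
           (\<tau> (Arr 3 v), a, v) \<in> set es \<and> col v = dig (Suc i'))) \<and>
     (\<forall>j' < j. \<forall>u v. es ! j' = (u, a, v) \<longrightarrow> \<sigma> (Arr 2 u) = Suc i \<longrightarrow> col v = dig (Suc i) \<longrightarrow>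
        \<tau> (Arr 2 v) \<noteq> 0)"
  have I: "?I (length es) \<sigma>'" unfolding \<sigma>'_def
  proof (rule For_rule[where I = ?I])
    show "\<sigma> (Var 5) = length es" using inst by (simp add: inst_def)
    show "?I 0 (\<sigma>(Var 13 := 0))" using old unfolding layered_def by (auto intro: less_SucI)
    fix j \<tau>
    assume j: "j < length es" and I: "?I j \<tau>" and jv: "\<tau> (Var 13) = j"
      and fr: "\<And>l. l \<notin> writes (For 13 5 ?body) \<Longrightarrow> \<tau> l = \<sigma> l"
    have arr: "\<tau> (Arr 0 p) = \<sigma> (Arr 0 p)" "\<tau> (Arr 6 p) = col p" "\<tau> (Arr (Suc 0) p) = dig p" "\<tau> (Var 10) = i" for p
      using fr i by (auto simp: col dig)
    obtain u l v where e: "es ! j = (u, l, v)" by (metis prod_cases3)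
    then have f: "\<sigma> (Arr 0 (6 + 3 * j)) = u" "\<sigma> (Arr 0 (7 + 3 * j)) = l" "\<sigma> (Arr 0 (8 + 3 * j)) = v"
      using inst_edge[OF inst j] by auto
    note n = inst_node[OF inst wf j, unfolded f]
    let ?c = "l = a \<and> \<tau> (Arr 2 u) = Suc i \<and> \<tau> (Arr 2 v) = 0 \<and> col v = dig (Suc i)"
    have step: "sem ?body \<tau> = (if ?c then \<tau>(Arr 2 v := Suc (Suc i), Arr 3 v := u) else \<tau>)"
      using f by (auto simp: jv arr)
    show "?I (Suc j) ((sem ?body \<tau>)(Var 13 := Suc j))"
    proof (cases ?c)
      case True
      have uv: "u \<noteq> v" using True by auto
      have \<sigma>v: "\<sigma> (Arr 2 v) = 0" using True I by metis
      let ?\<tau>' = "\<tau>(Arr 2 v := Suc (Suc i), Arr 3 v := u, Var 13 := Suc j)"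
      have "?I (Suc j) ?\<tau>'"
      proof (intro conjI allI impI)
        fix p assume "\<sigma> (Arr 2 p) \<noteq> 0"
        then show "?\<tau>' (Arr 2 p) = \<sigma> (Arr 2 p)" using I \<sigma>v by auto
      next
        fix p assume "\<sigma> (Arr 2 p) = 0" "?\<tau>' (Arr 2 p) \<noteq> 0"
        then show "?\<tau>' (Arr 2 p) = Suc (Suc i)" using I by (cases "p = v") auto
      next
        fix p assume p: "p < n" "?\<tau>' (Arr 2 p) \<noteq> 0"
        show "?\<tau>' (Arr 2 p) = 1 \<and> p = s \<or>
          (\<exists>i' < Suc i. ?\<tau>' (Arr 2 p) = Suc (Suc i') \<and> ?\<tau>' (Arr 3 p) < n \<and>
             ?\<tau>' (Arr 2 (?\<tau>' (Arr 3 p))) = Suc i' \<and> (?\<tau>' (Arr 3 p), a, p) \<in> set es \<and> col p = dig (Suc i'))"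
        proof (cases "p = v")
          case True
          then show ?thesis using \<open>?c\<close> n uv by (intro disjI2 exI[of _ i]) simp
        next
          case False
          then have "\<tau> (Arr 2 p) = 1 \<and> p = s \<or>
            (\<exists>i' < Suc i. \<tau> (Arr 2 p) = Suc (Suc i') \<and> \<tau> (Arr 3 p) < n \<and> \<tau> (Arr 2 (\<tau> (Arr 3 p))) = Suc i' \<and>
               (\<tau> (Arr 3 p), a, p) \<in> set es \<and> col p = dig (Suc i'))"
            using I p by simp
          then show ?thesis
          proof (elim disjE exE conjE)
            fix i' assume *: "i' < Suc i" "\<tau> (Arr 2 p) = Suc (Suc i')" "\<tau> (Arr 3 p) < n"
              "\<tau> (Arr 2 (\<tau> (Arr 3 p))) = Suc i'" "(\<tau> (Arr 3 p), a, p) \<in> set es" "col p = dig (Suc i')"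
            \<comment> \<open>A recorded parent has a nonzero layer, hence is not the node being
              entered and keeps its layer.\<close>
            then have "\<tau> (Arr 3 p) \<noteq> v" using \<open>?c\<close> by auto
            then show ?thesis using * False by (intro disjI2 exI[of _ i']) simp
          qed (use False in simp)
        qed
      next
        fix j' u' v' assume "j' < Suc j" "es ! j' = (u', a, v')" "\<sigma> (Arr 2 u') = Suc i" "col v' = dig (Suc i)"
        then show "?\<tau>' (Arr 2 v') \<noteq> 0" using I e
          by (cases "j' = j") (auto simp: less_Suc_eq)
      qed
      then show ?thesis unfolding step if_P[OF True] .
    next
      case False
      have "\<tau> (Arr 2 v) \<noteq> 0" if "l = a" "\<sigma> (Arr 2 u) = Suc i" "col v = dig (Suc i)"
        using False that I by (metis nat.distinct(1))
      then show ?thesis unfolding step using False I e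
        by (auto simp: less_Suc_eq)
    qed
  qed
  show ?thesis unfolding layered_def
  proof (intro conjI allI impI)
    show "\<sigma>' (Arr 2 s) = 1" using I old unfolding layered_def by (metis zero_neq_one)
  next
    fix v assume "v < n" "\<sigma>' (Arr 2 v) \<noteq> 0"
    then show "\<sigma>' (Arr 2 v) = 1 \<and> v = s \<or>
        (\<exists>i' < Suc i. \<sigma>' (Arr 2 v) = Suc (Suc i') \<and> \<sigma>' (Arr 3 v) < n \<and> \<sigma>' (Arr 2 (\<sigma>' (Arr 3 v))) = Suc i' \<and>
           (\<sigma>' (Arr 3 v), a, v) \<in> set es \<and> col v = dig (Suc i'))" using I by blast
  next
    fix u v i' assume e: "(u, a, v) \<in> set es" and i': "i' < Suc i" and u: "\<sigma>' (Arr 2 u) = Suc i'"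
      and c: "col v = dig (Suc i')"
    \<comment> \<open>Nodes entered in this round have layer \<open>i + 2\<close>, so a node with
      layer at most \<open>i + 1\<close> had it before.\<close>
    have "\<sigma> (Arr 2 u) = Suc i'" using I u i' by (metis less_irrefl Suc_inject nat.distinct(1))
    then show "\<sigma>' (Arr 2 v) \<noteq> 0"
    proof (cases "i' = i")
      case True
      with I e c \<open>\<sigma> (Arr 2 u) = Suc i'\<close> show ?thesis by (auto simp: in_set_conv_nth)
    next
      case False
      then have "\<sigma> (Arr 2 v) \<noteq> 0" using old e c \<open>\<sigma> (Arr 2 u) = Suc i'\<close> i' unfolding layered_def
        by (metis less_antisym)
      then show ?thesis using I by metis
    qed
  qed
qed

lemma layer_correct:
  assumes inst: "inst n es s t k \<sigma>" and wf: "wf_graph n es" and s: "s < n"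
  shows "layered es n a s k (\<lambda>v. \<sigma> (Arr 6 v)) (\<lambda>i. \<sigma> (Arr 1 i))
     (\<lambda>v. sem (layer a) \<sigma> (Arr 2 v)) (\<lambda>v. sem (layer a) \<sigma> (Arr 3 v))"
proof -
  let ?body = "For 13 5 (layer_step a)"
  define \<tau> where "\<tau> = sem (clear 2 ;; Put 2 (X 2) (N 1)) \<sigma>"
  have fr: "\<tau> l = \<sigma> l" if "l \<notin> insert (Var 15) (range (Arr 2))" for l
    unfolding \<tau>_def by (rule sem_frame) (use that in auto)
  have \<tau>2: "\<tau> (Arr 2 v) = (if v = s then 1 else 0)" if "v < n" for v
  proof -
    have "sem (clear 2) \<sigma> (Arr 2 v) = 0" using that inst by (intro clear_correct) (auto simp: inst_def)
    moreover have "sem (clear 2) \<sigma> (Var 2) = s" using inst by (subst sem_frame) (auto simp: inst_def)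
    ultimately show ?thesis by (simp add: \<tau>_def)
  qed
  have i\<tau>: "inst n es s t k \<tau>" by (rule inst_cong[OF inst fr]) (auto simp: inst_locs_def)
  let ?L = "\<lambda>i \<rho>. layered es n a s i (\<lambda>v. \<sigma> (Arr 6 v)) (\<lambda>i. \<sigma> (Arr 1 i))
     (\<lambda>v. \<rho> (Arr 2 v)) (\<lambda>v. \<rho> (Arr 3 v))"
  have "?L k (sem (For 10 4 ?body) \<tau>)"
  proof (rule For_rule[where I = ?L])
    show "\<tau> (Var 4) = k" using i\<tau> by (simp add: inst_def)
    show "?L 0 (\<tau>(Var 10 := 0))" unfolding layered_def using \<tau>2 s by auto
    fix i \<rho>
    assume I: "?L i \<rho>" and iv: "\<rho> (Var 10) = i" and fr': "\<And>l. l \<notin> writes (For 10 4 ?body) \<Longrightarrow> \<rho> l = \<tau> l"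
    have i\<rho>: "inst n es s t k \<rho>" by (rule inst_cong[OF i\<tau> fr']) (auto simp: inst_locs_def)
    have c: "(\<lambda>v. \<sigma> (Arr 6 v)) = (\<lambda>v. \<rho> (Arr 6 v))" "(\<lambda>v. \<sigma> (Arr 1 v)) = (\<lambda>v. \<rho> (Arr 1 v))"
      using fr fr' by (auto simp: fun_eq_iff)
    have "?L (Suc i) (sem ?body \<rho>)"
      using layer_round[OF i\<rho> wf iv c I] .
    then show "?L (Suc i) ((sem ?body \<rho>)(Var 10 := Suc i))" by (simp del: sem.simps)
  qed
  then show ?thesis unfolding layer_def by (simp add: \<tau>_def del: sem.simps(6))
qed

section \<open>Marking a path and testing its continuations\<close>

definition mark :: cmd where
  "mark = clear 4 ;; Asg 17 (X 16) ;; For 10 6 (Put 4 (X 17) (N 1) ;; Asg 17 (Get 3 (X 17)))"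

lemma mark_correct:
  assumes "inst n es s t k \<sigma>" "\<sigma> (Var 6) = Suc k" "\<sigma> (Var 16) = x"
    and anc: "ancestors (\<lambda>v. \<sigma> (Arr 3 v)) k x \<subseteq> {..<n}"
  shows "marked n (sem mark \<sigma>) = ancestors (\<lambda>v. \<sigma> (Arr 3 v)) k x"
proof -
  let ?par = "\<lambda>v. \<sigma> (Arr 3 v)"
  let ?body = "Put 4 (X 17) (N 1) ;; Asg 17 (Get 3 (X 17))"
  define \<tau> where "\<tau> = sem (clear 4 ;; Asg 17 (X 16)) \<sigma>"
  have fr: "\<tau> l = \<sigma> l" if "l \<notin> {Var 15, Var 17} \<union> range (Arr 4)" for l
    unfolding \<tau>_def by (rule sem_frame) (use that in auto)
  have \<tau>4: "\<tau> (Arr 4 v) = 0" if "v < n" for v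
    using clear_correct[of \<sigma> n v 4] that assms(1) by (simp add: \<tau>_def inst_def)
  have \<tau>17: "\<tau> (Var 17) = x"
    using assms(3) sem_frame[of "Var 16" "clear 4" \<sigma>] by (auto simp: \<tau>_def)
  let ?I = "\<lambda>i s. s (Var 17) = (?par ^^ i) x \<and>
     (\<forall>v < n. s (Arr 4 v) \<noteq> 0 \<longleftrightarrow> v \<in> (\<lambda>j. (?par ^^ j) x) ` {..<i})"
  have "?I (Suc k) (sem (For 10 6 ?body) \<tau>)"
  proof (rule For_rule[where I = ?I])
    show "\<tau> (Var 6) = Suc k" using fr[of "Var 6"] assms(2) by simp
    show "?I 0 (\<tau>(Var 10 := 0))" using \<tau>4 \<tau>17 by simp
    fix i s assume "i < Suc k" and I: "?I i s" and fr': "\<And>l. l \<notin> writes (For 10 6 ?body) \<Longrightarrow> s l = \<tau> l"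
    then have "s (Arr 3 v) = ?par v" for v using fr by auto
    then have "sem ?body s = s(Arr 4 ((?par ^^ i) x) := 1, Var 17 := (?par ^^ Suc i) x)"
      using I by simp
    moreover have "(?par ^^ i) x < n" using anc \<open>i < Suc k\<close> unfolding ancestors_def by (simp add: image_subset_iff)
    ultimately show "?I (Suc i) ((sem ?body s)(Var 10 := Suc i))"
      using I by (auto simp: lessThan_Suc simp del: sem.simps)
  qed
  then show ?thesis
    using anc unfolding mark_def marked_def ancestors_def lessThan_Suc_atMost
    by (auto simp: \<tau>_def simp del: sem.simps(6))
qed

text \<open>The right end of the \<open>k\<close>-path is unknown, so every node in the last layer
  is tried. Each has its own recorded path, hence the marks are rebuilt every time.\<close>

definition endpoints :: "nat \<Rightarrow> nat list \<Rightarrow> cmd" where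
  "endpoints a w =
     For 16 1
       (Cond (neq (Get 2 (X 16)) (X 6)) Skip
          (mark ;; tail_prog a [] 0 16 ;; tail_prog a w 0 16))"

lemma writes_mark: "writes mark = {Var 10, Var 15, Var 17} \<union> range (Arr 4)"
  by (auto simp: mark_def)

lemma writes_endpoints:
  "writes (endpoints a w) \<subseteq>
     Var ` {0, 10, 13, 15, 16, 17} \<union> Var ` {24..} \<union> range (Arr 4) \<union> range (Arr 5)"
  using writes_tail_prog[of a w 0 16] writes_tail_prog[of a "[]" 0 16]
  by (auto simp: endpoints_def writes_mark)

lemma endpoints_correct:
  assumes inst: "inst n es s t k \<sigma>" and wf: "wf_graph n es" and t: "t < n"
    and k1: "\<sigma> (Var 6) = Suc k"
    and lay: "layered es n a s k col dig (\<lambda>v. \<sigma> (Arr 2 v)) (\<lambda>v. \<sigma> (Arr 3 v))"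
  shows "sem (endpoints a w) \<sigma> (Var 0) =
    (if solves es n a w s t k (\<lambda>v. \<sigma> (Arr 2 v)) (\<lambda>v. \<sigma> (Arr 3 v)) then 1 else \<sigma> (Var 0))"
proof -
  let ?par = "\<lambda>v. \<sigma> (Arr 3 v)"
  let ?then = "mark ;; tail_prog a [] 0 16 ;; tail_prog a w 0 16"
  let ?body = "Cond (neq (Get 2 (X 16)) (X 6)) Skip ?then"
  let ?good = "\<lambda>x. \<sigma> (Arr 2 x) = Suc k \<and> (tail es a t (ancestors ?par k x) [] x \<or> tail es a t (ancestors ?par k x) w x)"
  let ?I = "\<lambda>x \<tau>. \<tau> (Var 0) = (if \<exists>x' < x. ?good x' then 1 else \<sigma> (Var 0))"
  have W: "writes (For 16 1 ?body) \<subseteq>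
     Var ` {0, 10, 13, 15, 16, 17} \<union> Var ` {24..} \<union> range (Arr 4) \<union> range (Arr 5)"
    using writes_endpoints unfolding endpoints_def .
  have "?I n (sem (For 16 1 ?body) \<sigma>)"
  proof (rule For_rule[where I = ?I])
    show "\<sigma> (Var 1) = n" using inst by (simp add: inst_def)
    fix x \<tau> assume x: "x < n" and I: "?I x \<tau>" and xv: "\<tau> (Var 16) = x"
      and fr: "\<And>l. l \<notin> writes (For 16 1 ?body) \<Longrightarrow> \<tau> l = \<sigma> l"
    have frame: "\<tau> l = \<sigma> l" if "l \<notin> Var ` {0, 10, 13, 15, 16, 17} \<union> Var ` {24..} \<union> range (Arr 4) \<union> range (Arr 5)" for l
      by (rule fr) (use W that in blast)
    have fr': "\<tau> (Arr 2 v) = \<sigma> (Arr 2 v)" "\<tau> (Arr 3 v) = \<sigma> (Arr 3 v)" "\<tau> (Var 6) = Suc k" for v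
      using k1 by (auto intro!: trans[OF frame])
    have i\<tau>: "inst n es s t k \<tau>"
      by (rule inst_cong[OF inst frame]) (auto simp: inst_locs_def)
    show "?I (Suc x) ((sem ?body \<tau>)(Var 16 := Suc x))"
    proof (cases "\<sigma> (Arr 2 x) = Suc k")
      case False
      then have "sem ?body \<tau> = \<tau>" using xv fr' by simp
      then show ?thesis using I False by (auto simp: less_Suc_eq)
    next
      case True
      then have anc: "ancestors ?par k x \<subseteq> {..<n}"
        using layered_walk[OF lay x] by force
      let ?\<tau>1 = "sem mark \<tau>"
      have f1: "?\<tau>1 l = \<tau> l" if "l \<notin> {Var 10, Var 15, Var 17} \<union> range (Arr 4)" for l
        by (rule sem_frame) (use that writes_mark in auto)
      have m1: "marked n ?\<tau>1 = ancestors ?par k x"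
        using mark_correct[OF i\<tau> fr'(3) xv] anc unfolding fr' by simp
      have i1: "inst n es s t k ?\<tau>1" by (rule inst_cong[OF i\<tau> f1]) (auto simp: inst_locs_def)
      have x1: "?\<tau>1 (Var 16) = x" using xv f1 by simp
      let ?\<tau>2 = "sem (tail_prog a [] 0 16) ?\<tau>1"
      have r2: "?\<tau>2 (Var 0) = (if tail es a t (ancestors ?par k x) [] x then 1 else \<tau> (Var 0))"
        "?\<tau>2 (Arr 4 v) = ?\<tau>1 (Arr 4 v)" for v
        using tail_prog_correct[OF i1 wf t _ x1 x, of 0 a "[]"] f1[of "Var 0"] m1 by auto
      have f2: "?\<tau>2 l = ?\<tau>1 l"
        if "l \<notin> {Var 0, Var 10, Var 13, Var 15} \<union> Var ` {24..} \<union> range (Arr 4) \<union> range (Arr 5)" for l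
        by (rule sem_frame) (use that writes_tail_prog[of a "[]" 0 16] in auto)
      \<comment> \<open>The first test has restored the marks, so the second one starts from the
        same path.\<close>
      have m2: "marked n ?\<tau>2 = ancestors ?par k x" unfolding m1[symmetric] marked_def r2 ..
      have i2: "inst n es s t k ?\<tau>2" by (rule inst_cong[OF i1 f2]) (auto simp: inst_locs_def)
      have x2: "?\<tau>2 (Var 16) = x" by (subst f2) (auto simp: x1)
      have "sem (tail_prog a w 0 16) ?\<tau>2 (Var 0) = (if tail es a t (ancestors ?par k x) w x then 1 else ?\<tau>2 (Var 0))"
        using tail_prog_correct[OF i2 wf t _ x2 x, of 0 a w] m2 by auto
      moreover have "sem ?body \<tau> = sem (tail_prog a w 0 16) ?\<tau>2" using True xv fr' by simp
      ultimately have "sem ?body \<tau> (Var 0) = (if ?good x then 1 else \<tau> (Var 0))"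
        using True r2(1) by (simp del: tail.simps sem.simps)
      then show ?thesis using I
        by (auto simp: less_Suc_eq simp del: tail.simps sem.simps)
    qed
  qed simp
  then show ?thesis unfolding solves_def endpoints_def .
qed

section \<open>Trying all guesses\<close>

definition search :: "nat \<Rightarrow> nat list \<Rightarrow> cmd" where
  "search a w = For 9 8 (decode ;; colour ;; layer a ;; endpoints a w)"

lemma writes_layers:
  "writes decode = {Var 10, Var 11, Var 12, Var 13} \<union> range (Arr 1)"
  "writes colour = {Var 14, Var 15} \<union> range (Arr 6)"
  "writes (layer a) = {Var 10, Var 13, Var 15} \<union> range (Arr 2) \<union> range (Arr 3)"
  by (auto simp: decode_def colour_def layer_def)

lemma writes_search:
  "writes (search a w) \<subseteq> Var ` {0, 9, 10, 11, 12, 13, 14, 15, 16, 17} \<union> Var ` {24..} \<union>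
     (\<Union>j \<in> {1, 2, 3, 4, 5, 6}. range (Arr j))"
  using writes_endpoints[of a w] by (auto simp: search_def writes_layers)

text \<open>Decoding fixes the digit array only up to position \<open>k\<close>; this transfers the
  search result to the true digit function, which agrees with the array there.\<close>

lemma layered_digits_cong:
  assumes "\<And>i. i \<le> k \<Longrightarrow> dig i = dig' i"
  shows "layered es n a s k col dig lay par \<longleftrightarrow> layered es n a s k col dig' lay par"
  unfolding layered_def by (simp add: assms Suc_leI cong: conj_cong imp_cong)

lemma search_correct:
  assumes inst: "inst n es s t k \<sigma>" and wf: "wf_graph n es" and st: "s < n" "t < n"
    and \<sigma>: "\<sigma> (Var 0) = 0" "\<sigma> (Var 6) = Suc k" "\<sigma> (Var 7) = M" "\<sigma> (Var 8) = M ^ Suc k" and "M > 0"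
    and complete: "SimplePath (lang_akwa a w k) es s t \<Longrightarrow>
       \<exists>z < M ^ Suc k. separating es n a w s t k (digit M z)"
  shows "sem (search a w) \<sigma> (Var 0) = (if SimplePath (lang_akwa a w k) es s t then 1 else 0)"
proof -
  let ?SP = "SimplePath (lang_akwa a w k) es s t"
  let ?body = "decode ;; colour ;; layer a ;; endpoints a w"
  let ?I = "\<lambda>z \<tau>. (\<tau> (Var 0) = 0 \<or> \<tau> (Var 0) = 1 \<and> ?SP) \<and>
     ((\<exists>z' < z. separating es n a w s t k (digit M z')) \<longrightarrow> \<tau> (Var 0) = 1)"
  have W: "writes (For 9 8 ?body) \<subseteq> Var ` {0, 9, 10, 11, 12, 13, 14, 15, 16, 17} \<union> Var ` {24..} \<union>
     (\<Union>j \<in> {1, 2, 3, 4, 5, 6}. range (Arr j))" using writes_search unfolding search_def .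
  have "?I (M ^ Suc k) (sem (For 9 8 ?body) \<sigma>)"
  proof (rule For_rule[where I = ?I])
    fix z \<tau> assume z: "z < M ^ Suc k" and I: "?I z \<tau>" and zv: "\<tau> (Var 9) = z"
      and fr: "\<And>l. l \<notin> writes (For 9 8 ?body) \<Longrightarrow> \<tau> l = \<sigma> l"
    have frame: "\<tau> l = \<sigma> l" if "l \<notin> Var ` {0, 9, 10, 11, 12, 13, 14, 15, 16, 17} \<union> Var ` {24..} \<union>
     (\<Union>j \<in> {1, 2, 3, 4, 5, 6}. range (Arr j))" for l
      by (rule fr) (use W that in blast)
    have v\<tau>: "\<tau> (Var 6) = Suc k" "\<tau> (Var 7) = M" "\<tau> (Var 8) = M ^ Suc k"
      using \<sigma> by (auto intro!: trans[OF frame])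
    have i\<tau>: "inst n es s t k \<tau>"
      by (rule inst_cong[OF inst frame]) (auto simp: inst_locs_def)
    let ?\<tau>1 = "sem decode \<tau>"
    let ?\<tau>2 = "sem colour ?\<tau>1"
    let ?\<tau>3 = "sem (layer a) ?\<tau>2"
    have f1: "?\<tau>1 l = \<tau> l" if "l \<notin> writes decode" for l using that by (rule sem_frame)
    have f2: "?\<tau>2 l = ?\<tau>1 l" if "l \<notin> writes colour" for l using that by (rule sem_frame)
    have f3: "?\<tau>3 l = ?\<tau>2 l" if "l \<notin> writes (layer a)" for l using that by (rule sem_frame)
    have i1: "inst n es s t k ?\<tau>1"
      by (rule inst_cong[OF i\<tau> f1]) (auto simp: inst_locs_def writes_layers)
    have i2: "inst n es s t k ?\<tau>2"
      by (rule inst_cong[OF i1 f2]) (auto simp: inst_locs_def writes_layers)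
    have i3: "inst n es s t k ?\<tau>3"
      by (rule inst_cong[OF i2 f3]) (auto simp: inst_locs_def writes_layers)
    have d1: "?\<tau>1 (Arr 1 i) = digit M z i" if "i \<le> k" for i
      using that by (intro decode_correct[OF v\<tau> zv \<open>M > 0\<close> z]) simp
    then have d2: "?\<tau>2 (Arr 1 i) = digit M z i" if "i \<le> k" for i
      using that f2 by (simp add: writes_layers)
    define col where "col v = ?\<tau>2 (Arr 6 v)" for v
    define lay where "lay v = ?\<tau>3 (Arr 2 v)" for v
    define par where "par v = ?\<tau>3 (Arr 3 v)" for v
    \<comment> \<open>A guess whose digit 0 is 0 leaves the colours unspecified. Such a guess is not
      separating, and soundness holds for every colouring.\<close>
    have col: "col v = v mod digit M z 0" if "digit M z 0 > 0" "v < n" for v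
      unfolding col_def using i1 d1[of 0] that by (intro colour_correct) (auto simp: inst_def)
    have lay: "layered es n a s k col (digit M z) lay par"
      using layer_correct[OF i2 wf st(1), of a]
        layered_digits_cong[of k "\<lambda>i. ?\<tau>2 (Arr 1 i)" "digit M z" es n a s col lay par] d2
      unfolding col_def lay_def par_def by simp
    have v3: "?\<tau>3 (Var 6) = Suc k" "?\<tau>3 (Var 0) = \<tau> (Var 0)"
      using v\<tau> f1 f2 f3 by (simp_all add: writes_layers)
    have "sem (endpoints a w) ?\<tau>3 (Var 0) = (if solves es n a w s t k lay par then 1 else \<tau> (Var 0))"
      using endpoints_correct[OF i3 wf st(2) v3(1), of a col "digit M z" w] lay
      unfolding lay_def par_def v3 by simp
    then have r: "sem ?body \<tau> (Var 0) = (if solves es n a w s t k lay par then 1 else \<tau> (Var 0))"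
      by simp
    have "solves es n a w s t k lay par \<longrightarrow> ?SP" using solves_sound[OF lay] by blast
    moreover have "solves es n a w s t k lay par" if "separating es n a w s t k (digit M z)"
      using that col lay unfolding separating_def by blast
    ultimately show "?I (Suc z) ((sem ?body \<tau>)(Var 9 := Suc z))"
      using I r by (auto simp: less_Suc_eq simp del: sem.simps)
  qed (use \<sigma> in simp_all)
  then show ?thesis using complete unfolding search_def by auto
qed

text \<open>Register 4 initially holds the input length, the index at which the header was saved, so
  it is overwritten by \<open>k\<close> only after the other values have been fetched.\<close>

definition read_input :: "nat \<Rightarrow> cmd" where
  "read_input c =
     Asg 1 (Get 1 (X 4)) ;; Asg 2 (Get 2 (X 4)) ;; Asg 3 (Get 3 (X 4)) ;; Asg 5 (Get 5 (X 4)) ;;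
     Asg 4 (Get 4 (X 4)) ;; Asg 6 (Plus (X 4) (N 1)) ;; Asg 18 (Plus (X 4) (Plus (X 4) (N c))) ;;
     Asg 19 (N 0) ;; Asg 20 (N 1) ;; Asg 7 (N 3) ;; Asg 8 (N 1) ;; Asg 0 (N 0)"

definition square_loop :: cmd where
  "square_loop = For 10 18 (Asg 19 (Plus (X 19) (X 18)))"

definition log_loop :: cmd where
  "log_loop = For 10 1 (Cond (Minus (X 1) (X 20))
     (Asg 20 (Plus (X 20) (X 20)) ;; Asg 7 (Plus (X 7) (X 19))) Skip)"

definition power_loop :: cmd where
  "power_loop = For 10 6 (Asg 21 (N 0) ;; For 13 7 (Asg 21 (Plus (X 21) (X 8))) ;; Asg 8 (X 21))"

lemma square_loop_correct:
  assumes "\<sigma> (Var 18) = K" "\<sigma> (Var 19) = 0"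
  shows "sem square_loop \<sigma> (Var 19) = K ^ 2"
proof -
  have "sem square_loop \<sigma> (Var 19) = K * K" unfolding square_loop_def
  proof (rule For_rule[where I = "\<lambda>i s. s (Var 19) = i * K"])
    fix i s assume "s (Var 19) = i * K"
      and "\<And>l. l \<notin> writes (For 10 18 (Asg 19 (Plus (X 19) (X 18)))) \<Longrightarrow> s l = \<sigma> l"
    then show "((sem (Asg 19 (Plus (X 19) (X 18))) s)(Var 10 := Suc i)) (Var 19) = Suc i * K"
      using assms by simp
  qed (use assms in auto)
  then show ?thesis by (simp add: power2_eq_square)
qed

text \<open>Adding \<open>Q\<close> at each doubling computes \<open>l * Q\<close> without
  multiplication; \<open>n\<close> passes suffice because \<open>n \<le> 2 ^ n\<close>. The lower
  bound on \<open>2 ^ l\<close> serves the choice of the modulus, the upper bound the running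
  time.\<close>

lemma log_loop_correct:
  assumes "\<sigma> (Var 1) = n" "\<sigma> (Var 19) = Q" "\<sigma> (Var 20) = 1" "\<sigma> (Var 7) = 3" "n \<ge> 1"
  shows "\<exists>l. n \<le> 2 ^ l \<and> 2 ^ l \<le> 2 * n \<and> sem log_loop \<sigma> (Var 7) = 3 + l * Q"
proof -
  let ?body = "Cond (Minus (X 1) (X 20)) (Asg 20 (Plus (X 20) (X 20)) ;; Asg 7 (Plus (X 7) (X 19))) Skip"
  let ?I = "\<lambda>i s. \<exists>l. s (Var 20) = 2 ^ l \<and> 2 ^ l \<le> 2 * n \<and> s (Var 7) = 3 + l * Q \<and> (n \<le> 2 ^ l \<or> l = i)"
  have "?I n (sem log_loop \<sigma>)" unfolding log_loop_def
  proof (rule For_rule[where I = ?I])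
    show "?I 0 (\<sigma>(Var 10 := 0))" using assms by (intro exI[of _ 0]) auto
    fix i s assume I: "?I i s" and fr: "\<And>l. l \<notin> writes (For 10 1 ?body) \<Longrightarrow> s l = \<sigma> l"
    have s: "s (Var (Suc 0)) = n" "s (Var 19) = Q" using fr[of "Var 1"] fr[of "Var 19"] assms by auto
    obtain l where l: "s (Var 20) = 2 ^ l" "2 ^ l \<le> 2 * n" "s (Var 7) = 3 + l * Q" "n \<le> 2 ^ l \<or> l = i"
      using I by blast
    show "?I (Suc i) ((sem ?body s)(Var 10 := Suc i))"
    proof (cases "n \<le> 2 ^ l")
      case True
      then show ?thesis using l s by (intro exI[of _ l]) simp
    next
      case False
      then show ?thesis using l s by (intro exI[of _ "Suc l"]) auto
    qed
  qed (use assms in auto)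
  then obtain l where "2 ^ l \<le> 2 * n" "sem log_loop \<sigma> (Var 7) = 3 + l * Q" "n \<le> 2 ^ l \<or> l = n" by blast
  moreover have "n \<le> 2 ^ n" using less_exp[of n] by simp
  ultimately show ?thesis by blast
qed

text \<open>Multiplication is repeated addition, which makes the base \<open>M\<close> itself a loop
  limit.\<close>

lemma power_loop_correct:
  assumes "\<sigma> (Var 6) = k1" "\<sigma> (Var 7) = M" "\<sigma> (Var 8) = 1"
  shows "sem power_loop \<sigma> (Var 8) = M ^ k1"
proof -
  let ?inner = "For 13 7 (Asg 21 (Plus (X 21) (X 8)))"
  let ?body = "Asg 21 (N 0) ;; ?inner ;; Asg 8 (X 21)"
  show ?thesis unfolding power_loop_def
  proof (rule For_rule[where I = "\<lambda>i s. s (Var 8) = M ^ i"])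
    fix i s assume I: "s (Var 8) = M ^ i" and fr: "\<And>l. l \<notin> writes (For 10 6 ?body) \<Longrightarrow> s l = \<sigma> l"
    let ?s = "s(Var 21 := 0)"
    have "sem ?inner ?s (Var 21) = M * M ^ i"
    proof (rule For_rule[where I = "\<lambda>j s. s (Var 21) = j * M ^ i"])
      show "?s (Var 7) = M" using fr[of "Var 7"] assms by simp
      fix j \<tau> assume "\<tau> (Var 21) = j * M ^ i"
        and "\<And>l. l \<notin> writes ?inner \<Longrightarrow> \<tau> l = ?s l"
      then show "((sem (Asg 21 (Plus (X 21) (X 8))) \<tau>)(Var 13 := Suc j)) (Var 21) = Suc j * M ^ i"
        using I by simp
    qed simp
    then show "((sem ?body s)(Var 10 := Suc i)) (Var 8) = M ^ Suc i" by (simp del: sem.simps(6))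
  qed (use assms in auto)
qed

section \<open>The complete program and its loop limits\<close>

definition program :: "nat \<Rightarrow> nat list \<Rightarrow> cmd" where
  "program a w = read_input (length w) ;; square_loop ;; log_loop ;; power_loop ;; search a w"

lemma writes_setup:
  "writes square_loop = {Var 10, Var 19}" "writes log_loop = {Var 7, Var 10, Var 20}"
  "writes power_loop = {Var 8, Var 10, Var 13, Var 21}"
  by (auto simp: square_loop_def log_loop_def power_loop_def)

lemma limits_setup:
  "limits square_loop = {Var 18}" "limits log_loop = {Var 1}" "limits power_loop = {Var 6, Var 7}"
  by (auto simp: square_loop_def log_loop_def power_loop_def)

lemma limits_tail_prog: "limits (tail_prog a w d x) \<subseteq> {Var 1, Var 5}"
  by (induction w arbitrary: d x) (auto simp: reach_prog_def clear_def)

lemma limits_search: "limits (search a w) \<subseteq> {Var 1, Var 4, Var 5, Var 6, Var 8}"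
  using limits_tail_prog[of a w 0 16] limits_tail_prog[of a "[]" 0 16]
  by (auto simp: search_def decode_def colour_def layer_def endpoints_def mark_def clear_def)

lemma wfC_tail_prog:
  "x < 24 + 2 * d \<Longrightarrow> 24 + 2 * d + 2 * length w \<le> nv \<Longrightarrow> wfC nv (tail_prog a w d x)"
proof (induction w arbitrary: d x)
  case Nil
  then show ?case by (auto simp: reach_prog_def clear_def neq_def)
next
  case (Cons l w)
  have "Var (24 + 2 * d) \<notin> writes (tail_prog a w (Suc d) (25 + 2 * d))"
    "Var 5 \<notin> writes (tail_prog a w (Suc d) (25 + 2 * d))"
    using writes_tail_prog[of a w "Suc d" "25 + 2 * d"] by auto
  with Cons show ?case by (auto simp: neq_def)
qed

lemma wfC_program: "24 + 2 * length w \<le> nv \<Longrightarrow> wfC nv (program a w)"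
proof -
  assume nv: "24 + 2 * length w \<le> nv"
  have t: "wfC nv (tail_prog a w 0 16)" "wfC nv (tail_prog a [] 0 16)"
    using wfC_tail_prog[of 16 0 w nv a] wfC_tail_prog[of 16 0 "[]" nv a] nv by auto
  have wt: "Var x \<notin> writes (tail_prog a v 0 16)" if "x < 24" "x \<notin> {0, 10, 13, 15}" for x v
    using writes_tail_prog[of a v 0 16] that by auto
  have we: "Var x \<notin> writes (endpoints a w)" if "x < 24" "x \<notin> {0, 10, 13, 15, 16, 17}" for x
    using writes_endpoints[of a w] that by auto
  have e: "wfC nv (endpoints a w)" unfolding endpoints_def
    using t nv wt by (auto simp: mark_def clear_def neq_def simp del: tail_prog.simps)
  have "wfC nv (search a w)" unfolding search_def using e nv we
    by (auto simp: writes_layers) (auto simp: decode_def colour_def layer_def clear_def neq_def)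
  then show ?thesis unfolding program_def
    using nv by (auto simp: read_input_def square_loop_def log_loop_def power_loop_def)
qed

lemma program_correct:
  assumes \<sigma>: "\<sigma> (Var 4) = L" "\<sigma> (Arr 1 L) = n" "\<sigma> (Arr 2 L) = s" "\<sigma> (Arr 3 L) = t" "\<sigma> (Arr 4 L) = k"
    "\<sigma> (Arr 5 L) = length es"
    and edges: "\<And>j. j < length es \<Longrightarrow>
      es ! j = (\<sigma> (Arr 0 (6 + 3 * j)), \<sigma> (Arr 0 (7 + 3 * j)), \<sigma> (Arr 0 (8 + 3 * j)))"
    and wf: "wf_graph n es" "s < n" "t < n"
  shows "\<exists>l. 2 ^ l \<le> 2 * n \<and>
    (let K = 2 * k + length w; M = 3 + l * K ^ 2
     in bounded_loops (n + length es + Suc k + K + M ^ Suc k) (program a w) \<sigma>) \<and>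
    sem (program a w) \<sigma> (Var 0) = (if SimplePath (lang_akwa a w k) es s t then 1 else 0)"
proof -
  define K where "K = 2 * k + length w"
  let ?\<sigma>1 = "sem (read_input (length w)) \<sigma>"
  let ?\<sigma>2 = "sem square_loop ?\<sigma>1"
  let ?\<sigma>3 = "sem log_loop ?\<sigma>2"
  let ?\<sigma>4 = "sem power_loop ?\<sigma>3"
  have f2: "?\<sigma>2 l = ?\<sigma>1 l" if "l \<notin> {Var 10, Var 19}" for l
    by (rule sem_frame) (use that writes_setup in blast)
  have f3: "?\<sigma>3 l = ?\<sigma>2 l" if "l \<notin> {Var 7, Var 10, Var 20}" for l
    by (rule sem_frame) (use that writes_setup in blast)
  have f4: "?\<sigma>4 l = ?\<sigma>3 l" if "l \<notin> {Var 8, Var 10, Var 13, Var 21}" for l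
    by (rule sem_frame) (use that writes_setup in blast)
  have s1: "?\<sigma>1 (Var 0) = 0" "?\<sigma>1 (Var 1) = n" "?\<sigma>1 (Var 2) = s" "?\<sigma>1 (Var 3) = t" "?\<sigma>1 (Var 4) = k"
    "?\<sigma>1 (Var 5) = length es" "?\<sigma>1 (Var 6) = Suc k" "?\<sigma>1 (Var 7) = 3" "?\<sigma>1 (Var 8) = 1" "?\<sigma>1 (Var 18) = K"
    "?\<sigma>1 (Var 19) = 0" "?\<sigma>1 (Var 20) = 1" "?\<sigma>1 (Arr 0 i) = \<sigma> (Arr 0 i)" for i
    using \<sigma> by (simp_all add: read_input_def K_def)
  have s2: "?\<sigma>2 (Var 19) = K ^ 2" using square_loop_correct[of ?\<sigma>1 K] s1 by simp
  have n: "n \<ge> 1" using wf(2) by simp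
  obtain l where l: "n \<le> 2 ^ l" "2 ^ l \<le> 2 * n" "?\<sigma>3 (Var 7) = 3 + l * K ^ 2"
    using log_loop_correct[of ?\<sigma>2 n "K ^ 2"] s1 s2 f2 n by auto
  define M where "M = 3 + l * K ^ 2"
  have s4: "?\<sigma>4 (Var 8) = M ^ Suc k"
    using power_loop_correct[of ?\<sigma>3 "Suc k" M] l(3) f3 f2 s1 unfolding M_def by simp
  have inst: "inst n es s t k ?\<sigma>4"
    using s1 edges f2 f3 f4 unfolding inst_def by simp
  have complete: "\<exists>z < M ^ Suc k. separating es n a w s t k (digit M z)" if "SimplePath (lang_akwa a w k) es s t"
    using separating_exists[OF wf(1,2) l(1) _ that, of M] unfolding M_def K_def by blast
  have "sem (search a w) ?\<sigma>4 (Var 0) = (if SimplePath (lang_akwa a w k) es s t then 1 else 0)"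
    by (rule search_correct[OF inst wf, where M = M])
      (use s1 f2 f3 f4 s4 l(3) complete in \<open>simp_all add: M_def\<close>)
  then have result: "sem (program a w) \<sigma> (Var 0) = (if SimplePath (lang_akwa a w k) es s t then 1 else 0)"
    unfolding program_def by simp
  let ?B = "n + length es + Suc k + K + M ^ Suc k"
  \<comment> \<open>The base is a loop limit of \<open>power_loop\<close>; its power, a summand of
    \<open>?B\<close>, covers it.\<close>
  have "M \<le> M ^ Suc k" using self_le_power[of M "Suc k"] unfolding M_def by simp
  moreover have "?\<sigma>3 (Var 7) = M" using l(3) unfolding M_def .
  ultimately have v: "?\<sigma>1 (Var 18) \<le> ?B" "?\<sigma>2 (Var 1) \<le> ?B" "?\<sigma>3 (Var 6) \<le> ?B" "?\<sigma>3 (Var 7) \<le> ?B"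
    "?\<sigma>4 (Var 1) \<le> ?B" "?\<sigma>4 (Var 4) \<le> ?B" "?\<sigma>4 (Var 5) \<le> ?B" "?\<sigma>4 (Var 6) \<le> ?B" "?\<sigma>4 (Var 8) \<le> ?B"
    using s1 f2 f3 f4 s4 by (simp_all del: power_Suc)
  \<comment> \<open>Registers 7 and 8 are computed by one stage and used as limits by a later one,
    so the read-only criterion is applied to each stage separately.\<close>
  have "bounded_loops ?B square_loop ?\<sigma>1"
    by (rule bounded_loopsI) (use v(1) in \<open>auto simp: writes_setup limits_setup\<close>)
  moreover have "bounded_loops ?B log_loop ?\<sigma>2"
    by (rule bounded_loopsI) (use v(2) in \<open>auto simp: writes_setup limits_setup\<close>)
  moreover have "bounded_loops ?B power_loop ?\<sigma>3"
    by (rule bounded_loopsI) (use v(3,4) in \<open>auto simp: writes_setup limits_setup\<close>)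
  moreover have "bounded_loops ?B (search a w) ?\<sigma>4"
  proof (rule bounded_loopsI)
    show "limits (search a w) \<inter> writes (search a w) = {}"
    proof (rule Int_emptyI)
      fix l assume l: "l \<in> limits (search a w)" "l \<in> writes (search a w)"
      from l(1) have "l \<in> {Var 1, Var 4, Var 5, Var 6, Var 8}" using limits_search by (rule rev_subsetD)
      moreover have "l \<in> Var ` {0, 9, 10, 11, 12, 13, 14, 15, 16, 17} \<union> Var ` {24..} \<union>
          (\<Union>j \<in> {1, 2, 3, 4, 5, 6}. range (Arr j))"
        using l(2) writes_search by (rule rev_subsetD)
      ultimately show False by auto
    qed
    show "?\<sigma>4 l \<le> ?B" if "l \<in> limits (search a w)" for l
    proof -
      from that have "l \<in> {Var 1, Var 4, Var 5, Var 6, Var 8}" using limits_search by (rule rev_subsetD)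
      then show ?thesis using v(5-9) by (elim insertE emptyE) simp_all
    qed
  qed
  moreover have "bounded_loops ?B (read_input (length w)) \<sigma>" by (simp add: read_input_def)
  ultimately have "bounded_loops ?B (program a w) \<sigma>" unfolding program_def by simp
  with result l(2) show ?thesis unfolding M_def K_def Let_def by blast
qed

subsection \<open>The machine program\<close>

text \<open>The input occupies the addresses of the variables. Registers 1 to 5 are saved as
  \<open>Arr j L\<close> for \<open>j = 1, \<dots>, 5\<close>, where \<open>L\<close> is the length of the input; then the input is copied to array 0
  from the top down, so that no cell is overwritten before it has been read. Register 0 can be used
  for addressing at the outset because \<open>L\<close> is recovered from the number of edges.\<close>

definition stash_code :: "nat \<Rightarrow> instr list" where
  "stash_code nv =
     [Add 0 0 0, Add 0 0 0, Add 0 0 0, Store 0 1,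
      Const 1 (nv + 18), Add 1 1 0, Store 1 2, Const 2 1, Add 1 1 2, Store 1 3, Add 1 1 2, Store 1 4,
      Add 1 1 2, Store 1 5, Load 3 0, Const 4 4, Sub 1 1 4, Store 1 3,
      Add 0 5 5, Add 0 0 5, Const 4 5, Add 0 0 4, Const 4 0, Add 4 4 0, Const 5 0]"

definition move_code :: "nat \<Rightarrow> instr list" where
  "move_code nv =
     [Add 1 0 0, Add 1 1 1, Add 1 1 1, Const 3 (nv + 16), Add 1 1 3, Load 3 0, Store 1 3, Sub 0 0 2]"

definition prelude :: "nat \<Rightarrow> instr list" where
  "prelude nv = stash_code nv @ [Jz 0 35] @ move_code nv @ [Jz 5 25]"

lemma length_prelude [simp]: "length (prelude nv) = 35"
  by (simp add: prelude_def stash_code_def move_code_def)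

lemma stash_effect:
  assumes "m 0 = L" "m 5 = e" "L = 5 + 3 * e" "nv \<ge> 24"
  defines "m' \<equiv> fold effect (stash_code nv) m"
  shows "m' 0 = L" "m' 2 = 1" "m' 4 = L" "m' 5 = 0"
    "m' (nv + 16 + 8 * L + 1) = m 1" "m' (nv + 16 + 8 * L + 2) = m 2" "m' (nv + 16 + 8 * L + 3) = m 3"
    "m' (nv + 16 + 8 * L + 4) = m 4" "m' (nv + 16 + 8 * L + 5) = e"
    "\<And>p. 6 \<le> p \<Longrightarrow> p \<le> L \<Longrightarrow> m' p = m p"
  using assms(1-4) unfolding m'_def stash_code_def by simp_all

text \<open>Each cell takes 10 steps: exit test, eight instructions, jump back. Cells below 6 serve
  as working registers meanwhile, so copying is claimed from 6 on; the last conjunct protects the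
  saved header.\<close>

lemma move_loop:
  assumes P: "code_at P 25 ([Jz 0 35] @ move_code nv @ [Jz 5 25])"
    and "m 0 = p" "m 2 = 1" "m 5 = 0" "nv \<ge> 24"
  shows "\<exists>m'. reach P (10 * p + 1) (25, m) (35, m') \<and>
    (\<forall>q. 6 \<le> q \<longrightarrow> q \<le> p \<longrightarrow> m' (nv + 16 + 8 * q) = m q) \<and>
    (\<forall>r. r \<notin> {0, 1, 3} \<longrightarrow> (\<forall>q. 1 \<le> q \<longrightarrow> q \<le> p \<longrightarrow> r \<noteq> nv + 16 + 8 * q) \<longrightarrow> m' r = m r)"
  using assms(2-4)
proof (induction p arbitrary: m)
  case 0
  have "code_at P 25 [Jz 0 35]" using P by (simp only: code_at_append)
  from reach_Jz[OF this, of m] 0 have "reach P 1 (25, m) (35, m)" by simp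
  then show ?case by auto
next
  case (Suc p)
  have C: "code_at P 25 [Jz 0 35]" "code_at P 26 (move_code nv)" "code_at P 34 [Jz 5 25]"
    using P unfolding code_at_append by (auto simp: move_code_def)
  let ?m = "fold effect (move_code nv) m"
  have m: "?m 0 = p" "?m 2 = 1" "?m 5 = 0" "6 \<le> Suc p \<Longrightarrow> ?m (nv + 16 + 8 * Suc p) = m (Suc p)"
    "\<And>r. r \<notin> {0, 1, 3, nv + 16 + 8 * Suc p} \<Longrightarrow> ?m r = m r"
    using Suc.prems assms(5) by (simp_all add: move_code_def)
  have r1: "reach P 1 (25, m) (26, m)" using reach_Jz[OF C(1), of m] Suc.prems by simp
  have r2: "reach P 8 (26, m) (34, ?m)"
    by (rule reach_straightI[OF C(2) _ refl]) (auto simp: move_code_def)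
  have r3: "reach P 1 (34, ?m) (25, ?m)" using reach_Jz[OF C(3), of ?m] m(3) by simp
  have r: "reach P 10 (25, m) (25, ?m)"
    by (rule reach_mono[OF reach_trans[OF reach_trans[OF r1 r2] r3]]) simp
  obtain m' where m': "reach P (10 * p + 1) (25, ?m) (35, m')"
    "\<And>q. 6 \<le> q \<Longrightarrow> q \<le> p \<Longrightarrow> m' (nv + 16 + 8 * q) = ?m q"
    "\<And>r. r \<notin> {0, 1, 3} \<Longrightarrow> (\<And>q. 1 \<le> q \<Longrightarrow> q \<le> p \<Longrightarrow> r \<noteq> nv + 16 + 8 * q) \<Longrightarrow> m' r = ?m r"
    using Suc.IH[OF m(1-3)] by blast
  have "reach P (10 * Suc p + 1) (25, m) (35, m')"
    by (rule reach_mono[OF reach_trans[OF r m'(1)]]) simp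
  moreover have "m' (nv + 16 + 8 * q) = m q" if "6 \<le> q" "q \<le> Suc p" for q
  proof (cases "q = Suc p")
    case True
    have "m' (nv + 16 + 8 * q) = ?m (nv + 16 + 8 * q)" by (rule m'(3)) (use True in auto)
    then show ?thesis using m(4) True that by simp
  next
    case False
    then have "m' (nv + 16 + 8 * q) = ?m q" using m'(2) that by simp
    then show ?thesis using m(5)[of q] that False by simp
  qed
  moreover have "m' r = m r" if r: "r \<notin> {0, 1, 3}" "\<forall>q. 1 \<le> q \<longrightarrow> q \<le> Suc p \<longrightarrow> r \<noteq> nv + 16 + 8 * q" for r
  proof -
    have "m' r = ?m r" using r by (intro m'(3)) auto
    also have "\<dots> = m r" using r by (intro m(5)) auto
    finally show ?thesis .
  qed
  ultimately show ?case by blast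
qed

section \<open>Loading an encoded instance\<close>

lemma encode_nth:
  assumes "j < length es" "c < 3"
  shows "encode n es s t k ! (5 + (3 * j + c)) =
    (case es ! j of (u, l, v) \<Rightarrow> if c = 0 then u else if c = 1 then l else v)"
proof -
  have "concat (map (\<lambda>(u, l, v). [u, l, v]) es) ! (3 * j + c) =
    (case es ! j of (u, l, v) \<Rightarrow> if c = 0 then u else if c = 1 then l else v)"
    using assms(1)
  proof (induction es arbitrary: j)
    case (Cons e es)
    obtain u l v where e: "e = (u, l, v)" by (metis prod_cases3)
    show ?case
    proof (cases j)
      case 0
      have "c = 0 \<or> c = 1 \<or> c = 2" using assms(2) by auto
      then show ?thesis using 0 e by auto
    next
      case (Suc j')
      then show ?thesis using Cons e by (simp add: nth_Cons')
    qed
  qed simp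
  then show ?thesis unfolding encode_def by (simp add: nth_append)
qed

lemma length_encode: "length (encode n es s t k) = 5 + 3 * length es"
proof -
  have "length (concat (map (\<lambda>(u, l, v). [u, l, v]) es)) = 3 * length es"
    by (induction es) auto
  then show ?thesis by (simp add: encode_def)
qed

lemma prelude_correct:
  fixes n es s t k
  defines "L \<equiv> 5 + 3 * length es"
  assumes P: "code_at P 0 (prelude nv)" and nv: "nv \<ge> 24"
  obtains m \<sigma> where "reach P (10 * L + 26) (init (encode n es s t k)) (35, m)" "represents nv \<sigma> m"
    "\<sigma> (Var 4) = L" "\<sigma> (Arr 1 L) = n" "\<sigma> (Arr 2 L) = s" "\<sigma> (Arr 3 L) = t" "\<sigma> (Arr 4 L) = k"
    "\<sigma> (Arr 5 L) = length es"
    "\<And>j. j < length es \<Longrightarrow>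
      es ! j = (\<sigma> (Arr 0 (6 + 3 * j)), \<sigma> (Arr 0 (7 + 3 * j)), \<sigma> (Arr 0 (8 + 3 * j)))"
proof -
  define m0 where "m0 = snd (init (encode n es s t k))"
  have init: "init (encode n es s t k) = (0, m0)" by (simp add: m0_def init_def)
  have m0_eq: "m0 p = encode n es s t k ! (p - 1)" if "1 \<le> p" "p \<le> L" for p
    using that unfolding m0_def init_def length_encode L_def by simp
  have m0: "m0 0 = L" by (simp add: m0_def init_def length_encode L_def)
  have m0': "m0 1 = n" "m0 2 = s" "m0 3 = t" "m0 4 = k" "m0 5 = length es"
    using m0_eq[of 1] m0_eq[of 2] m0_eq[of 3] m0_eq[of 4] m0_eq[of 5]
    by (simp_all add: L_def encode_def)
  define m1 where "m1 = fold effect (stash_code nv) m0"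
  note m1 = stash_effect[OF m0 m0'(5) L_def[THEN meta_eq_to_obj_eq] nv, folded m1_def]
  have len: "length (stash_code nv) = 25" by (simp add: stash_code_def)
  have C: "code_at P 0 (stash_code nv)" "code_at P 25 ([Jz 0 35] @ move_code nv @ [Jz 5 25])"
    using P unfolding prelude_def code_at_append[of P 0 "stash_code nv"] len by simp_all
  have r1: "reach P 25 (0, m0) (25, m1)"
    by (rule reach_straightI[OF C(1)]) (auto simp: m1_def stash_code_def)
  obtain m2 where m2: "reach P (10 * L + 1) (25, m1) (35, m2)"
    "\<And>q. 6 \<le> q \<Longrightarrow> q \<le> L \<Longrightarrow> m2 (nv + 16 + 8 * q) = m1 q"
    "\<And>r. r \<notin> {0, 1, 3} \<Longrightarrow> (\<And>q. 1 \<le> q \<Longrightarrow> q \<le> L \<Longrightarrow> r \<noteq> nv + 16 + 8 * q) \<Longrightarrow> m2 r = m1 r"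
    using move_loop[OF C(2) m1(1,2,4) nv] by blast
  define \<sigma> where "\<sigma> l = m2 (address nv l)" for l
  have stash: "\<sigma> (Arr j L) = m1 (nv + 16 + 8 * L + j)" if "1 \<le> j" "j \<le> 5" for j
    unfolding \<sigma>_def address_simps
  proof (rule m2(3))
    fix q :: nat
    \<comment> \<open>Copied cells have offset 0 modulo 8 and the saved header has offsets 1 to 5,
      so the copying loop misses it.\<close>
    have "8 * L + j \<noteq> 8 * q" using that by presburger
    then show "nv + 16 + 8 * L + j \<noteq> nv + 16 + 8 * q" by simp
  qed (use nv in auto)
  show ?thesis
  proof (rule that)
    show "reach P (10 * L + 26) (init (encode n es s t k)) (35, m2)"
      unfolding init by (rule reach_mono[OF reach_trans[OF r1 m2(1)]]) simp
    show "represents nv \<sigma> m2" by (simp add: represents_def \<sigma>_def)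
    show "\<sigma> (Var 4) = L" unfolding \<sigma>_def address_simps by (subst m2(3)) (use m1(3) nv in auto)
    show "\<sigma> (Arr 1 L) = n" "\<sigma> (Arr 2 L) = s" "\<sigma> (Arr 3 L) = t" "\<sigma> (Arr 4 L) = k" "\<sigma> (Arr 5 L) = length es"
      using m1(5-9) m0' by (simp_all add: stash del: One_nat_def)
    fix j assume j: "j < length es"
    have "\<sigma> (Arr 0 (6 + 3 * j + c)) = encode n es s t k ! (5 + (3 * j + c))" if "c < 3" for c
    proof -
      have p: "6 \<le> 6 + 3 * j + c" "6 + 3 * j + c \<le> L" using j that unfolding L_def by auto
      have "\<sigma> (Arr 0 (6 + 3 * j + c)) = m0 (6 + 3 * j + c)"
        using m2(2)[OF p] m1(10)[OF p] by (simp add: \<sigma>_def)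
      also have "\<dots> = encode n es s t k ! (5 + (3 * j + c))" using m0_eq[OF _ p(2)] by simp
      finally show ?thesis .
    qed
    from this[of 0] this[of 1] this[of 2]
    show "es ! j = (\<sigma> (Arr 0 (6 + 3 * j)), \<sigma> (Arr 0 (7 + 3 * j)), \<sigma> (Arr 0 (8 + 3 * j)))"
      using encode_nth[OF j, of 0 n s t k] encode_nth[OF j, of 1 n s t k] encode_nth[OF j, of 2 n s t k]
      by (simp add: case_prod_beta algebra_simps prod_eq_iff)
  qed
qed

lemma reach_halts:
  assumes "reach P T (init xs) (length P, m)" "m 0 = y"
  shows "\<exists>t \<le> T. halts_with P xs t y"
  using assms unfolding reach_def halts_with_def halted_def by force

definition machine :: "nat \<Rightarrow> nat list \<Rightarrow> instr list" where
  "machine a w = (let nv = 24 + 2 * length w in prelude nv @ compile nv 35 (program a w))"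

lemma machine_correct:
  assumes "wf_graph n es" "s < n" "t < n"
  shows "\<exists>l. 2 ^ l \<le> 2 * n \<and>
    (let K = 2 * k + length w; M = 3 + l * K ^ 2; B = n + length es + Suc k + K + M ^ Suc k in
     \<exists>T \<le> 10 * (5 + 3 * length es) + 26 + time_bound (24 + 2 * length w) B (program a w).
       halts_with (machine a w) (encode n es s t k) T (if SimplePath (lang_akwa a w k) es s t then 1 else 0))"
proof -
  let ?nv = "24 + 2 * length w" and ?P = "machine a w"
  have P: "?P = prelude ?nv @ compile ?nv 35 (program a w)" by (simp add: machine_def Let_def)
  have C: "code_at ?P 0 (prelude ?nv)" "code_at ?P 35 (compile ?nv 35 (program a w))"
    using code_at_whole[of ?P] unfolding P code_at_append[of _ 0 "prelude ?nv"] by simp_all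
  obtain m \<sigma> where m: "reach ?P (10 * (5 + 3 * length es) + 26) (init (encode n es s t k)) (35, m)"
    "represents ?nv \<sigma> m"
    and \<sigma>: "\<sigma> (Var 4) = 5 + 3 * length es" "\<sigma> (Arr 1 (5 + 3 * length es)) = n"
    "\<sigma> (Arr 2 (5 + 3 * length es)) = s" "\<sigma> (Arr 3 (5 + 3 * length es)) = t"
    "\<sigma> (Arr 4 (5 + 3 * length es)) = k" "\<sigma> (Arr 5 (5 + 3 * length es)) = length es"
    "\<And>j. j < length es \<Longrightarrow>
      es ! j = (\<sigma> (Arr 0 (6 + 3 * j)), \<sigma> (Arr 0 (7 + 3 * j)), \<sigma> (Arr 0 (8 + 3 * j)))"
    using prelude_correct[OF C(1), where n = n and es = es and s = s and t = t and k = k] by auto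
  obtain l where l: "2 ^ l \<le> 2 * n"
    "bounded_loops (n + length es + Suc k + (2 * k + length w) + (3 + l * (2 * k + length w) ^ 2) ^ Suc k)
      (program a w) \<sigma>"
    "sem (program a w) \<sigma> (Var 0) = (if SimplePath (lang_akwa a w k) es s t then 1 else 0)"
    using program_correct[OF \<sigma> assms, where a = a and w = w] unfolding Let_def by blast
  let ?B = "n + length es + Suc k + (2 * k + length w) + (3 + l * (2 * k + length w) ^ 2) ^ Suc k"
  obtain m' where m': "reach ?P (time_bound ?nv ?B (program a w)) (35, m)
      (35 + length (compile ?nv 35 (program a w)), m')" "represents ?nv (sem (program a w) \<sigma>) m'"
    using compile_correct[OF C(2) wfC_program l(2) m(2)] by auto
  have "35 + length (compile ?nv 35 (program a w)) = length ?P" unfolding P by simp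
  then have "reach ?P (10 * (5 + 3 * length es) + 26 + time_bound ?nv ?B (program a w))
     (init (encode n es s t k)) (length ?P, m')"
    using reach_trans[OF m(1) m'(1)] by simp
  moreover have "m' 0 = (if SimplePath (lang_akwa a w k) es s t then 1 else 0)"
    using m'(2) l(3) unfolding represents_def by (auto dest!: spec[of _ "Var 0"])
  ultimately show ?thesis using l(1) reach_halts unfolding Let_def by blast
qed

subsection \<open>The running time\<close>

text \<open>For \<open>j = x div q\<close> one has
  \<open>x \<le> q * (j + 1) \<le> q * 2 ^ j\<close>, and the \<open>q\<close>-th power of
  \<open>2 ^ j\<close> is at most \<open>2 ^ x\<close>. With a logarithm for \<open>x\<close>, the
  second factor becomes linear in the size.\<close>

lemma power_le_self_power_exp: "(x::nat) ^ q \<le> q ^ q * 2 ^ x"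
proof (cases "q = 0")
  case False
  define j where "j = x div q"
  have "x = q * j + x mod q" unfolding j_def by simp
  moreover have "x mod q < q" using False by simp
  ultimately have "x \<le> q * Suc j" unfolding mult_Suc_right by linarith
  also have "\<dots> \<le> q * 2 ^ j" using less_exp[of j] by (intro mult_le_mono2) (simp add: Suc_le_eq)
  finally have "x ^ q \<le> (q * 2 ^ j) ^ q" by (rule power_mono) simp
  also have "\<dots> = q ^ q * 2 ^ (j * q)" by (simp add: power_mult_distrib power_mult)
  also have "\<dots> \<le> q ^ q * 2 ^ x" unfolding j_def by (intro mult_le_mono2 power_increasing) auto
  finally show ?thesis .
qed simp

text \<open>The factor \<open>K ^ 2 + 3\<close> does not involve \<open>n\<close> and goes into the
  exponential. The remaining power of \<open>Suc l\<close> is split by the preceding estimate, where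
  \<open>2 ^ Suc l \<le> 4 * n\<close>.\<close>

lemma loop_limit_bound:
  fixes k c l n d :: nat
  assumes "2 ^ l \<le> 2 * n"
  shows "((3 + l * (2 * k + c) ^ 2) ^ Suc k) ^ d \<le> 2 ^ (((2 * c + 4) * d + d * d) * (k + 2) ^ 2) * (4 * n)"
proof -
  define q K where "q = Suc k * d" and "K = 2 * k + c"
  have "K + 2 \<le> 2 ^ (K + 2)" using less_exp[of "K + 2"] by simp
  then have "(K + 2) ^ 2 \<le> (2 ^ (K + 2)) ^ 2" by (rule power_mono) simp
  also have "\<dots> = 2 ^ (2 * (K + 2))" by (metis mult.commute power_mult)
  also have "\<dots> \<le> 2 ^ ((2 * c + 4) * (k + 2))"
    unfolding K_def by (intro power_increasing) (auto simp: algebra_simps)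
  finally have K: "K ^ 2 + 3 \<le> 2 ^ ((2 * c + 4) * (k + 2))" by (simp add: power2_eq_square algebra_simps)
  have "3 + l * K ^ 2 \<le> (K ^ 2 + 3) * Suc l" by (simp add: algebra_simps)
  then have "(3 + l * K ^ 2) ^ q \<le> ((K ^ 2 + 3) * Suc l) ^ q" by (rule power_mono) simp
  also have "\<dots> = (K ^ 2 + 3) ^ q * Suc l ^ q" by (rule power_mult_distrib)
  also have "\<dots> \<le> (2 ^ ((2 * c + 4) * (k + 2))) ^ q * (q ^ q * 2 ^ Suc l)"
    using K by (intro mult_mono power_mono power_le_self_power_exp) auto
  also have "\<dots> \<le> 2 ^ ((2 * c + 4) * d * (k + 2) ^ 2) * (2 ^ (d * d * (k + 2) ^ 2) * (4 * n))"
  proof (intro mult_le_mono)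
    have "((2::nat) ^ ((2 * c + 4) * (k + 2))) ^ q = 2 ^ ((2 * c + 4) * (k + 2) * q)"
      by (simp only: power_mult)
    also have "\<dots> \<le> 2 ^ ((2 * c + 4) * d * (k + 2) ^ 2)"
    proof (rule power_increasing)
      have "(k + 2) * q \<le> d * (k + 2) ^ 2" unfolding q_def by (simp add: power2_eq_square algebra_simps)
      then have "(2 * c + 4) * ((k + 2) * q) \<le> (2 * c + 4) * (d * (k + 2) ^ 2)" by (rule mult_le_mono2)
      then show "(2 * c + 4) * (k + 2) * q \<le> (2 * c + 4) * d * (k + 2) ^ 2" by (simp only: mult.assoc)
    qed simp
    finally show "((2::nat) ^ ((2 * c + 4) * (k + 2))) ^ q \<le> 2 ^ ((2 * c + 4) * d * (k + 2) ^ 2)" .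
    have "q ^ q \<le> (2 ^ q) ^ q" using less_exp[of q] by (intro power_mono) auto
    also have "\<dots> = 2 ^ (q * q)" by (simp only: power_mult)
    also have "\<dots> \<le> 2 ^ (d * d * (k + 2) ^ 2)"
    proof (rule power_increasing)
      have "q \<le> d * (k + 2)" unfolding q_def by (simp add: algebra_simps)
      then have "q * q \<le> (d * (k + 2)) * (d * (k + 2))" by (intro mult_le_mono)
      then show "q * q \<le> d * d * (k + 2) ^ 2" by (simp only: power2_eq_square mult_ac)
    qed simp
    finally show "q ^ q \<le> 2 ^ (d * d * (k + 2) ^ 2)" .
    show "2 ^ Suc l \<le> 4 * n" using assms by simp
  qed
  also have "\<dots> = 2 ^ (((2 * c + 4) * d + d * d) * (k + 2) ^ 2) * (4 * n)"
    by (simp only: add_mult_distrib power_add mult.assoc)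
  finally show ?thesis unfolding q_def K_def by (simp only: power_mult[symmetric])
qed

text \<open>The time is a power of a linear term times \<open>N\<close>; the power of
  \<open>N\<close> contributes the exponential in \<open>k\<close> and one factor
  \<open>4 * x\<close>. Constants move into the exponent by \<open>y \<le> x ^ y\<close>, which uses
  \<open>x \<ge> 2\<close>.\<close>

lemma time_bound_FPT:
  fixes k c l n e d x :: nat
  assumes "2 ^ l \<le> 2 * n" "n \<ge> 1" and x: "x = n + e + k + 2"
    and T: "T \<le> (n + e + Suc k + (2 * k + c) + (3 + l * (2 * k + c) ^ 2) ^ Suc k + 2) ^ d"
  shows "10 * (5 + 3 * e) + 26 + T \<le>
    2 ^ (((2 * c + 4) * d + d * d) * (k + 2) ^ 2) * x ^ (4 * (c + 6) ^ d + d + 78)"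
proof -
  define N f where "N = (3 + l * (2 * k + c) ^ 2) ^ Suc k"
    and "f = (2::nat) ^ (((2 * c + 4) * d + d * d) * (k + 2) ^ 2)"
  have N: "N \<ge> 1" unfolding N_def by simp
  have f: "f \<ge> 1" unfolding f_def by simp
  have x2: "x \<ge> 2" using x by simp
  have xp: "y \<le> x ^ y" for y :: nat
    using le_power_const[of y "x - 2"] x2 by simp
  have "n + e + Suc k + (2 * k + c) + N + 2 \<le> (c + 6) * x * N"
  proof -
    have "n + e + Suc k + (2 * k + c) + 2 \<le> (c + 4) * x" using x by (simp add: algebra_simps)
    also have "\<dots> \<le> (c + 4) * x * N" using N by simp
    finally have "n + e + Suc k + (2 * k + c) + 2 + N \<le> (c + 4) * x * N + x * N"
      using x2 by (intro add_mono) auto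
    also have "\<dots> \<le> (c + 6) * x * N" by (simp add: algebra_simps)
    finally show ?thesis by simp
  qed
  then have "(n + e + Suc k + (2 * k + c) + N + 2) ^ d \<le> ((c + 6) * x * N) ^ d" by (rule power_mono) simp
  also have "\<dots> = (c + 6) ^ d * x ^ d * N ^ d" by (simp only: power_mult_distrib)
  also have "\<dots> \<le> (c + 6) ^ d * x ^ d * (f * (4 * x))"
  proof (rule mult_le_mono2)
    have "N ^ d \<le> f * (4 * n)" unfolding N_def f_def by (rule loop_limit_bound[OF assms(1)])
    also have "\<dots> \<le> f * (4 * x)" using x by simp
    finally show "N ^ d \<le> f * (4 * x)" .
  qed
  also have "\<dots> = f * ((4 * (c + 6) ^ d) * (x ^ d * x))" by (simp only: mult_ac)
  also have "\<dots> \<le> f * (x ^ (4 * (c + 6) ^ d) * (x ^ d * x))"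
    by (intro mult_le_mono2 mult_le_mono1 xp)
  also have "\<dots> = f * x ^ (4 * (c + 6) ^ d + d + 1)" by (simp add: power_add)
  finally have "T \<le> f * x ^ (4 * (c + 6) ^ d + d + 1)" using T unfolding N_def by simp
  also have "\<dots> \<le> f * x ^ (4 * (c + 6) ^ d + d + 77)"
    using x2 by (intro mult_le_mono2 power_increasing) auto
  finally have T': "T \<le> f * x ^ (4 * (c + 6) ^ d + d + 77)" .
  \<comment> \<open>The left side is \<open>30 * e + 76\<close>. Adding the two parts later costs a
    factor 2, absorbed by one more \<open>x\<close>; this turns the exponent summand 77 into
    78.\<close>
  have "10 * (5 + 3 * e) + 26 \<le> 76 * x" using x by simp
  also have "\<dots> \<le> x ^ 76 * x" using xp[of 76] by (rule mult_le_mono1)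
  also have "\<dots> = x ^ 77" by (simp flip: power_Suc2)
  also have "\<dots> \<le> x ^ (4 * (c + 6) ^ d + d + 77)" using x2 by (intro power_increasing) auto
  also have "\<dots> \<le> f * x ^ (4 * (c + 6) ^ d + d + 77)" using f by simp
  finally have "10 * (5 + 3 * e) + 26 + T \<le> 2 * (f * x ^ (4 * (c + 6) ^ d + d + 77))" using T' by simp
  also have "\<dots> \<le> x * (f * x ^ (4 * (c + 6) ^ d + d + 77))" using x2 by (rule mult_le_mono1)
  also have "\<dots> = f * x ^ (4 * (c + 6) ^ d + d + 78)" by (simp add: power_add numeral_eq_Suc)
  finally show ?thesis unfolding f_def .
qed

section \<open>Computability of the parameter function\<close>

definition exp_prog :: "nat \<Rightarrow> cmd" where
  "exp_prog C =
     Asg 2 (Plus (X 1) (N 2)) ;; Asg 3 (N C) ;; Asg 0 (N 1) ;;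
     For 4 2 (For 5 2 (For 6 3 (Asg 0 (Plus (X 0) (X 0)))))"

text \<open>Nesting the loops multiplies their limits, so the doubling is executed
  \<open>(k + 2) * (k + 2) * C\<close> times without a multiplication in the language.\<close>

lemma exp_prog_correct:
  assumes "\<sigma> (Var 1) = k"
  shows "sem (exp_prog C) \<sigma> (Var 0) = 2 ^ (C * (k + 2) ^ 2)"
proof -
  let ?c = "For 6 3 (Asg 0 (Plus (X 0) (X 0)))"
  have 1: "sem ?c s (Var 0) = s (Var 0) * 2 ^ C" if "s (Var 3) = C" for s
    by (rule For_rule[where I = "\<lambda>i \<tau>. \<tau> (Var 0) = s (Var 0) * 2 ^ i"]) (use that in auto)
  have 2: "sem (For 5 2 ?c) s (Var 0) = s (Var 0) * 2 ^ (C * (k + 2))"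
    if s: "s (Var 3) = C" "s (Var 2) = k + 2" for s
  proof (rule For_rule[where I = "\<lambda>i \<tau>. \<tau> (Var 0) = s (Var 0) * 2 ^ (C * i)"])
    fix i \<tau> assume I: "\<tau> (Var 0) = s (Var 0) * 2 ^ (C * i)"
      and fr: "\<And>l. l \<notin> writes (For 5 2 ?c) \<Longrightarrow> \<tau> l = s l"
    have "\<tau> (Var 3) = C" using fr[of "Var 3"] s by simp
    from 1[of \<tau>, OF this] I show "((sem ?c \<tau>)(Var 5 := Suc i)) (Var 0) = s (Var 0) * 2 ^ (C * Suc i)"
      by (simp add: power_add del: sem.simps)
  qed (use s in auto)
  have 3: "sem (For 4 2 (For 5 2 ?c)) s (Var 0) = s (Var 0) * 2 ^ (C * (k + 2) * (k + 2))"
    if s: "s (Var 3) = C" "s (Var 2) = k + 2" for s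
  proof (rule For_rule[where I = "\<lambda>i \<tau>. \<tau> (Var 0) = s (Var 0) * 2 ^ (C * (k + 2) * i)"])
    fix i \<tau> assume I: "\<tau> (Var 0) = s (Var 0) * 2 ^ (C * (k + 2) * i)"
      and fr: "\<And>l. l \<notin> writes (For 4 2 (For 5 2 ?c)) \<Longrightarrow> \<tau> l = s l"
    have "\<tau> (Var 3) = C" "\<tau> (Var 2) = k + 2" using fr[of "Var 3"] fr[of "Var 2"] s by simp_all
    from 2[of \<tau>, OF this] I
    show "((sem (For 5 2 ?c) \<tau>)(Var 4 := Suc i)) (Var 0) = s (Var 0) * 2 ^ (C * (k + 2) * Suc i)"
      by (simp add: power_add del: sem.simps)
  qed (use s in auto)
  let ?s = "sem (Asg 2 (Plus (X 1) (N 2)) ;; Asg 3 (N C) ;; Asg 0 (N 1)) \<sigma>"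
  have "?s (Var 3) = C" "?s (Var 2) = k + 2" "?s (Var 0) = 1" using assms by simp_all
  from 3[of ?s, OF this(1,2)] this(3)
  have "sem (exp_prog C) \<sigma> (Var 0) = 2 ^ (C * (k + 2) * (k + 2))"
    unfolding exp_prog_def by (simp del: sem.simps(6))
  then show ?thesis by (simp only: power2_eq_square mult.assoc)
qed

lemma computable_exp: "computable (\<lambda>k. 2 ^ (C * (k + 2) ^ 2))"
  unfolding computable_def
proof (intro exI allI)
  fix k
  let ?P = "compile 24 0 (exp_prog C)"
  define \<sigma> where "\<sigma> l = snd (init [k]) (address 24 l)" for l
  let ?B = "k + 2 + C"
  have r: "represents 24 \<sigma> (snd (init [k]))" by (simp add: represents_def \<sigma>_def)
  have "wfC 24 (exp_prog C)" by (simp add: exp_prog_def)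
  have \<sigma>1: "\<sigma> (Var 1) = k" by (simp add: \<sigma>_def init_def)
  have "bounded_loops ?B (For 4 2 (For 5 2 (For 6 3 (Asg 0 (Plus (X 0) (X 0))))))
    (sem (Asg 2 (Plus (X 1) (N 2)) ;; Asg 3 (N C) ;; Asg 0 (N 1)) \<sigma>)"
    by (rule bounded_loopsI) (use \<sigma>1 in auto)
  then have "bounded_loops ?B (exp_prog C) \<sigma>"
    unfolding exp_prog_def by (simp del: bounded_loops.simps(6))
  from compile_correct[OF code_at_whole \<open>wfC 24 (exp_prog C)\<close> this r]
  obtain m where "reach ?P (time_bound 24 ?B (exp_prog C)) (0, snd (init [k])) (length ?P, m)"
    "represents 24 (sem (exp_prog C) \<sigma>) m" by auto
  moreover from this(2) have "m 0 = 2 ^ (C * (k + 2) ^ 2)"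
    using exp_prog_correct[of \<sigma> k C, OF \<sigma>1] unfolding represents_def by (auto dest!: spec[of _ "Var 0"])
  moreover have "(0, snd (init [k])) = init [k]" by (simp add: init_def)
  ultimately have "\<exists>t \<le> time_bound 24 ?B (exp_prog C). halts_with ?P [k] t (2 ^ (C * (k + 2) ^ 2))"
    using reach_halts[of ?P _ "[k]" m] by (simp del: power2_eq_square)
  then show "halts_with ?P [k] (SOME t. halts_with ?P [k] t (2 ^ (C * (k + 2) ^ 2))) (2 ^ (C * (k + 2) ^ 2))"
    by (metis someI_ex)
qed

theorem mainTheorem12:
  fixes a :: nat and w :: "nat list"
  shows "FPT (\<lambda>n es s t k. SimplePath (lang_akwa a w k) es s t)"
proof -
  let ?nv = "24 + 2 * length w" and ?c = "length w"
  \<comment> \<open>\<open>d\<close> depends on the program alone, hence on \<open>a\<close> and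
    \<open>w\<close>; so \<open>f\<close> and the exponent are fixed before any instance is
    given.\<close>
  obtain d where d: "\<And>B. time_bound ?nv B (program a w) \<le> (B + 2) ^ d"
    using time_bound_polynomial[of ?nv "program a w"] by blast
  define f where "f k = (2::nat) ^ (((2 * ?c + 4) * d + d * d) * (k + 2) ^ 2)" for k
  have "computable f" unfolding f_def by (rule computable_exp)
  moreover have "\<exists>T \<le> f k * (graph_size n es + k + 2) ^ (4 * (?c + 6) ^ d + d + 78).
      halts_with (machine a w) (encode n es s t k) T (if SimplePath (lang_akwa a w k) es s t then 1 else 0)"
    if "wf_graph n es \<and> s < n \<and> t < n" for n es s t k
  proof -
    let ?B = "\<lambda>l. n + length es + Suc k + (2 * k + ?c) + (3 + l * (2 * k + ?c) ^ 2) ^ Suc k"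
    have "wf_graph n es" "s < n" "t < n" using that by auto
    from machine_correct[OF this, of k w a, unfolded Let_def] obtain l where l: "2 ^ l \<le> 2 * n"
      and "\<exists>T \<le> 10 * (5 + 3 * length es) + 26 + time_bound ?nv (?B l) (program a w).
        halts_with (machine a w) (encode n es s t k) T (if SimplePath (lang_akwa a w k) es s t then 1 else 0)"
      by - (erule exE, erule conjE, rule that)
    then obtain T where T: "T \<le> 10 * (5 + 3 * length es) + 26 + time_bound ?nv (?B l) (program a w)"
      "halts_with (machine a w) (encode n es s t k) T (if SimplePath (lang_akwa a w k) es s t then 1 else 0)"
      by - (erule exE, erule conjE, rule that)
    have "n \<ge> 1" using that by auto
    from time_bound_FPT[OF l this refl d] T(1)
    have "T \<le> f k * (graph_size n es + k + 2) ^ (4 * (?c + 6) ^ d + d + 78)"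
      unfolding f_def graph_size_def by (rule order_trans[rotated])
    with T(2) show ?thesis by blast
  qed
  ultimately show ?thesis unfolding FPT_def by blast
qed

end
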